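(* Let $d\ge1$, $\beta\in\{1,2\}$, $H=\frac{1}{2\beta+d}$, $X\in G^{H,d}_L$, $f\in\Theta^\beta$, $\lambda\in\mathbb{R}^d$, $0\le a<b<\infty$ and $m\in\mathbb{N}$. Let $I^n_{m,k}$, $k=0,1,\dots,m$, $n\ge2$, be the quantities defined in the context. Then for $k=1,2,\dots,m$ there exists a positive constant $c$, not depending on $n$, such that $$|I^n_{m,k-1}-I^n_{m,k}|\le c\,(b-a)^{\frac{m(1-Hd)}{2}}(\ln n)^{-\frac12}.$$
   Context: Quantities $I^n_{m,k}$. Let $\ell_{n,H,d}=(\ln n)^{-\frac12}n^{\frac{Hd+1}{2}}$, $c_{m,d}=\frac{m!}{(2\pi)^{md}}$ and $D_m=\{(s_1,\dots,s_m):na<s_1<\dots<s_m<nb\}$, with conventions $s_0=0$, $x_{m+1}=0$, and $\iota=\sqrt{-1}$. For $k=0,1,\dots,m$, $$I^n_{m,k}=c_{m,d}\,\ell_{n,H,d}^m\,n^{-m}\int_{\mathbb{R}^{md}}\int_{D_m}I_k\prod_{i=k+1}^m(\widehat f(x_i-x_{i+1})-\widehat f(0))\exp\Big(-\iota n^H\lambda\cdot x_1-\frac12\mathrm{Var}\big(\sum_{i=1}^mx_i\cdot(X_{s_i}-X_{s_{i-1}})\big)\Big)ds\,dx,$$ where $I_0=1$, $I_k=\prod_{j=1}^{(k-1)/2}|\widehat f(x_{2j})-\widehat f(0)|^2\,(\widehat f(-x_{k+1})-\widehat f(0))$ if $k$ is odd, and $I_k=\prod_{j=1}^{k/2}|\widehat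 f(x_{2j})-\widehat f(0)|^2$ if $k\geq 2$ is even. (Thus $I^n_{m,0}=\mathbb{E}[(F_n(b)-F_n(a))^m]$ with $F_n(t)=\ell_{n,H,d}(\int_0^tf(n^H(X_s-\lambda))ds-n^{-Hd}L_t(\lambda)\int_{\mathbb{R}^d}f(x)dx)$, $L_t(\lambda)$ the local time of $X$ at $\lambda$.) Fourier transform: $\widehat f(y)=\int_{\mathbb{R}^d}e^{\iota y\cdot x}f(x)dx$. Function class (real-valued $f$): $\Theta^1=\{f\in L^2(\mathbb{R}^d):\int_{\mathbb{R}^d}|f(x)||x| dx<\infty\}$ and $\Theta^2=\{f\in L^2(\mathbb{R}^d):\int_{\mathbb{R}^d}|f(x)||x|^2 dx<\infty,\ \int_{\mathbb{R}^d}xf(x)dx=0\}$. Process. $X=\{X_t=(X^1_t,\dots,X^d_t),\,t\ge0\}$ denotes a $d$-dimensional centered Gaussian process with continuous sample paths whose components are independent copies of a one-dimensional centered Gaussian process. Self-similarity with index $H$: for every $a>0$, $(X_{at})_{t\ge0}$ and $(a^HX_t)_{t\ge0}$ have the same law. Strong local nondeterminism: there is $\kappa_H>0$ such that for any integer $m\ge1$ and any times $0=s_0<s_1\le\dots\le s_m<t<\infty$, $\mathrm{Var}(X^1_t\mid X^1_{s_1},\dots,X^1_{s_m})\ge\kappa_H\min_{1\le j\le m}|t-s_j|^{2H}$. Assumption (A): there exist $\eta\ge1$, $\sigma>0$ and a non-negative non-decreasing function $\phi$ on $[0,1/\eta]$ with $\lim_{\varepsilon\to0}\phi(\varepsilon)=0$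 such that for all $t>0$ and $h\in[0,t/\eta]$, $0\le h^{2H}(\sigma-\phi(h/t))\le\mathrm{Var}(X^1_{t+h}-X^1_t)\le h^{2H}(\sigma+\phi(h/t))$. Assumption (B): there exists a non-negative non-increasing function $\psi$ on $(1,\infty)$ with $\lim_{\eta\to\infty}\psi(\eta)=0$ such that for any $0<t_1<t_2<t_3<t_4<\infty$ and $\eta>1$, with $\Delta t_i=t_i-t_{i-1}$, if (i) $\Delta t_2/\Delta t_4\le1/\eta$ or (ii) $\Delta t_2/\Delta t_4\ge\eta$ or (iii) $\max\{\Delta t_2,\Delta t_4\}/\Delta t_3\le1/\eta$, then $|\mathbb{E}(X^1_{t_4}-X^1_{t_3})(X^1_{t_2}-X^1_{t_1})|\le\psi(\eta)[\mathbb{E}(X^1_{t_4}-X^1_{t_3})^2]^{1/2}[\mathbb{E}(X^1_{t_2}-X^1_{t_1})^2]^{1/2}$. $G^{H,d}_L$ is the class of all such $X$ satisfying self-similarity with index $H$, strong local nondeterminism, (A) and (B). *)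

theory Defs
  imports "HOL-Probability.Probability"
begin

section \<open>Gaussian processes indexed by the half-line\<close>

text \<open>A process is a family \<open>Y t\<close> of random variables of which only the times \<open>t \<ge> 0\<close> matter;
  its law is the image measure on the product space of paths over \<open>{0..}\<close>.\<close>

definition process_law ::
  "'w measure \<Rightarrow> (real \<Rightarrow> 'w \<Rightarrow> 'v::topological_space) \<Rightarrow> (real \<Rightarrow> 'v) measure"
where
  "process_law M Y =
     distr M (Pi\<^sub>M {0..} (\<lambda>_. borel)) (\<lambda>\<omega>. \<lambda>t\<in>{0..}. Y t \<omega>)"

text \<open>The degenerate law (the Dirac mass at 0) counts as centered Gaussian.\<close>

definition centered_gaussian_rv :: "'w measure \<Rightarrow> ('w \<Rightarrow> real) \<Rightarrow> bool" where
  "centered_gaussian_rv M Z \<longleftrightarrow>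
     Z \<in> borel_measurable M \<and>
     (distr M borel Z = return borel 0 \<or>
      (\<exists>\<tau>>0. distributed M lborel Z (normal_density 0 \<tau>)))"

definition centered_gaussian_process ::
  "'w measure \<Rightarrow> (real \<Rightarrow> 'w \<Rightarrow> 'v::euclidean_space) \<Rightarrow> bool"
where
  "centered_gaussian_process M Y \<longleftrightarrow>
     (\<forall>t\<ge>0. Y t \<in> borel_measurable M) \<and>
     (\<forall>T c. finite T \<longrightarrow> T \<subseteq> {0..} \<longrightarrow>
        centered_gaussian_rv M (\<lambda>\<omega>. \<Sum>t\<in>T. c t \<bullet> Y t \<omega>))"

definition iid_components ::
  "'w measure \<Rightarrow> (real \<Rightarrow> 'w \<Rightarrow> real^'d::finite) \<Rightarrow> bool"
where
  "iid_components M X \<longleftrightarrow>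
     prob_space.indep_vars M (\<lambda>_. Pi\<^sub>M {0..} (\<lambda>_. borel))
       (\<lambda>i \<omega>. \<lambda>t\<in>{0..}. X t \<omega> $ i) UNIV \<and>
     (\<forall>i j. process_law M (\<lambda>t \<omega>. X t \<omega> $ i) = process_law M (\<lambda>t \<omega>. X t \<omega> $ j))"

definition self_similar ::
  "'w measure \<Rightarrow> real \<Rightarrow> (real \<Rightarrow> 'w \<Rightarrow> 'v::euclidean_space) \<Rightarrow> bool"
where
  "self_similar M H Y \<longleftrightarrow>
     (\<forall>a>0. process_law M (\<lambda>t. Y (a * t)) =
            process_law M (\<lambda>t \<omega>. (a powr H) *\<^sub>R Y t \<omega>))"

text \<open>The sigma-algebra generated by \<open>Y (s 1), \<dots>, Y (s m)\<close>.\<close>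

definition sigma_of_times ::
  "'w measure \<Rightarrow> (real \<Rightarrow> 'w \<Rightarrow> real) \<Rightarrow> nat \<Rightarrow> (nat \<Rightarrow> real) \<Rightarrow> 'w measure"
where
  "sigma_of_times M Y m s =
     vimage_algebra (space M) (\<lambda>\<omega>. \<lambda>j\<in>{1..m}. Y (s j) \<omega>) (Pi\<^sub>M {1..m} (\<lambda>_. borel))"

definition cond_variance ::
  "'w measure \<Rightarrow> 'w measure \<Rightarrow> ('w \<Rightarrow> real) \<Rightarrow> 'w \<Rightarrow> real"
where
  "cond_variance M F Z = real_cond_exp M F (\<lambda>\<omega>. (Z \<omega> - real_cond_exp M F Z \<omega>)\<^sup>2)"

definition strong_local_nondeterminism ::
  "'w measure \<Rightarrow> real \<Rightarrow> (real \<Rightarrow> 'w \<Rightarrow> real) \<Rightarrow> bool"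
where
  "strong_local_nondeterminism M H Y \<longleftrightarrow>
     (\<exists>\<kappa>>0. \<forall>m\<ge>1. \<forall>(s :: nat \<Rightarrow> real) t.
        0 < s 1 \<longrightarrow> mono_on {1..m} s \<longrightarrow> s m < t \<longrightarrow>
        (AE \<omega> in M. cond_variance M (sigma_of_times M Y m s) (Y t) \<omega>
           \<ge> \<kappa> * (MIN j\<in>{1..m}. \<bar>t - s j\<bar> powr (2 * H))))"

definition assumption_A :: "'w measure \<Rightarrow> real \<Rightarrow> (real \<Rightarrow> 'w \<Rightarrow> real) \<Rightarrow> bool" where
  "assumption_A M H Y \<longleftrightarrow>
     (\<exists>\<eta>\<ge>1. \<exists>\<sigma>>0. \<exists>\<phi> :: real \<Rightarrow> real.
        (\<forall>\<epsilon>\<in>{0..1/\<eta>}. 0 \<le> \<phi> \<epsilon>) \<and> mono_on {0..1/\<eta>} \<phi> \<and> (\<phi> \<longlongrightarrow> 0) (at_right 0) \<and>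
        (\<forall>t>0. \<forall>h\<in>{0..t/\<eta>}.
           0 \<le> h powr (2 * H) * (\<sigma> - \<phi> (h / t)) \<and>
           h powr (2 * H) * (\<sigma> - \<phi> (h / t))
             \<le> prob_space.variance M (\<lambda>\<omega>. Y (t + h) \<omega> - Y t \<omega>) \<and>
           prob_space.variance M (\<lambda>\<omega>. Y (t + h) \<omega> - Y t \<omega>)
             \<le> h powr (2 * H) * (\<sigma> + \<phi> (h / t))))"

definition assumption_B :: "'w measure \<Rightarrow> (real \<Rightarrow> 'w \<Rightarrow> real) \<Rightarrow> bool" where
  "assumption_B M Y \<longleftrightarrow>
     (\<exists>\<psi> :: real \<Rightarrow> real.
        (\<forall>\<eta>>1. 0 \<le> \<psi> \<eta>) \<and> antimono_on {1<..} \<psi> \<and> (\<psi> \<longlongrightarrow> 0) at_top \<and>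
        (\<forall>t1 t2 t3 t4 \<eta>. 0 < t1 \<longrightarrow> t1 < t2 \<longrightarrow> t2 < t3 \<longrightarrow> t3 < t4 \<longrightarrow> \<eta> > 1 \<longrightarrow>
           (t2 - t1) / (t4 - t3) \<le> 1 / \<eta> \<or>
           (t2 - t1) / (t4 - t3) \<ge> \<eta> \<or>
           max (t2 - t1) (t4 - t3) / (t3 - t2) \<le> 1 / \<eta> \<longrightarrow>
           \<bar>prob_space.expectation M (\<lambda>\<omega>. (Y t4 \<omega> - Y t3 \<omega>) * (Y t2 \<omega> - Y t1 \<omega>))\<bar>
             \<le> \<psi> \<eta> * sqrt (prob_space.expectation M (\<lambda>\<omega>. (Y t4 \<omega> - Y t3 \<omega>)\<^sup>2))
                   * sqrt (prob_space.expectation M (\<lambda>\<omega>. (Y t2 \<omega> - Y t1 \<omega>)\<^sup>2))))"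

text \<open>The class \<open>G\<^sub>L\<^bsup>H,d\<^esup>\<close> with \<open>d = CARD('d)\<close>. The conditions on the first component are stated
  for every component; since the components are identically distributed this is the same.\<close>

definition G_L :: "'w measure \<Rightarrow> real \<Rightarrow> (real \<Rightarrow> 'w \<Rightarrow> real^'d::finite) \<Rightarrow> bool" where
  "G_L M H X \<longleftrightarrow>
     prob_space M \<and>
     centered_gaussian_process M X \<and>
     (\<forall>\<omega>\<in>space M. continuous_on {0..} (\<lambda>t. X t \<omega>)) \<and>
     iid_components M X \<and>
     self_similar M H X \<and>
     (\<forall>i. strong_local_nondeterminism M H (\<lambda>t \<omega>. X t \<omega> $ i) \<and>
          assumption_A M H (\<lambda>t \<omega>. X t \<omega> $ i) \<and>
          assumption_B M (\<lambda>t \<omega>. X t \<omega> $ i))"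

section \<open>Function classes and the Fourier transform\<close>

definition L2_functions :: "(real^'d::finite \<Rightarrow> real) set" where
  "L2_functions = {f \<in> borel_measurable lebesgue. integrable lebesgue (\<lambda>x. (f x)\<^sup>2)}"

definition Theta1 :: "(real^'d::finite \<Rightarrow> real) set" where
  "Theta1 = {f \<in> L2_functions. integrable lebesgue (\<lambda>x. \<bar>f x\<bar> * norm x)}"

definition Theta2 :: "(real^'d::finite \<Rightarrow> real) set" where
  "Theta2 = {f \<in> L2_functions. integrable lebesgue (\<lambda>x. \<bar>f x\<bar> * (norm x)\<^sup>2) \<and>
                               (LINT x|lebesgue. f x *\<^sub>R x) = 0}"

text \<open>Only the indices 1 and 2 are meaningful.\<close>

definition Theta :: "nat \<Rightarrow> (real^'d::finite \<Rightarrow> real) set" where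
  "Theta \<beta> = (if \<beta> = 1 then Theta1 else Theta2)"

definition fourier :: "(real^'d::finite \<Rightarrow> real) \<Rightarrow> real^'d \<Rightarrow> complex" where
  "fourier f y = (LINT x|lebesgue. exp (\<i> * of_real (y \<bullet> x)) * of_real (f x))"

section \<open>The quantities \<open>I\<^sup>n\<^sub>m\<^sub>,\<^sub>k\<close>\<close>

definition ell :: "nat \<Rightarrow> real \<Rightarrow> nat \<Rightarrow> real" where
  "ell n H d = ln (real n) powr (- 1/2) * real n powr ((H * real d + 1) / 2)"

definition c_const :: "nat \<Rightarrow> nat \<Rightarrow> real" where
  "c_const m d = fact m / (2 * pi) ^ (m * d)"

definition D_set :: "nat \<Rightarrow> real \<Rightarrow> real \<Rightarrow> nat \<Rightarrow> (nat \<Rightarrow> real) set" where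
  "D_set n a b m =
     {s \<in> {1..m} \<rightarrow>\<^sub>E {real n * a <..< real n * b}. strict_mono_on {1..m} s}"

definition I_factor ::
  "(real^'d::finite \<Rightarrow> real) \<Rightarrow> nat \<Rightarrow> (nat \<Rightarrow> real^'d) \<Rightarrow> complex"
where
  "I_factor f k x =
     (if k = 0 then 1
      else if odd k then
        (\<Prod>j=1..(k-1) div 2. of_real ((cmod (fourier f (x (2*j)) - fourier f 0))\<^sup>2))
          * (fourier f (- x (k+1)) - fourier f 0)
      else (\<Prod>j=1..k div 2. of_real ((cmod (fourier f (x (2*j)) - fourier f 0))\<^sup>2)))"

text \<open>Here \<open>s\<close> and \<open>x\<close> are taken to be already extended by \<open>s\<^sub>0 = 0\<close> and \<open>x\<^bsub>m+1\<^esub> = 0\<close>.\<close>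

definition I_integrand ::
  "'w measure \<Rightarrow> (real \<Rightarrow> 'w \<Rightarrow> real^'d::finite) \<Rightarrow> real \<Rightarrow> (real^'d \<Rightarrow> real) \<Rightarrow> real^'d \<Rightarrow>
   nat \<Rightarrow> nat \<Rightarrow> nat \<Rightarrow> (nat \<Rightarrow> real^'d) \<Rightarrow> (nat \<Rightarrow> real) \<Rightarrow> complex"
where
  "I_integrand M X H f lam m k n x s =
     I_factor f k x * (\<Prod>i=k+1..m. fourier f (x i - x (i+1)) - fourier f 0)
       * exp (- \<i> * of_real (real n powr H * (lam \<bullet> x 1))
              - of_real (1/2 * prob_space.variance M
                   (\<lambda>\<omega>. \<Sum>i=1..m. x i \<bullet> (X (s i) \<omega> - X (s (i-1)) \<omega>))))"

text \<open>Integration variables are functions on \<open>{1..m}\<close>; the updates below implement the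
  conventions \<open>s\<^sub>0 = 0\<close> and \<open>x\<^bsub>m+1\<^esub> = 0\<close>.\<close>

definition I_quantity ::
  "'w measure \<Rightarrow> (real \<Rightarrow> 'w \<Rightarrow> real^'d::finite) \<Rightarrow> real \<Rightarrow> (real^'d \<Rightarrow> real) \<Rightarrow> real^'d \<Rightarrow>
   real \<Rightarrow> real \<Rightarrow> nat \<Rightarrow> nat \<Rightarrow> nat \<Rightarrow> complex"
where
  "I_quantity M X H f lam a b m k n =
     of_real (c_const m CARD('d) * ell n H CARD('d) ^ m / real n ^ m) *
     (LINT x|Pi\<^sub>M {1..m} (\<lambda>_. lborel).
        (LINT s:D_set n a b m|Pi\<^sub>M {1..m} (\<lambda>_. lborel).
          I_integrand M X H f lam m k n (x(m+1 := 0)) (s(0 := 0))))"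

end

theory Submission
  imports Defs
begin

text \<open>Why the difference of two consecutive quantities gains a factor \<open>(ln n) powr (-1/2)\<close>.

  Write \<open>t(x) = min 1 (norm x)\<close>. The moment conditions on \<open>f\<close> say that the Fourier transform of
  \<open>f\<close> moves slowly: its increment from \<open>y\<close> to \<open>y + u\<close> is at most a constant times
  \<open>t(u) ^ \<beta> + t(u) * t(y) ^ (\<beta> - 1)\<close> (lemma \<open>fourier_increment_bound\<close>). In \<open>I\<^sub>k\<^sub>-\<^sub>1 - I\<^sub>k\<close> all factors
  but one agree, and the remaining one is exactly such an increment. Expanding the product
  (lemma \<open>chain_expansion_vanishing_end\<close>) bounds the integrand by finitely many monomials
  \<open>\<Prod>i. t(x\<^sub>i) ^ q\<^sub>i\<close> of total degree \<open>\<beta> * m\<close>, with every \<open>q\<^sub>i \<le> 2 * \<beta>\<close>. The point of taking the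
  difference is that \<open>0 < q\<^sub>k < 2 * \<beta>\<close> in each of them.

  The Gaussian exponential decouples: strong local nondeterminism, the scaling of the variance and
  the upper bound on the variance of increments give
  \<open>Var (\<Sum>i. x\<^sub>i \<bullet> (X(s\<^sub>i) - X(s\<^sub>i\<^sub>-\<^sub>1))) \<ge> \<kappa> * (\<Sum>i. |x\<^sub>i|\<^sup>2 * (s\<^sub>i - s\<^sub>i\<^sub>-\<^sub>1) powr (2 * H))\<close>
  (lemma \<open>G_L_variance_lower_bound\<close>). Passing to the increments of the times, the integral of
  each monomial is therefore at most a product of integrals over one frequency and one increment
  of length below \<open>n * B\<close>. Doing the frequency integral first, such a factor is bounded by
  \<open>\<integral> u powr (- H * d) * min 1 (u powr (- H * q)) du\<close> over \<open>0 < u < n * B\<close>, which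
  is of order \<open>n powr (H * (2 * \<beta> - q))\<close> when \<open>q < 2 * \<beta>\<close> and of order \<open>ln n\<close> when \<open>q = 2 * \<beta>\<close>,
  because \<open>H * (2 * \<beta> + d) = 1\<close> (lemma \<open>weight_bound\<close>).

  Since the degrees add up to \<open>\<beta> * m\<close>, the powers of \<open>n\<close> cancel against the normalisation, which
  leaves \<open>(ln n) powr (- m / 2)\<close> times one logarithm for each \<open>i\<close> with \<open>q\<^sub>i = 2 * \<beta>\<close>. If \<open>L\<close> is the
  number of these \<open>i\<close>, then \<open>2 * \<beta> * L + q\<^sub>k \<le> \<beta> * m\<close>, hence \<open>L \<le> (m - 1) / 2\<close>: the exponent \<open>q\<^sub>k\<close>
  strictly between the extremes costs half a logarithm.

  With all exponents equal to 0 the same estimate shows that the integrals converge absolutely, so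
  that the difference of two quantities is the integral of the difference.\<close>

section \<open>Regularity of the Fourier transform\<close>

text \<open>The Fourier factors are bounded and vanish at the origin to the order \<open>\<beta>\<close>; powers of this truncated
  size express both properties at once.\<close>

definition trunc :: "'a::real_normed_vector \<Rightarrow> real" where
  "trunc x = min 1 (norm x)"

lemma trunc_nonneg [simp]: "0 \<le> trunc x"
  and trunc_le_1 [simp]: "trunc x \<le> 1"
  and trunc_le_norm: "trunc x \<le> norm x"
  and trunc_0 [simp]: "trunc 0 = 0"
  and trunc_uminus [simp]: "trunc (- x) = trunc x"
  by (auto simp: trunc_def)

lemma trunc_diff_le: "trunc (x - y) \<le> trunc x + trunc y"
  unfolding trunc_def using norm_triangle_ineq4[of x y] norm_ge_zero[of x] norm_ge_zero[of y] by linarith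

lemma borel_measurable_trunc [measurable]: "trunc \<in> borel_measurable borel"
  unfolding trunc_def[abs_def] by measurable

lemma cmod_iexp_diff_le: "cmod (exp (\<i> * of_real s) - 1) \<le> \<bar>s\<bar>"
  using iexp_approx1[of s 0] by simp

lemma cmod_iexp_taylor_le: "cmod (exp (\<i> * of_real s) - 1 - \<i> * of_real s) \<le> s\<^sup>2"
proof -
  have "cmod (exp (\<i> * of_real s) - 1 - \<i> * of_real s) \<le> \<bar>s\<bar>\<^sup>2 / 2"
    using iexp_approx1[of s 1] by (simp add: atMost_Suc numeral_2_eq_2 algebra_simps)
  moreover have "\<bar>s\<bar>\<^sup>2 / 2 \<le> s\<^sup>2" by simp
  ultimately show ?thesis by linarith
qed

text \<open>The three bounds correspond to the three moments of \<open>f\<close>: boundedness to the integral of \<open>|f|\<close>, the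
  linear one to the first moment, and the quadratic one, after removal of the linear term \<open>\<i> (u \<bullet> x)\<close>,
  to the second moment. The last rests on
  \<open>e\<^sup>i\<^sup>y (e\<^sup>i\<^sup>u - 1) - \<i> u = (e\<^sup>i\<^sup>u - 1 - \<i> u) + (e\<^sup>i\<^sup>y - 1) (e\<^sup>i\<^sup>u - 1)\<close>.\<close>

lemma iexp_increment_bound:
  fixes x y u :: "'a::real_inner"
  shows "cmod (exp (\<i> * of_real ((y + u) \<bullet> x)) - exp (\<i> * of_real (y \<bullet> x))) \<le> 2"
    and "cmod (exp (\<i> * of_real ((y + u) \<bullet> x)) - exp (\<i> * of_real (y \<bullet> x))) \<le> norm u * norm x"
    and "cmod (exp (\<i> * of_real ((y + u) \<bullet> x)) - exp (\<i> * of_real (y \<bullet> x)) - \<i> * of_real (u \<bullet> x))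
          \<le> norm u * (norm u + norm y) * (norm x)\<^sup>2"
proof -
  let ?U = "exp (\<i> * of_real (u \<bullet> x))" and ?Y = "exp (\<i> * of_real (y \<bullet> x))"
  have split: "exp (\<i> * of_real ((y + u) \<bullet> x)) = ?Y * ?U"
    by (simp add: inner_add_left exp_add algebra_simps)
  have U: "cmod (?U - 1) \<le> norm u * norm x"
    using cmod_iexp_diff_le[of "u \<bullet> x"] Cauchy_Schwarz_ineq2[of u x] by linarith
  have Y: "cmod (?Y - 1) \<le> norm y * norm x"
    using cmod_iexp_diff_le[of "y \<bullet> x"] Cauchy_Schwarz_ineq2[of y x] by linarith
  show "cmod (exp (\<i> * of_real ((y + u) \<bullet> x)) - ?Y) \<le> 2"
    using norm_triangle_ineq4[of "exp (\<i> * of_real ((y + u) \<bullet> x))" ?Y] by simp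
  have "cmod (exp (\<i> * of_real ((y + u) \<bullet> x)) - ?Y) = cmod (?Y * (?U - 1))"
    unfolding split by (simp add: algebra_simps)
  then show "cmod (exp (\<i> * of_real ((y + u) \<bullet> x)) - ?Y) \<le> norm u * norm x"
    using U by (simp add: norm_mult)
  have "exp (\<i> * of_real ((y + u) \<bullet> x)) - ?Y - \<i> * of_real (u \<bullet> x)
      = (?U - 1 - \<i> * of_real (u \<bullet> x)) + (?Y - 1) * (?U - 1)"
    unfolding split by (simp add: algebra_simps)
  then have "cmod (exp (\<i> * of_real ((y + u) \<bullet> x)) - ?Y - \<i> * of_real (u \<bullet> x))
      \<le> cmod (?U - 1 - \<i> * of_real (u \<bullet> x)) + cmod (?Y - 1) * cmod (?U - 1)"
    by (metis norm_mult norm_triangle_ineq)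
  also have "\<dots> \<le> (norm u * norm x)\<^sup>2 + (norm y * norm x) * (norm u * norm x)"
  proof (intro add_mono mult_mono U Y)
    have "(u \<bullet> x)\<^sup>2 \<le> (norm u * norm x)\<^sup>2"
      using Cauchy_Schwarz_ineq2[of u x] by (metis abs_ge_zero power2_abs power_mono)
    then show "cmod (?U - 1 - \<i> * of_real (u \<bullet> x)) \<le> (norm u * norm x)\<^sup>2"
      using cmod_iexp_taylor_le[of "u \<bullet> x"] by linarith
  qed auto
  finally show "cmod (exp (\<i> * of_real ((y + u) \<bullet> x)) - ?Y - \<i> * of_real (u \<bullet> x))
          \<le> norm u * (norm u + norm y) * (norm x)\<^sup>2"
    by (simp add: power2_eq_square algebra_simps)
qed

text \<open>On the unit ball \<open>|f| \<le> 1 + f\<^sup>2\<close>, and outside of it a lower power of the norm is dominated by a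
  higher one.\<close>

lemma L2_weighted_integrable:
  fixes f :: "real^'d::finite \<Rightarrow> real"
  assumes f: "f \<in> L2_functions" and w: "integrable lebesgue (\<lambda>x. \<bar>f x\<bar> * norm x ^ \<beta>)" and "j \<le> \<beta>"
  shows "integrable lebesgue (\<lambda>x. \<bar>f x\<bar> * norm x ^ j)"
proof (rule Bochner_Integration.integrable_bound)
  have [measurable]: "f \<in> borel_measurable lebesgue" and f2: "integrable lebesgue (\<lambda>x. (f x)\<^sup>2)"
    using f by (auto simp: L2_functions_def)
  have [measurable]: "norm \<in> borel_measurable (lebesgue :: (real^'d) measure)"
    by (intro measurable_completion) simp
  show "integrable lebesgue (\<lambda>x::real^'d. (indicator (cball 0 1) x + (f x)\<^sup>2) + \<bar>f x\<bar> * norm x ^ \<beta>)"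
    by (intro Bochner_Integration.integrable_add f2 w)
      (simp add: integrable_indicator_iff emeasure_lborel_cball_finite[unfolded infinity_ennreal_def])
  show "(\<lambda>x. \<bar>f x\<bar> * norm x ^ j) \<in> borel_measurable lebesgue" by measurable
  show "AE x in lebesgue. norm (\<bar>f x\<bar> * norm x ^ j)
          \<le> norm (indicator (cball 0 1) x + (f x)\<^sup>2 + \<bar>f x\<bar> * norm x ^ \<beta>)"
  proof (rule AE_I2)
    fix x :: "real^'d"
    have 1: "\<bar>f x\<bar> \<le> 1 + (f x)\<^sup>2"
      using sum_squares_bound[of "\<bar>f x\<bar>" 1] by (simp add: power2_eq_square)
    show "norm (\<bar>f x\<bar> * norm x ^ j) \<le> norm (indicator (cball 0 1) x + (f x)\<^sup>2 + \<bar>f x\<bar> * norm x ^ \<beta>)"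
    proof (cases "norm x \<le> 1")
      case True
      have "\<bar>f x\<bar> * norm x ^ j \<le> \<bar>f x\<bar>"
        using power_le_one[of "norm x" j] True by (simp add: mult_left_le)
      moreover have "0 \<le> \<bar>f x\<bar> * norm x ^ \<beta>" by simp
      ultimately have "\<bar>f x\<bar> * norm x ^ j \<le> 1 + (f x)\<^sup>2 + \<bar>f x\<bar> * norm x ^ \<beta>"
        using 1 by linarith
      then show ?thesis using True by (simp add: abs_mult)
    next
      case False
      have "\<bar>f x\<bar> * norm x ^ j \<le> \<bar>f x\<bar> * norm x ^ \<beta>"
        using False \<open>j \<le> \<beta>\<close> by (intro mult_left_mono power_increasing) auto
      then have "\<bar>f x\<bar> * norm x ^ j \<le> (f x)\<^sup>2 + \<bar>f x\<bar> * norm x ^ \<beta>"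
        using zero_le_power2[of "f x"] by linarith
      then show ?thesis using False by (simp add: abs_mult)
    qed
  qed
qed

lemma Theta_weighted_integrable:
  assumes "\<beta> \<in> {1, 2}" and "f \<in> Theta \<beta>" and "j \<le> \<beta>"
  shows "integrable lebesgue (\<lambda>x. \<bar>f x\<bar> * norm x ^ j)"
  using assms by - (rule L2_weighted_integrable[of f \<beta>]; auto simp: Theta_def Theta1_def Theta2_def)

text \<open>For \<open>\<beta> = 1\<close> this is the Lipschitz bound combined with boundedness. For \<open>\<beta> = 2\<close> the vanishing first
  moment of \<open>f\<close> allows the linear term \<open>\<i> (u \<bullet> x)\<close> to be subtracted under the integral, so that the
  increment is of second order: it is small when the starting point \<open>y\<close> is small as well.\<close>

lemma fourier_increment_bound:
  fixes f :: "real^'d::finite \<Rightarrow> real"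
  assumes \<beta>: "\<beta> \<in> {1, 2}" and f: "f \<in> Theta \<beta>"
  obtains C where "C > 0"
    "\<And>y u. cmod (fourier f (y + u) - fourier f y) \<le> C * (trunc u ^ \<beta> + trunc u * trunc y ^ (\<beta> - 1))"
proof -
  have [measurable]: "f \<in> borel_measurable lebesgue"
    using \<beta> f by (auto simp: Theta_def Theta1_def Theta2_def L2_functions_def)
  have im: "(\<lambda>x. (y::real^'d) \<bullet> x) \<in> borel_measurable lebesgue" for y
    by (intro measurable_completion) simp
  note [measurable] = im
  have wi: "integrable lebesgue (\<lambda>x. \<bar>f x\<bar> * norm x ^ j)" if "j \<le> \<beta>" for j
    using Theta_weighted_integrable[OF \<beta> f that] .
  define A where "A j = (LINT x|lebesgue. \<bar>f x\<bar> * norm x ^ j)" for j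
  have A_nonneg: "0 \<le> A j" for j unfolding A_def by (intro integral_nonneg_AE) auto
  have i0: "integrable lebesgue (\<lambda>x. exp (\<i> * of_real (y \<bullet> x)) * of_real (f x) :: complex)" for y
  proof (rule Bochner_Integration.integrable_bound[OF wi[of 0]])
    show "(\<lambda>x. exp (\<i> * of_real (y \<bullet> x)) * of_real (f x) :: complex) \<in> borel_measurable lebesgue"
      by measurable
  qed (auto simp: norm_mult)
  have diff: "fourier f (y + u) - fourier f y =
      (LINT x|lebesgue. (exp (\<i> * of_real ((y + u) \<bullet> x)) - exp (\<i> * of_real (y \<bullet> x))) * of_real (f x))" for y u
    unfolding fourier_def by (subst Bochner_Integration.integral_diff[symmetric, OF i0 i0])
      (simp add: algebra_simps)
  have b0: "cmod (fourier f (y + u) - fourier f y) \<le> 2 * A 0" for y u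
  proof -
    have "cmod (fourier f (y + u) - fourier f y) \<le> (LINT x|lebesgue. 2 * (\<bar>f x\<bar> * norm x ^ 0))"
      unfolding diff
    proof (rule Bochner_Integration.integral_norm_bound_integral)
      show "cmod ((exp (\<i> * of_real ((y + u) \<bullet> x)) - exp (\<i> * of_real (y \<bullet> x))) * of_real (f x))
          \<le> 2 * (\<bar>f x\<bar> * norm x ^ 0)" for x
        using mult_right_mono[OF iexp_increment_bound(1)[of y u x] abs_ge_zero[of "f x"]]
        by (simp add: norm_mult)
      show "integrable lebesgue (\<lambda>x. (exp (\<i> * of_real ((y + u) \<bullet> x)) - exp (\<i> * of_real (y \<bullet> x))) * of_real (f x))"
        using Bochner_Integration.integrable_diff[OF i0[of "y + u"] i0[of y]] by (simp add: algebra_simps)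
    qed (use wi[of 0] in auto)
    then show ?thesis by (simp add: A_def)
  qed
  have b1: "cmod (fourier f (y + u) - fourier f y) \<le> norm u * A 1" for y u
  proof -
    have "cmod (fourier f (y + u) - fourier f y) \<le> (LINT x|lebesgue. norm u * (\<bar>f x\<bar> * norm x ^ 1))"
      unfolding diff
    proof (rule Bochner_Integration.integral_norm_bound_integral)
      show "cmod ((exp (\<i> * of_real ((y + u) \<bullet> x)) - exp (\<i> * of_real (y \<bullet> x))) * of_real (f x))
          \<le> norm u * (\<bar>f x\<bar> * norm x ^ 1)" for x
        using mult_right_mono[OF iexp_increment_bound(2)[of y u x] abs_ge_zero[of "f x"]]
        by (simp add: norm_mult mult_ac)
      show "integrable lebesgue (\<lambda>x. (exp (\<i> * of_real ((y + u) \<bullet> x)) - exp (\<i> * of_real (y \<bullet> x))) * of_real (f x))"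
        using Bochner_Integration.integrable_diff[OF i0[of "y + u"] i0[of y]] by (simp add: algebra_simps)
    qed (use wi[of 1] \<beta> in auto)
    then show ?thesis by (simp add: A_def)
  qed
  define C where "C = 2 * A 0 + A 1 + A 2 + 1"
  have "C > 0" using A_nonneg[of 0] A_nonneg[of 1] A_nonneg[of 2] by (simp add: C_def)
  have t1: "cmod (fourier f (y + u) - fourier f y) \<le> C * trunc u" for y u
  proof (cases "norm u \<ge> 1")
    case True
    then show ?thesis using b0[of y u] A_nonneg[of 1] A_nonneg[of 2] by (simp add: trunc_def C_def)
  next
    case False
    have "norm u * A 1 \<le> C * norm u"
      using A_nonneg[of 0] A_nonneg[of 2] by (simp add: C_def mult.commute mult_left_mono)
    then show ?thesis using b1[of y u] False by (simp add: trunc_def)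
  qed
  consider "\<beta> = 1" | "\<beta> = 2" using \<beta> by auto
  then show thesis
  proof cases
    case 1
    show thesis
    proof (rule that[OF \<open>C > 0\<close>])
      fix y u :: "real^'d"
      have "C * trunc u \<le> C * (trunc u ^ \<beta> + trunc u * trunc y ^ (\<beta> - 1))"
        using \<open>C > 0\<close> 1 by (intro mult_left_mono) auto
      then show "cmod (fourier f (y + u) - fourier f y) \<le> C * (trunc u ^ \<beta> + trunc u * trunc y ^ (\<beta> - 1))"
        using t1[of y u] by linarith
    qed
  next
    case 2
    then have mom: "(LINT x|lebesgue. f x *\<^sub>R x) = 0"
      using f by (simp add: Theta_def Theta2_def)
    have idm: "(\<lambda>x. x) \<in> borel_measurable (lebesgue :: (real^'d) measure)"
      by (intro measurable_completion) simp
    have ix: "integrable lebesgue (\<lambda>x. f x *\<^sub>R x)"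
    proof (rule Bochner_Integration.integrable_bound[OF wi[of 1]])
      show "(\<lambda>x. f x *\<^sub>R x) \<in> borel_measurable lebesgue"
        using idm by measurable
    qed (use 2 in \<open>auto simp: abs_mult\<close>)
    have iu: "integrable lebesgue (\<lambda>x. f x * (u \<bullet> x))" "(LINT x|lebesgue. f x * (u \<bullet> x)) = 0" for u
      using integrable_inner_right[OF ix, of u] integral_inner_right[OF ix, of u] mom by auto
    have ic: "integrable lebesgue (\<lambda>x. \<i> * of_real (u \<bullet> x) * of_real (f x) :: complex)"
      "(LINT x|lebesgue. \<i> * of_real (u \<bullet> x) * of_real (f x) :: complex) = 0" for u
    proof -
      have *: "(\<lambda>x. \<i> * of_real (u \<bullet> x) * of_real (f x)) = (\<lambda>x. \<i> * complex_of_real (f x * (u \<bullet> x)))"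
        by (simp add: fun_eq_iff)
      show "integrable lebesgue (\<lambda>x. \<i> * of_real (u \<bullet> x) * of_real (f x) :: complex)"
        unfolding * using integrable_mult_right[OF integrable_of_real[OF iu(1)[of u]]] by blast
      have "(LINT x|lebesgue. complex_of_real (f x * (u \<bullet> x))) = of_real (LINT x|lebesgue. f x * (u \<bullet> x))"
        by (rule integral_complex_of_real)
      then show "(LINT x|lebesgue. \<i> * of_real (u \<bullet> x) * of_real (f x) :: complex) = 0"
        unfolding * using iu(2)[of u] by simp
    qed
    have b2: "cmod (fourier f (y + u) - fourier f y) \<le> norm u * (norm u + norm y) * A 2" for y u
    proof -
      let ?h = "\<lambda>x. (exp (\<i> * of_real ((y + u) \<bullet> x)) - exp (\<i> * of_real (y \<bullet> x))) * of_real (f x)"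
      let ?l = "\<lambda>x. \<i> * of_real (u \<bullet> x) * of_real (f x) :: complex"
      have ih: "integrable lebesgue ?h"
        using Bochner_Integration.integrable_diff[OF i0[of "y + u"] i0[of y]] by (simp add: algebra_simps)
      have "fourier f (y + u) - fourier f y = (LINT x|lebesgue. ?h x - ?l x)"
        unfolding diff using Bochner_Integration.integral_diff[OF ih ic(1)[of u]] ic(2)[of u] by simp
      also have "cmod \<dots> \<le> (LINT x|lebesgue. norm u * (norm u + norm y) * (\<bar>f x\<bar> * norm x ^ 2))"
      proof (rule Bochner_Integration.integral_norm_bound_integral)
        show "integrable lebesgue (\<lambda>x. ?h x - ?l x)"
          by (intro Bochner_Integration.integrable_diff ih ic)
        show "integrable lebesgue (\<lambda>x. norm u * (norm u + norm y) * (\<bar>f x\<bar> * norm x ^ 2))"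
          using wi[of 2] 2 by (intro integrable_mult_right) auto
        show "cmod (?h x - ?l x) \<le> norm u * (norm u + norm y) * (\<bar>f x\<bar> * norm x ^ 2)" for x
        proof -
          have "?h x - ?l x = (exp (\<i> * of_real ((y + u) \<bullet> x)) - exp (\<i> * of_real (y \<bullet> x))
              - \<i> * of_real (u \<bullet> x)) * of_real (f x)"
            by (simp add: algebra_simps)
          then have "cmod (?h x - ?l x) = cmod (exp (\<i> * of_real ((y + u) \<bullet> x)) - exp (\<i> * of_real (y \<bullet> x))
              - \<i> * of_real (u \<bullet> x)) * \<bar>f x\<bar>"
            by (simp add: norm_mult)
          also have "\<dots> \<le> norm u * (norm u + norm y) * (norm x)\<^sup>2 * \<bar>f x\<bar>"
            by (intro mult_right_mono iexp_increment_bound) auto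
          finally show ?thesis by (simp add: mult_ac)
        qed
      qed
      finally show ?thesis by (simp add: A_def)
    qed
    show thesis
    proof (rule that[OF \<open>C > 0\<close>])
      fix y u :: "real^'d"
      have "cmod (fourier f (y + u) - fourier f y) \<le> C * (trunc u * (trunc u + trunc y))"
      proof (cases "norm u \<ge> 1")
        case True
        then have "trunc u = 1" by (simp add: trunc_def)
        moreover have "C \<le> C * (1 + trunc y)" using \<open>C > 0\<close> by (simp add: algebra_simps)
        ultimately show ?thesis using t1[of y u] by simp
      next
        case u: False
        show ?thesis
        proof (cases "norm y \<ge> 1")
          case True
          then have "trunc y = 1" by (simp add: trunc_def)
          moreover have "C * trunc u \<le> C * (trunc u * (trunc u + 1))"
            using \<open>C > 0\<close> by (intro mult_left_mono) (auto simp: algebra_simps)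
          ultimately show ?thesis using t1[of y u] by simp
        next
          case False
          have "norm u * (norm u + norm y) * A 2 \<le> norm u * (norm u + norm y) * C"
            using A_nonneg[of 0] A_nonneg[of 1] by (intro mult_left_mono) (auto simp: C_def)
          then show ?thesis using b2[of y u] u False by (simp add: trunc_def mult_ac)
        qed
      qed
      then show "cmod (fourier f (y + u) - fourier f y) \<le> C * (trunc u ^ \<beta> + trunc u * trunc y ^ (\<beta> - 1))"
        using 2 by (simp add: power2_eq_square algebra_simps)
    qed
  qed
qed

lemma fourier_uminus: "fourier f (- y) = cnj (fourier f y)"
proof -
  have "cnj (fourier f y) = (LINT x|lebesgue. cnj (exp (\<i> * of_real (y \<bullet> x)) * of_real (f x)))"
    unfolding fourier_def by (rule Bochner_Integration.integral_cnj[symmetric])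
  then show ?thesis by (simp add: fourier_def exp_cnj)
qed

lemma fourier_0_real: "cnj (fourier f 0) = fourier f 0"
  using fourier_uminus[of f 0] by simp

lemma borel_measurable_fourier:
  fixes f :: "real^'d::finite \<Rightarrow> real"
  assumes "\<beta> \<in> {1, 2}" and "f \<in> Theta \<beta>"
  shows "fourier f \<in> borel_measurable borel"
proof -
  obtain C where C: "C > 0"
    "\<And>y u. cmod (fourier f (y + u) - fourier f y) \<le> C * (trunc u ^ \<beta> + trunc u * trunc y ^ (\<beta> - 1))"
    using fourier_increment_bound[OF assms] by blast
  have lip: "dist (fourier f x) (fourier f y) \<le> 2 * C * dist x y" for x y
  proof -
    have "trunc (x - y) ^ \<beta> \<le> trunc (x - y)" "trunc (x - y) * trunc y ^ (\<beta> - 1) \<le> trunc (x - y)"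
      using assms(1) by (auto simp: power2_eq_square mult_left_le)
    then have "cmod (fourier f x - fourier f y) \<le> C * (2 * trunc (x - y))"
      using C(2)[of y "x - y"] C(1) by (smt (verit) add_diff_cancel_left' add_diff_eq mult_left_mono)
    also have "\<dots> \<le> C * (2 * norm (x - y))"
      using C(1) trunc_le_norm[of "x - y"] by (intro mult_left_mono) auto
    finally show ?thesis by (simp add: dist_norm)
  qed
  have "(2 * C)-lipschitz_on UNIV (fourier f)"
    using lip C(1) by (intro lipschitz_onI) auto
  then have "continuous_on UNIV (fourier f)"
    by (rule lipschitz_on_continuous_on)
  then show ?thesis by (rule borel_measurable_continuous_onI)
qed

section \<open>Gaussian integrals\<close>

lemma nn_integral_gaussian_real:
  assumes "a > 0"
  shows "(\<integral>\<^sup>+x. ennreal (exp (- a * x\<^sup>2)) \<partial>lborel) = ennreal (sqrt (pi / a))"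
proof -
  define \<sigma> where "\<sigma> = 1 / sqrt (2 * a)"
  have \<sigma>: "\<sigma> > 0" "2 * \<sigma>\<^sup>2 = 1 / a" using assms by (auto simp: \<sigma>_def power_divide)
  have "exp (- a * x\<^sup>2) = sqrt (pi / a) * normal_density 0 \<sigma> x" for x
  proof -
    have "2 * pi * \<sigma>\<^sup>2 = pi / a" using \<sigma>(2) by (metis mult.assoc mult.commute times_divide_eq_right mult.right_neutral)
    then show ?thesis using \<sigma> assms unfolding normal_density_def by simp
  qed
  then have "(\<integral>\<^sup>+x. ennreal (exp (- a * x\<^sup>2)) \<partial>lborel)
      = (\<integral>\<^sup>+x. ennreal (sqrt (pi / a)) * ennreal (normal_density 0 \<sigma> x) \<partial>lborel)"
    using assms by (simp add: ennreal_mult')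
  also have "\<dots> = ennreal (sqrt (pi / a)) * (\<integral>\<^sup>+x. ennreal (normal_density 0 \<sigma> x) \<partial>lborel)"
    by (rule nn_integral_cmult) simp
  also have "(\<integral>\<^sup>+x. ennreal (normal_density 0 \<sigma> x) \<partial>lborel) = 1"
    using \<sigma>(1) by (subst nn_integral_eq_integral) (auto simp: integrable_normal_density normal_density_nonneg)
  finally show ?thesis by simp
qed

lemma nn_integral_gaussian:
  assumes "a > 0"
  shows "(\<integral>\<^sup>+(x::'a::euclidean_space). ennreal (exp (- a * (norm x)\<^sup>2)) \<partial>lborel)
    = ennreal (sqrt (pi / a) ^ DIM('a))"
proof -
  have "(norm x)\<^sup>2 = (\<Sum>b\<in>Basis. (x \<bullet> b)\<^sup>2)" for x :: 'a
    unfolding power2_norm_eq_inner by (subst euclidean_inner) (simp add: power2_eq_square)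
  then have "(\<integral>\<^sup>+(x::'a). ennreal (exp (- a * (norm x)\<^sup>2)) \<partial>lborel)
     = (\<integral>\<^sup>+(x::'a). (\<Prod>b\<in>Basis. ennreal (exp (- a * (x \<bullet> b)\<^sup>2))) \<partial>lborel)"
    by (simp add: sum_distrib_left exp_sum prod_ennreal flip: sum_negf)
  also have "\<dots> = (\<Prod>b\<in>(Basis::'a set). ennreal (sqrt (pi / a)))"
    by (subst nn_integral_lborel_prod) (auto simp: nn_integral_gaussian_real[OF assms, simplified])
  also have "\<dots> = ennreal (sqrt (pi / a) ^ DIM('a))"
    using assms by (simp add: ennreal_power)
  finally show ?thesis .
qed

lemma power_le_exp_half_square:
  fixes w :: real
  assumes "w \<ge> 0"
  shows "w ^ q \<le> (1 + 2 ^ q * real q ^ q) * exp (w\<^sup>2 / 2)"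
proof (cases "q = 0")
  case True
  have "1 \<le> exp (w\<^sup>2 / 2)" by simp
  then have "1 \<le> 2 * exp (w\<^sup>2 / 2)" by linarith
  then show ?thesis using True by simp
next
  case False
  have "(w\<^sup>2 / 2 / real q) ^ q \<le> (1 + (w\<^sup>2 / 2) / real q) ^ q"
    by (intro power_mono) auto
  also have "\<dots> \<le> exp (w\<^sup>2 / 2)"
    using False by (intro exp_ge_one_plus_x_over_n_power_n) (auto intro: order_trans[of _ 0])
  finally have "(w\<^sup>2) ^ q \<le> 2 ^ q * real q ^ q * exp (w\<^sup>2 / 2)"
    using False by (simp add: power_divide field_simps)
  moreover have "w ^ q \<le> 1 + (w\<^sup>2) ^ q"
  proof -
    have "(w\<^sup>2) ^ q = (w ^ q)\<^sup>2" by (simp add: power_mult[symmetric] mult.commute)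
    moreover have "0 \<le> (w ^ q - 1)\<^sup>2" by simp
    ultimately show ?thesis using zero_le_power[OF assms, of q] by (simp add: power2_diff)
  qed
  moreover have "1 \<le> exp (w\<^sup>2 / 2)" by simp
  ultimately show ?thesis unfolding distrib_right by linarith
qed

lemma powr_half_power: "a > 0 \<Longrightarrow> sqrt (c / a) ^ d = sqrt c ^ d * a powr (- real d / 2)"
proof -
  assume "a > 0"
  then have "sqrt a ^ d = a powr (real d / 2)"
    by (simp add: powr_half_sqrt[symmetric] powr_powr mult.commute flip: powr_realpow)
  then show ?thesis using \<open>a > 0\<close>
    by (simp add: real_sqrt_divide power_divide powr_minus_divide)
qed

text \<open>The factor 1 in the minimum comes from \<open>trunc x \<le> 1\<close>; the other one comes from
  \<open>trunc x \<le> norm x\<close> when half of the Gaussian is spent on absorbing the power of the norm.\<close>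

lemma trunc_gaussian_moment_bound:
  obtains C where "C > 0" "\<And>a. a > 0 \<Longrightarrow>
    (\<integral>\<^sup>+(x::'a::euclidean_space). ennreal (trunc x ^ q * exp (- a * (norm x)\<^sup>2)) \<partial>lborel)
      \<le> ennreal (C * a powr (- real DIM('a) / 2) * min 1 (a powr (- real q / 2)))"
proof -
  define K where "K = (1 + 2 ^ q * real q ^ q :: real)"
  have K: "K \<ge> 1" by (simp add: K_def)
  define C where "C = K * sqrt (2 * pi) ^ DIM('a)"
  have "C > 0" using K by (simp add: C_def)
  show thesis
  proof (rule that[OF \<open>C > 0\<close>])
    fix a :: real assume a: "a > 0"
    let ?I = "\<integral>\<^sup>+(x::'a). ennreal (trunc x ^ q * exp (- a * (norm x)\<^sup>2)) \<partial>lborel"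
    have "?I \<le> (\<integral>\<^sup>+(x::'a). ennreal (exp (- a * (norm x)\<^sup>2)) \<partial>lborel)"
      by (intro nn_integral_mono ennreal_leI) (simp add: mult_left_le_one_le power_le_one)
    also have "\<dots> = ennreal (sqrt pi ^ DIM('a) * a powr (- real DIM('a) / 2))"
      using nn_integral_gaussian[OF a, where 'a='a] powr_half_power[OF a, of pi "DIM('a)"] by simp
    also have "\<dots> \<le> ennreal (C * a powr (- real DIM('a) / 2) * 1)"
    proof (rule ennreal_leI)
      have "sqrt pi ^ DIM('a) \<le> sqrt (2 * pi) ^ DIM('a)"
        by (intro power_mono) auto
      also have "\<dots> \<le> C" unfolding C_def using mult_right_mono[OF K] by fastforce
      finally show "sqrt pi ^ DIM('a) * a powr (- real DIM('a) / 2) \<le> C * a powr (- real DIM('a) / 2) * 1"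
        by (simp add: mult_right_mono)
    qed
    finally have 1: "?I \<le> ennreal (C * a powr (- real DIM('a) / 2) * 1)" .
    have pt: "trunc x ^ q * exp (- a * (norm x)\<^sup>2)
        \<le> K * a powr (- real q / 2) * exp (- (a / 2) * (norm x)\<^sup>2)" for x :: 'a
    proof -
      define w where "w = sqrt a * norm x"
      have w2: "w\<^sup>2 = a * (norm x)\<^sup>2" using a by (simp add: w_def power_mult_distrib)
      have "trunc x ^ q \<le> norm x ^ q" by (intro power_mono trunc_le_norm) auto
      also have "norm x ^ q = a powr (- real q / 2) * w ^ q"
        using powr_half_power[OF a, of 1 q] a
        by (simp add: w_def power_mult_distrib real_sqrt_divide power_divide field_simps)
      also have "\<dots> \<le> a powr (- real q / 2) * (K * exp (w\<^sup>2 / 2))"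
        unfolding K_def using a by (intro mult_left_mono power_le_exp_half_square) (auto simp: w_def)
      finally have "trunc x ^ q * exp (- a * (norm x)\<^sup>2)
          \<le> a powr (- real q / 2) * (K * exp (w\<^sup>2 / 2)) * exp (- a * (norm x)\<^sup>2)"
        by (intro mult_right_mono) auto
      also have "\<dots> = K * a powr (- real q / 2) * (exp (w\<^sup>2 / 2) * exp (- a * (norm x)\<^sup>2))"
        by simp
      also have "exp (w\<^sup>2 / 2) * exp (- a * (norm x)\<^sup>2) = exp (- (a / 2) * (norm x)\<^sup>2)"
        unfolding w2 by (simp add: exp_add[symmetric])
      finally show ?thesis .
    qed
    have "?I \<le> (\<integral>\<^sup>+(x::'a). ennreal (K * a powr (- real q / 2)) * ennreal (exp (- (a / 2) * (norm x)\<^sup>2)) \<partial>lborel)"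
      using pt K by (intro nn_integral_mono) (auto simp flip: ennreal_mult')
    also have "\<dots> = ennreal (K * a powr (- real q / 2)) * ennreal (sqrt (pi / (a / 2)) ^ DIM('a))"
      using a nn_integral_gaussian[of "a / 2", where 'a='a] by (subst nn_integral_cmult) auto
    also have "\<dots> = ennreal (C * a powr (- real DIM('a) / 2) * a powr (- real q / 2))"
      using K powr_half_power[OF a, of "2 * pi" "DIM('a)"]
      by (simp add: C_def ennreal_mult'[symmetric] mult_ac)
    finally have 2: "?I \<le> ennreal (C * a powr (- real DIM('a) / 2) * a powr (- real q / 2))" .
    show "?I \<le> ennreal (C * a powr (- real DIM('a) / 2) * min 1 (a powr (- real q / 2)))"
      using 1 2 by (auto simp: min_def)
  qed
qed

lemma nn_integral_powr_near_0:
  fixes s :: real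
  assumes "s < 1"
  shows "(\<integral>\<^sup>+u. ennreal (u powr (- s)) * indicator {0..1} u \<partial>lborel) = ennreal (1 / (1 - s))"
  using nn_integral_has_integral_lebesgue'[OF _ has_integral_powr_from_0[of "- s" 1]] assms by simp

lemma nn_integral_powr_from_1:
  fixes \<delta> T :: real
  assumes "T \<ge> 1" "\<delta> \<ge> 0"
  shows "(\<integral>\<^sup>+u. ennreal (u powr (\<delta> - 1)) * indicator {1..T} u \<partial>lborel)
    \<le> ennreal (if \<delta> = 0 then ln T else T powr \<delta> / \<delta>)"
proof (cases "\<delta> = 0")
  case True
  have "(\<integral>\<^sup>+u. ennreal (u powr (\<delta> - 1)) * indicator {1..T} u \<partial>lborel) = ennreal (ln T - ln 1)"
  proof (rule nn_integral_FTC_Icc)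
    show "(ln has_real_derivative x powr (\<delta> - 1)) (at x)" if "x \<in> {1..T}" for x
      using that True by (auto intro!: derivative_eq_intros simp: powr_minus divide_inverse)
  qed (use assms in auto)
  then show ?thesis using True by simp
next
  case False
  have "(\<integral>\<^sup>+u. ennreal (u powr (\<delta> - 1)) * indicator {1..T} u \<partial>lborel)
      = ennreal (T powr \<delta> / \<delta> - 1 powr \<delta> / \<delta>)"
  proof (rule nn_integral_FTC_Icc)
    show "((\<lambda>x. x powr \<delta> / \<delta>) has_real_derivative x powr (\<delta> - 1)) (at x)"
      if "x \<in> {1..T}" for x
      using that False by (auto intro!: derivative_eq_intros)
  qed (use assms in auto)
  then show ?thesis using False assms by (auto intro!: ennreal_leI)
qed

section \<open>Single-variable weights\<close>

text \<open>What one frequency with exponent \<open>q\<close> and one time increment contribute to the final estimate. The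
  last argument only selects the space of the frequencies.\<close>

definition weight :: "real \<Rightarrow> real \<Rightarrow> real \<Rightarrow> nat \<Rightarrow> 'a::euclidean_space itself \<Rightarrow> ennreal" where
  "weight \<kappa> H T q _ = (\<integral>\<^sup>+(x::'a). \<integral>\<^sup>+u.
     ennreal (trunc x ^ q) * (indicator {0<..<T} u * ennreal (exp (- \<kappa> * (norm x)\<^sup>2 * u powr (2 * H)))) \<partial>lborel \<partial>lborel)"

text \<open>Exchanging the integrals and integrating over the frequency first leaves
  \<open>u powr (- H * d) * min 1 (u powr (- H * q))\<close>. Up to \<open>u = 1\<close> this is integrable since \<open>H * d < 1\<close>;
  from 1 on it is the power \<open>u powr (\<delta> - 1)\<close>, so a logarithm appears exactly when \<open>\<delta> = 0\<close>.\<close>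

lemma weight_bound:
  fixes \<kappa> H B \<delta> :: real
  assumes \<kappa>: "\<kappa> > 0" and H: "H > 0" "H * real DIM('a::euclidean_space) < 1" and B: "B \<ge> 1"
    and \<delta>: "\<delta> \<ge> 0" "H * (real DIM('a) + real q) = 1 - \<delta>"
  obtains C where "C > 0" "\<And>n::nat. n \<ge> 2 \<Longrightarrow>
    weight \<kappa> H (real n * B) q TYPE('a)
      \<le> ennreal (C * real n powr \<delta> * (if \<delta> = 0 then ln (real n) else 1))"
proof -
  let ?d = "real DIM('a)"
  obtain C0 where C0: "C0 > 0" "\<And>a. a > 0 \<Longrightarrow>
    (\<integral>\<^sup>+(x::'a). ennreal (trunc x ^ q * exp (- a * (norm x)\<^sup>2)) \<partial>lborel)
      \<le> ennreal (C0 * a powr (- ?d / 2) * min 1 (a powr (- real q / 2)))"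
    using trunc_gaussian_moment_bound[where 'a='a and q=q] by blast
  define C1 where "C1 = C0 * \<kappa> powr (- ?d / 2) * (1 + \<kappa> powr (- real q / 2))"
  have C1: "C1 > 0" using C0 \<kappa> by (simp add: C1_def add_pos_nonneg)
  have inner: "(\<integral>\<^sup>+(x::'a). ennreal (trunc x ^ q) * (indicator {0<..<T} u * ennreal (exp (- \<kappa> * (norm x)\<^sup>2 * u powr (2 * H)))) \<partial>lborel)
     \<le> ennreal C1 * (ennreal (u powr (- (H * ?d))) * indicator {0..1} u + ennreal (u powr (\<delta> - 1)) * indicator {1..T} u)"
    (is "?L \<le> _") for u T :: real
  proof (cases "0 < u \<and> u < T")
    case False
    then have "?L = 0" by (auto simp: indicator_def)
    then show ?thesis by simp
  next
    case True
    define a where "a = \<kappa> * u powr (2 * H)"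
    have a: "a > 0" using True \<kappa> by (simp add: a_def)
    have p1: "a powr (- ?d / 2) = \<kappa> powr (- ?d / 2) * u powr (- (H * ?d))"
      using True \<kappa> by (simp add: a_def powr_mult powr_powr)
    have p2: "a powr (- real q / 2) = \<kappa> powr (- real q / 2) * u powr (- (H * real q))"
      using True \<kappa> by (simp add: a_def powr_mult powr_powr)
    have p3: "u powr (- (H * ?d)) * u powr (- (H * real q)) = u powr (\<delta> - 1)"
    proof -
      have "- (H * ?d) + - (H * real q) = \<delta> - 1" using \<delta>(2) by (simp add: algebra_simps)
      then show ?thesis by (metis powr_add)
    qed
    have "?L = (\<integral>\<^sup>+(x::'a). ennreal (trunc x ^ q * exp (- a * (norm x)\<^sup>2)) \<partial>lborel)"
      using True by (intro nn_integral_cong) (simp add: a_def ennreal_mult' mult_ac)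
    also have "\<dots> \<le> ennreal (C0 * a powr (- ?d / 2) * min 1 (a powr (- real q / 2)))"
      by (rule C0(2)[OF a])
    also have "\<dots> \<le> ennreal (C1 * (if u \<le> 1 then u powr (- (H * ?d)) else u powr (\<delta> - 1)))"
    proof (intro ennreal_leI)
      have "C0 * a powr (- ?d / 2) * min 1 (a powr (- real q / 2)) \<le> C0 * a powr (- ?d / 2) * 1"
        using C0 by (intro mult_left_mono) auto
      also have "\<dots> = C0 * \<kappa> powr (- ?d / 2) * 1 * u powr (- (H * ?d))" unfolding p1 by simp
      also have "\<dots> \<le> C1 * u powr (- (H * ?d))"
        unfolding C1_def using C0 by (intro mult_right_mono mult_left_mono) auto
      finally have 1: "C0 * a powr (- ?d / 2) * min 1 (a powr (- real q / 2)) \<le> C1 * u powr (- (H * ?d))" .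
      have "C0 * a powr (- ?d / 2) * min 1 (a powr (- real q / 2)) \<le> C0 * a powr (- ?d / 2) * a powr (- real q / 2)"
        using C0 by (intro mult_left_mono) auto
      also have "\<dots> = C0 * \<kappa> powr (- ?d / 2) * \<kappa> powr (- real q / 2) * u powr (\<delta> - 1)"
        unfolding p1 p2 p3[symmetric] by simp
      also have "\<dots> \<le> C1 * u powr (\<delta> - 1)"
        unfolding C1_def using C0 by (intro mult_right_mono mult_left_mono) auto
      finally show "C0 * a powr (- ?d / 2) * min 1 (a powr (- real q / 2))
          \<le> C1 * (if u \<le> 1 then u powr (- (H * ?d)) else u powr (\<delta> - 1))"
        using 1 by auto
    qed
    also have "\<dots> \<le> ennreal C1 * (ennreal (u powr (- (H * ?d))) * indicator {0..1} u + ennreal (u powr (\<delta> - 1)) * indicator {1..T} u)"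
      unfolding ennreal_mult'[OF less_imp_le[OF C1]]
      using True by (intro mult_left_mono) (auto simp: indicator_def intro: add_increasing2)
    finally show ?thesis .
  qed
  have main: "weight \<kappa> H T q TYPE('a) \<le> ennreal (C1 * (1 / (1 - H * ?d) + (if \<delta> = 0 then ln T else T powr \<delta> / \<delta>)))"
    if "T \<ge> 1" for T
  proof -
    have "weight \<kappa> H T q TYPE('a) = (\<integral>\<^sup>+u. \<integral>\<^sup>+(x::'a). ennreal (trunc x ^ q) * (indicator {0<..<T} u *
        ennreal (exp (- \<kappa> * (norm x)\<^sup>2 * u powr (2 * H)))) \<partial>lborel \<partial>lborel)"
      unfolding weight_def by (rule lborel_pair.Fubini') measurable
    also have "\<dots> \<le> (\<integral>\<^sup>+u. ennreal C1 * (ennreal (u powr (- (H * ?d))) * indicator {0..1} u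
        + ennreal (u powr (\<delta> - 1)) * indicator {1..T} u) \<partial>lborel)"
      by (intro nn_integral_mono inner)
    also have "\<dots> = ennreal C1 * ((\<integral>\<^sup>+u. ennreal (u powr (- (H * ?d))) * indicator {0..1} u \<partial>lborel)
        + (\<integral>\<^sup>+u. ennreal (u powr (\<delta> - 1)) * indicator {1..T} u \<partial>lborel))"
      by (subst nn_integral_cmult, measurable, subst nn_integral_add, measurable)
    also have "\<dots> \<le> ennreal C1 * (ennreal (1 / (1 - H * ?d)) + ennreal (if \<delta> = 0 then ln T else T powr \<delta> / \<delta>))"
      using nn_integral_powr_near_0[OF H(2)] nn_integral_powr_from_1[OF that \<delta>(1)]
      by (intro mult_left_mono add_mono) auto
    also have "\<dots> = ennreal (C1 * (1 / (1 - H * ?d) + (if \<delta> = 0 then ln T else T powr \<delta> / \<delta>)))"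
      using C1 H that \<delta>(1) by (auto simp: ennreal_mult' ennreal_plus)
    finally show ?thesis .
  qed
  define S where "S = 1 / (1 - H * ?d)"
  have S: "S > 0" using H by (simp add: S_def)
  show thesis
  proof (cases "\<delta> = 0")
    case True
    define C where "C = C1 * (S / ln 2 + 1 + ln B / ln 2)"
    have "C > 0" using C1 S B by (simp add: C_def add_pos_nonneg)
    show thesis
    proof (rule that[OF \<open>C > 0\<close>])
      fix n :: nat assume n: "n \<ge> 2"
      have "real n * B \<ge> 1 * 1" using n B by (intro mult_mono) auto
      then have "weight \<kappa> H (real n * B) q TYPE('a) \<le> ennreal (C1 * (S + ln (real n * B)))"
        using main[of "real n * B"] True by (simp add: S_def)
      also have "\<dots> \<le> ennreal (C * ln (real n))"
      proof (intro ennreal_leI)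
        have l: "ln (real n) / ln 2 \<ge> 1" using n by simp
        have "S + ln (real n * B) = S * 1 + ln (real n) + ln B * 1"
          using n B by (simp add: ln_mult)
        also have "\<dots> \<le> S * (ln (real n) / ln 2) + ln (real n) + ln B * (ln (real n) / ln 2)"
          using l S B by (intro add_mono mult_left_mono) auto
        also have "\<dots> = (S / ln 2 + 1 + ln B / ln 2) * ln (real n)" by (simp add: algebra_simps)
        finally show "C1 * (S + ln (real n * B)) \<le> C * ln (real n)"
          unfolding C_def using C1 by (simp add: mult.assoc)
      qed
      finally show "weight \<kappa> H (real n * B) q TYPE('a)
          \<le> ennreal (C * real n powr \<delta> * (if \<delta> = 0 then ln (real n) else 1))"
        using True n by simp
    qed
  next
    case False
    define C where "C = C1 * (S + B powr \<delta> / \<delta>)"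
    have "C > 0" using C1 S B \<delta> False by (simp add: C_def add_pos_nonneg)
    show thesis
    proof (rule that[OF \<open>C > 0\<close>])
      fix n :: nat assume n: "n \<ge> 2"
      have "real n * B \<ge> 1 * 1" using n B by (intro mult_mono) auto
      then have "weight \<kappa> H (real n * B) q TYPE('a) \<le> ennreal (C1 * (S + (real n * B) powr \<delta> / \<delta>))"
        using main[of "real n * B"] False by (simp add: S_def)
      also have "\<dots> \<le> ennreal (C * real n powr \<delta>)"
      proof (intro ennreal_leI)
        have l: "real n powr \<delta> \<ge> 1" using n \<delta> by (intro ge_one_powr_ge_zero) auto
        have "S + (real n * B) powr \<delta> / \<delta> \<le> S * real n powr \<delta> + (B powr \<delta> / \<delta>) * real n powr \<delta>"
          using l S n B by (intro add_mono) (auto simp: powr_mult mult_ac)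
        then show "C1 * (S + (real n * B) powr \<delta> / \<delta>) \<le> C * real n powr \<delta>"
          using mult_left_mono[OF _ less_imp_le[OF C1]] by (fastforce simp: C_def algebra_simps)
      qed
      finally show "weight \<kappa> H (real n * B) q TYPE('a)
          \<le> ennreal (C * real n powr \<delta> * (if \<delta> = 0 then ln (real n) else 1))"
        using False by simp
    qed
  qed
qed

section \<open>Integrating out the times\<close>

text \<open>Integrating over the last time first, translation invariance of the Lebesgue measure removes the
  dependence on the preceding time.\<close>

lemma nn_integral_increments:
  fixes e :: "nat \<Rightarrow> real \<Rightarrow> ennreal"
  assumes e [measurable]: "\<And>i. e i \<in> borel_measurable borel"
  shows "(\<integral>\<^sup>+s. (\<Prod>i=1..m. e i ((s(0 := 0)) i - (s(0 := 0)) (i - 1))) \<partial>Pi\<^sub>M {1..m} (\<lambda>_. lborel))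
      = (\<Prod>i=1..m. \<integral>\<^sup>+u. e i u \<partial>lborel)"
proof (induction m)
  case 0
  interpret product_sigma_finite "\<lambda>_::nat. lborel :: real measure" by standard
  show ?case by (simp add: PiM_empty nn_integral_count_space_finite)
next
  case (Suc m)
  interpret product_sigma_finite "\<lambda>_::nat. lborel :: real measure" by standard
  have ins: "{1..Suc m} = insert (Suc m) {1..m}" by auto
  have shift: "(\<integral>\<^sup>+y. e (Suc m) (y - c) \<partial>lborel) = (\<integral>\<^sup>+u. e (Suc m) u \<partial>lborel)" for c
    using nn_integral_real_affine[of "e (Suc m)" 1 "- c"] by (simp add: algebra_simps)
  let ?w = "\<lambda>j s. \<Prod>i=1..j. e i ((s(0 := 0)) i - (s(0 := 0)) (i - 1))"
  have meas0: "(\<lambda>s. (s(0 := 0)) i) \<in> borel_measurable (Pi\<^sub>M {1..j} (\<lambda>_. lborel))" if "i \<le> j" for i j :: nat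
    using that by (cases "i = 0") (auto intro: measurable_component_singleton)
  have meas: "?w j \<in> borel_measurable (Pi\<^sub>M {1..j} (\<lambda>_. lborel))" for j
    by (intro borel_measurable_prod_ennreal measurable_compose[OF _ e] borel_measurable_diff meas0) auto
  have "(\<integral>\<^sup>+s. ?w (Suc m) s \<partial>Pi\<^sub>M {1..Suc m} (\<lambda>_. lborel))
      = (\<integral>\<^sup>+s. \<integral>\<^sup>+y. ?w (Suc m) (s(Suc m := y)) \<partial>lborel \<partial>Pi\<^sub>M {1..m} (\<lambda>_. lborel))"
    unfolding ins by (rule product_nn_integral_insert) (use meas[of "Suc m"] in \<open>simp_all only: ins finite_insert finite_atLeastAtMost atLeastAtMost_iff\<close>, simp)
  also have "\<dots> = (\<integral>\<^sup>+s. ?w m s * (\<integral>\<^sup>+u. e (Suc m) u \<partial>lborel) \<partial>Pi\<^sub>M {1..m} (\<lambda>_. lborel))"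
  proof (rule nn_integral_cong)
    fix s
    have "?w (Suc m) (s(Suc m := y)) = ?w m s * e (Suc m) (y - (s(0 := 0)) m)" for y
    proof -
      have "?w m (s(Suc m := y)) = ?w m s" by (intro prod.cong) auto
      then show ?thesis by (cases m) (auto simp: prod.nat_ivl_Suc')
    qed
    then show "(\<integral>\<^sup>+y. ?w (Suc m) (s(Suc m := y)) \<partial>lborel) = ?w m s * (\<integral>\<^sup>+u. e (Suc m) u \<partial>lborel)"
      using shift[of "(s(0 := 0)) m"] by (simp add: nn_integral_cmult)
  qed
  also have "\<dots> = (\<Prod>i=1..Suc m. \<integral>\<^sup>+u. e i u \<partial>lborel)"
    using Suc.IH meas[of m] by (simp add: nn_integral_multc)
  finally show ?case .
qed

section \<open>Square-integrable random variables\<close>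

definition sq_integrable :: "'w measure \<Rightarrow> ('w \<Rightarrow> real) \<Rightarrow> bool" where
  "sq_integrable M f \<longleftrightarrow> f \<in> borel_measurable M \<and> integrable M (\<lambda>x. (f x)\<^sup>2)"

lemma sq_integrable_mult:
  assumes "sq_integrable M f" "sq_integrable M g"
  shows "integrable M (\<lambda>x. f x * g x)"
proof (rule Bochner_Integration.integrable_bound)
  show "integrable M (\<lambda>x. (f x)\<^sup>2 + (g x)\<^sup>2)"
    using assms by (auto simp: sq_integrable_def)
  show "(\<lambda>x. f x * g x) \<in> borel_measurable M" using assms by (auto simp: sq_integrable_def)
  have "\<bar>a * b\<bar> \<le> a\<^sup>2 + b\<^sup>2" for a b :: real
    using sum_squares_bound[of "\<bar>a\<bar>" "\<bar>b\<bar>"] zero_le_power2[of a] zero_le_power2[of b]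
      abs_ge_zero[of "a * b"]
    unfolding abs_mult power2_abs by linarith
  then show "AE x in M. norm (f x * g x) \<le> norm ((f x)\<^sup>2 + (g x)\<^sup>2)" by simp
qed

lemma sq_integrable_add:
  assumes "sq_integrable M f" "sq_integrable M g"
  shows "sq_integrable M (\<lambda>x. f x + g x)"
proof -
  have "(f x + g x)\<^sup>2 = (f x)\<^sup>2 + (g x)\<^sup>2 + 2 * (f x * g x)" for x
    by (simp add: power2_sum)
  then show ?thesis
    using assms sq_integrable_mult[OF assms] by (auto simp: sq_integrable_def)
qed

lemma sq_integrable_cmult:
  assumes "sq_integrable M f"
  shows "sq_integrable M (\<lambda>x. c * f x)"
  using assms by (auto simp: sq_integrable_def power_mult_distrib)

lemma sq_integrable_diff:
  assumes "sq_integrable M f" "sq_integrable M g"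
  shows "sq_integrable M (\<lambda>x. f x - g x)"
  using sq_integrable_add[OF assms(1) sq_integrable_cmult[OF assms(2), of "-1"]] by simp

lemma sq_integrable_zero: "sq_integrable M (\<lambda>_. 0)"
  by (simp add: sq_integrable_def)

lemma sq_integrable_sum:
  assumes "\<And>i. i \<in> I \<Longrightarrow> sq_integrable M (f i)"
  shows "sq_integrable M (\<lambda>x. \<Sum>i\<in>I. f i x)"
  using assms by (induction I rule: infinite_finite_induct) (auto simp: sq_integrable_zero sq_integrable_add)

lemma (in finite_measure) sq_integrable_integrable:
  assumes "sq_integrable M f"
  shows "integrable M f"
  using sq_integrable_mult[OF assms, of "\<lambda>_. 1"] by (simp add: sq_integrable_def)

section \<open>Conditional variances bound variances from below\<close>

text \<open>With \<open>P\<close> the conditional expectation of \<open>Y\<close>, the variable \<open>c Y + W\<close> splits into \<open>c (Y - P)\<close> and the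
  \<open>F\<close>-measurable part \<open>c P + W\<close>; these are orthogonal, and the mean square of the first is the
  expected conditional variance of \<open>c Y\<close>.\<close>

lemma (in prob_space) cond_variance_lower_bound:
  assumes sub: "subalgebra M F" and Y: "sq_integrable M Y"
    and W: "sq_integrable M W" "W \<in> borel_measurable F"
    and K: "AE \<omega> in M. K \<le> cond_variance M F Y \<omega>"
  shows "c\<^sup>2 * K \<le> expectation (\<lambda>\<omega>. (c * Y \<omega> + W \<omega>)\<^sup>2)"
proof -
  interpret finite_measure_subalgebra M F by unfold_locales (rule sub)
  define P where "P = real_cond_exp M F Y"
  have iY: "integrable M Y" by (rule sq_integrable_integrable[OF Y])
  have PF [measurable]: "P \<in> borel_measurable F" by (simp add: P_def)
  have PM [measurable]: "P \<in> borel_measurable M" by (rule measurable_from_subalg[OF sub PF])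
  have WF [measurable]: "W \<in> borel_measurable F" by (rule W)
  have sP: "sq_integrable M P"
    unfolding sq_integrable_def P_def
  proof (intro conjI)
    have "convex_on UNIV (\<lambda>x::real. x\<^sup>2)"
      by (rule convex_power2)
    then show "integrable M (\<lambda>x. (real_cond_exp M F Y x)\<^sup>2)"
      using integrable_convex_cond_exp[OF iY, where I=UNIV and q="\<lambda>x. x\<^sup>2"] Y by (auto simp: sq_integrable_def)
  qed (use PM P_def in auto)
  define D where "D \<omega> = Y \<omega> - P \<omega>" for \<omega>
  define U where "U \<omega> = c * P \<omega> + W \<omega>" for \<omega>
  have sD: "sq_integrable M D" unfolding D_def by (intro sq_integrable_diff Y sP)
  have sU: "sq_integrable M U" unfolding U_def by (intro sq_integrable_add sq_integrable_cmult sP W)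
  have UF: "U \<in> borel_measurable F" unfolding U_def by measurable
  have "expectation (\<lambda>\<omega>. U \<omega> * P \<omega>) = expectation (\<lambda>\<omega>. U \<omega> * Y \<omega>)"
    unfolding P_def using sq_integrable_mult[OF sU Y] UF Y
    by (intro real_cond_exp_intg) (auto simp: sq_integrable_def)
  then have UD: "expectation (\<lambda>\<omega>. U \<omega> * D \<omega>) = 0"
    using sq_integrable_mult[OF sU Y] sq_integrable_mult[OF sU sP]
    by (simp add: D_def right_diff_distrib)
  have iD: "integrable M (\<lambda>\<omega>. (D \<omega>)\<^sup>2)" "integrable M (\<lambda>\<omega>. (U \<omega>)\<^sup>2)" "integrable M (\<lambda>\<omega>. U \<omega> * D \<omega>)"
    using sD sU sq_integrable_mult[OF sU sD] by (auto simp: sq_integrable_def)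
  have cv: "cond_variance M F Y = real_cond_exp M F (\<lambda>\<omega>. (D \<omega>)\<^sup>2)"
    by (simp add: cond_variance_def D_def P_def)
  have "K = expectation (\<lambda>_. K)" by (simp add: prob_space)
  also have "\<dots> \<le> expectation (cond_variance M F Y)"
    unfolding cv using K real_cond_exp_int(1)[OF iD(1)] by (intro integral_mono_AE) (auto simp: cv)
  also have "\<dots> = expectation (\<lambda>\<omega>. (D \<omega>)\<^sup>2)"
    unfolding cv by (rule real_cond_exp_int(2)[OF iD(1)])
  finally have KD: "K \<le> expectation (\<lambda>\<omega>. (D \<omega>)\<^sup>2)" .
  have "(c * Y \<omega> + W \<omega>)\<^sup>2 = c\<^sup>2 * (D \<omega>)\<^sup>2 + 2 * c * (U \<omega> * D \<omega>) + (U \<omega>)\<^sup>2" for \<omega>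
    by (simp add: D_def U_def power2_eq_square algebra_simps)
  then have "expectation (\<lambda>\<omega>. (c * Y \<omega> + W \<omega>)\<^sup>2)
      = c\<^sup>2 * expectation (\<lambda>\<omega>. (D \<omega>)\<^sup>2) + 2 * c * expectation (\<lambda>\<omega>. U \<omega> * D \<omega>) + expectation (\<lambda>\<omega>. (U \<omega>)\<^sup>2)"
    using iD by simp
  also have "\<dots> \<ge> c\<^sup>2 * K + 0 + 0"
    using KD UD by (intro add_mono mult_left_mono) auto
  finally show ?thesis by simp
qed

lemma centered_gaussian_rv_moments:
  assumes "prob_space M" and Z: "centered_gaussian_rv M Z"
  shows "sq_integrable M Z" and "integral\<^sup>L M Z = 0"
proof -
  interpret prob_space M by fact
  have [measurable]: "Z \<in> borel_measurable M" using Z by (simp add: centered_gaussian_rv_def)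
  consider "distr M borel Z = return borel 0" | \<tau> where "\<tau> > 0" "distributed M lborel Z (normal_density 0 \<tau>)"
    using Z by (auto simp: centered_gaussian_rv_def)
  then have "integrable M (\<lambda>\<omega>. (Z \<omega>)\<^sup>2) \<and> integral\<^sup>L M Z = 0"
  proof cases
    case 1
    have "AE z in distr M borel Z. z = 0" unfolding 1 by (subst AE_return) auto
    then have ae: "AE \<omega> in M. Z \<omega> = 0" by (subst (asm) AE_distr_iff) auto
    have "integrable M (\<lambda>\<omega>. (Z \<omega>)\<^sup>2) \<longleftrightarrow> integrable M (\<lambda>_. 0 :: real)"
      using ae by (intro integrable_cong_AE) auto
    moreover have "integral\<^sup>L M Z = integral\<^sup>L M (\<lambda>_. 0 :: real)"
      using ae by (intro integral_cong_AE) auto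
    ultimately show ?thesis by simp
  next
    case 2
    have "integrable lborel (\<lambda>x. normal_density 0 \<tau> x * x\<^sup>2)"
      using integrable_normal_moment[OF 2(1), of 0 2] by simp
    then have "integrable M (\<lambda>\<omega>. (Z \<omega>)\<^sup>2)"
      using distributed_integrable[OF 2(2), of "\<lambda>x. x\<^sup>2"] by (simp add: normal_density_nonneg)
    moreover have "integral\<^sup>L M Z = 0"
      using normal_distributed_expectation[OF 2(1), of Z 0] 2(2) by simp
    ultimately show ?thesis by simp
  qed
  then show "sq_integrable M Z" and "integral\<^sup>L M Z = 0" by (auto simp: sq_integrable_def)
qed

section \<open>Local nondeterminism\<close>

definition time_chain :: "nat \<Rightarrow> (nat \<Rightarrow> real) \<Rightarrow> bool" where
  "time_chain m s \<longleftrightarrow> s 0 = 0 \<and> (\<forall>i\<in>{1..m}. s (i - 1) < s i)"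

lemma time_chain_positive:
  assumes "time_chain m s" "i \<le> m"
  shows "0 \<le> s i" and "0 < i \<Longrightarrow> 0 < s i"
proof -
  have *: "i \<le> m \<Longrightarrow> 0 \<le> s i \<and> (0 < i \<longrightarrow> 0 < s i)" for i :: nat
  proof (induction i)
    case (Suc i)
    then have "s i < s (Suc i)" using assms(1) by (force simp: time_chain_def)
    with Suc show ?case by auto
  qed (use assms in \<open>auto simp: time_chain_def\<close>)
  show "0 \<le> s i" and "0 < i \<Longrightarrow> 0 < s i" using *[OF assms(2)] by auto
qed

lemma time_chain_mono:
  assumes "time_chain m s" "i \<le> j" "j \<le> m"
  shows "s i \<le> s j"
  using assms(2,3)
proof (induction j rule: dec_induct)
  case (step j)
  then have "s j < s (Suc j)" using assms(1) by (force simp: time_chain_def)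
  with step show ?case by auto
qed simp

text \<open>The properties of a single component of the process from which the lower bound for the
  variance of a combination of increments follows. The constant \<open>C\<close> bounds the variances of
  increments from above, at all pairs of times.\<close>

locale lnd_process = prob_space M for M :: "'w measure" +
  fixes Y :: "real \<Rightarrow> 'w \<Rightarrow> real" and H C :: real
  assumes H: "0 < H"
    and sq: "0 \<le> t \<Longrightarrow> sq_integrable M (Y t)"
    and start: "AE \<omega> in M. Y 0 \<omega> = 0"
    and scaling: "0 \<le> t \<Longrightarrow> expectation (\<lambda>\<omega>. (Y t \<omega>)\<^sup>2) = t powr (2 * H) * expectation (\<lambda>\<omega>. (Y 1 \<omega>)\<^sup>2)"
    and increment: "0 \<le> s \<Longrightarrow> s \<le> t \<Longrightarrow> expectation (\<lambda>\<omega>. (Y t \<omega> - Y s \<omega>)\<^sup>2) \<le> C * (t - s) powr (2 * H)"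
    and slnd: "strong_local_nondeterminism M H Y"
begin

lemma subalgebra_sigma_of_times:
  assumes "\<And>j. j \<in> {1..m} \<Longrightarrow> 0 \<le> s j"
  shows "subalgebra M (sigma_of_times M Y m s)"
proof -
  have "(\<lambda>\<omega>. \<lambda>j\<in>{1..m}. Y (s j) \<omega>) \<in> M \<rightarrow>\<^sub>M Pi\<^sub>M {1..m} (\<lambda>_. borel)"
    using sq assms by (intro measurable_restrict) (auto simp: sq_integrable_def)
  then show ?thesis
    unfolding subalgebra_def sigma_of_times_def
    using sets_image_in_sets[of M "space M"] by (auto simp: space_vimage_algebra)
qed

lemma measurable_sigma_of_times:
  assumes "j \<in> {1..m}"
  shows "Y (s j) \<in> borel_measurable (sigma_of_times M Y m s)"
proof -
  have "(\<lambda>\<omega>. \<lambda>j\<in>{1..m}. Y (s j) \<omega>) \<in> sigma_of_times M Y m s \<rightarrow>\<^sub>M Pi\<^sub>M {1..m} (\<lambda>_. borel)"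
    unfolding sigma_of_times_def by (rule measurable_vimage_algebra1) (auto simp: space_PiM)
  from measurable_compose[OF this measurable_component_singleton[OF assms]]
  show ?thesis using assms by simp
qed

text \<open>The local nondeterminism turned into an estimate for unconditional second moments. The minimum
  over the past times is attained at the most recent one, since the times increase.\<close>

lemma slnd_variance:
  obtains \<kappa> where "\<kappa> > 0"
    "\<And>m s t c W. m \<ge> 1 \<Longrightarrow> 0 < s 1 \<Longrightarrow> mono_on {1..m} s \<Longrightarrow> s m < t \<Longrightarrow> sq_integrable M W \<Longrightarrow>
      W \<in> borel_measurable (sigma_of_times M Y m s) \<Longrightarrow>
      \<kappa> * (c\<^sup>2 * (t - s m) powr (2 * H)) \<le> expectation (\<lambda>\<omega>. (c * Y t \<omega> + W \<omega>)\<^sup>2)"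
proof -
  obtain \<kappa> where \<kappa>: "\<kappa> > 0" "\<And>m s t. m \<ge> 1 \<Longrightarrow> 0 < s 1 \<Longrightarrow> mono_on {1..m} s \<Longrightarrow> s m < t \<Longrightarrow>
        (AE \<omega> in M. cond_variance M (sigma_of_times M Y m s) (Y t) \<omega>
           \<ge> \<kappa> * (MIN j\<in>{1..m}. \<bar>t - s j\<bar> powr (2 * H)))"
    using slnd unfolding strong_local_nondeterminism_def by blast
  show thesis
  proof (rule that[OF \<kappa>(1)])
    fix m :: nat and s :: "nat \<Rightarrow> real" and t c :: real and W
    assume m: "m \<ge> 1" and s: "0 < s 1" "mono_on {1..m} s" "s m < t"
      and W: "sq_integrable M W" "W \<in> borel_measurable (sigma_of_times M Y m s)"
    have pos: "0 < s j" and le: "s j \<le> s m" if "j \<in> {1..m}" for j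
      using s that m mono_onD[OF s(2), of 1 j] mono_onD[OF s(2), of j m] by auto
    have t: "0 \<le> t" using pos[of m] m s by simp
    have "(t - s m) powr (2 * H) \<le> (MIN j\<in>{1..m}. \<bar>t - s j\<bar> powr (2 * H))"
    proof (rule Min.boundedI)
      fix a assume "a \<in> (\<lambda>j. \<bar>t - s j\<bar> powr (2 * H)) ` {1..m}"
      then obtain j where j: "j \<in> {1..m}" "a = \<bar>t - s j\<bar> powr (2 * H)" by auto
      then show "(t - s m) powr (2 * H) \<le> a"
        using le[OF j(1)] s(3) H by (auto intro!: powr_mono2)
    qed (use m in auto)
    then have "\<kappa> * (t - s m) powr (2 * H) \<le> \<kappa> * (MIN j\<in>{1..m}. \<bar>t - s j\<bar> powr (2 * H))"
      using \<kappa>(1) by (intro mult_left_mono) auto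
    then have "AE \<omega> in M. \<kappa> * (t - s m) powr (2 * H) \<le> cond_variance M (sigma_of_times M Y m s) (Y t) \<omega>"
      using \<kappa>(2)[OF m s] by (auto elim!: eventually_mono)
    from cond_variance_lower_bound[OF subalgebra_sigma_of_times sq[OF t] W this, of c] pos
    show "\<kappa> * (c\<^sup>2 * (t - s m) powr (2 * H)) \<le> expectation (\<lambda>\<omega>. (c * Y t \<omega> + W \<omega>)\<^sup>2)"
      by (force simp: mult_ac less_imp_le)
  qed
qed

lemma variance_at_1_pos: "expectation (\<lambda>\<omega>. (Y 1 \<omega>)\<^sup>2) > 0"
proof -
  obtain \<kappa> where \<kappa>: "\<kappa> > 0"
    "\<And>m s t c W. m \<ge> 1 \<Longrightarrow> 0 < s 1 \<Longrightarrow> mono_on {1..m} s \<Longrightarrow> s m < t \<Longrightarrow> sq_integrable M W \<Longrightarrow>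
      W \<in> borel_measurable (sigma_of_times M Y m s) \<Longrightarrow>
      \<kappa> * (c\<^sup>2 * (t - s m) powr (2 * H)) \<le> expectation (\<lambda>\<omega>. (c * Y t \<omega> + W \<omega>)\<^sup>2)"
    using slnd_variance by blast
  have "\<kappa> * (1\<^sup>2 * (1 - 1/2) powr (2 * H)) \<le> expectation (\<lambda>\<omega>. (1 * Y 1 \<omega> + 0)\<^sup>2)"
    by (rule \<kappa>(2)[of 1 "\<lambda>_. 1/2"]) (auto simp: sq_integrable_zero mono_on_def)
  moreover have "\<kappa> * (1\<^sup>2 * (1 - 1/2) powr (2 * H)) > 0" using \<kappa>(1) by simp
  ultimately show ?thesis by simp
qed

definition increment_sum :: "nat \<Rightarrow> (nat \<Rightarrow> real) \<Rightarrow> (nat \<Rightarrow> real) \<Rightarrow> 'w \<Rightarrow> real" where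
  "increment_sum m y s \<omega> = (\<Sum>i=1..m. y i * (Y (s i) \<omega> - Y (s (i - 1)) \<omega>))"

lemma sq_integrable_increment_sum:
  assumes "\<And>i. i \<le> m \<Longrightarrow> 0 \<le> s i"
  shows "sq_integrable M (increment_sum m y s)"
  unfolding increment_sum_def[abs_def]
  by (intro sq_integrable_sum sq_integrable_cmult sq_integrable_diff sq assms) auto

text \<open>The last increment cannot be compensated by the past. With a single increment there is no positive
  earlier time to condition on; there the scaling of the variance takes over.\<close>

lemma last_increment_lower_bound:
  obtains \<kappa> where "\<kappa> > 0"
    "\<And>m y s. time_chain (Suc m) s \<Longrightarrow>
      \<kappa> * ((y (Suc m))\<^sup>2 * (s (Suc m) - s m) powr (2 * H)) \<le> expectation (\<lambda>\<omega>. (increment_sum (Suc m) y s \<omega>)\<^sup>2)"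
proof -
  obtain \<kappa> where \<kappa>: "\<kappa> > 0"
    "\<And>m s t c W. m \<ge> 1 \<Longrightarrow> 0 < s 1 \<Longrightarrow> mono_on {1..m} s \<Longrightarrow> s m < t \<Longrightarrow> sq_integrable M W \<Longrightarrow>
      W \<in> borel_measurable (sigma_of_times M Y m s) \<Longrightarrow>
      \<kappa> * (c\<^sup>2 * (t - s m) powr (2 * H)) \<le> expectation (\<lambda>\<omega>. (c * Y t \<omega> + W \<omega>)\<^sup>2)"
    using slnd_variance by blast
  define v where "v = expectation (\<lambda>\<omega>. (Y 1 \<omega>)\<^sup>2)"
  have v: "v > 0" unfolding v_def by (rule variance_at_1_pos)
  show thesis
  proof (rule that[of "min \<kappa> v"])
    show "min \<kappa> v > 0" using \<kappa> v by simp
    fix m and y s :: "nat \<Rightarrow> real"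
    assume chain: "time_chain (Suc m) s"
    then have s: "s 0 = 0" "s m < s (Suc m)" by (auto simp: time_chain_def dest: bspec[of _ _ "Suc m"])
    note nonneg = time_chain_positive[OF chain]
    let ?p = "(y (Suc m))\<^sup>2 * (s (Suc m) - s m) powr (2 * H)"
    have sqI: "sq_integrable M (increment_sum (Suc m) y s)"
      by (intro sq_integrable_increment_sum nonneg)
    show "min \<kappa> v * ?p \<le> expectation (\<lambda>\<omega>. (increment_sum (Suc m) y s \<omega>)\<^sup>2)"
    proof (cases "m = 0")
      case True
      have Y1: "sq_integrable M (Y (s 1))" using nonneg[of 1] by (intro sq) auto
      have "expectation (\<lambda>\<omega>. (increment_sum (Suc m) y s \<omega>)\<^sup>2) = expectation (\<lambda>\<omega>. (y 1)\<^sup>2 * (Y (s 1) \<omega>)\<^sup>2)"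
      proof (rule integral_cong_AE)
        show "AE \<omega> in M. (increment_sum (Suc m) y s \<omega>)\<^sup>2 = (y 1)\<^sup>2 * (Y (s 1) \<omega>)\<^sup>2"
          using start by eventually_elim (simp add: increment_sum_def True s power_mult_distrib)
      qed (use sqI Y1 in \<open>auto simp: sq_integrable_def\<close>)
      also have "\<dots> = v * ?p"
        using scaling[of "s 1"] nonneg[of 1] by (simp add: True s v_def)
      also have "\<dots> \<ge> min \<kappa> v * ?p"
        by (intro mult_right_mono) auto
      finally show ?thesis .
    next
      case False
      (* the variable at time 0 vanishes almost surely but is not among those conditioned on *)
      define Y0 where "Y0 j \<omega> = (if j = 0 then 0 else Y (s j) \<omega>)" for j \<omega>
      define W where "W \<omega> = (\<Sum>i=1..m. y i * (Y0 i \<omega> - Y0 (i - 1) \<omega>)) - y (Suc m) * Y0 m \<omega>" for \<omega>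
      have Y0s: "sq_integrable M (Y0 j)" if "j \<le> m" for j
        using that nonneg(1)[of j] by (cases "j = 0") (auto simp: Y0_def[abs_def] sq_integrable_zero intro: sq)
      have Y0F: "Y0 j \<in> borel_measurable (sigma_of_times M Y m s)" if "j \<le> m" for j
        using that measurable_sigma_of_times[of j m s] by (cases "j = 0") (auto simp: Y0_def[abs_def])
      have Ws: "sq_integrable M W" unfolding W_def[abs_def]
        by (intro sq_integrable_diff sq_integrable_sum sq_integrable_cmult Y0s) auto
      have WF: "W \<in> borel_measurable (sigma_of_times M Y m s)" unfolding W_def[abs_def]
        by (intro borel_measurable_diff borel_measurable_sum borel_measurable_times Y0F) auto
      have sm: "sq_integrable M (Y (s (Suc m)))" using nonneg(1)[of "Suc m"] by (intro sq) auto
      have "min \<kappa> v * ?p \<le> \<kappa> * ?p" by (intro mult_right_mono) auto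
      also have "\<dots> \<le> expectation (\<lambda>\<omega>. (y (Suc m) * Y (s (Suc m)) \<omega> + W \<omega>)\<^sup>2)"
      proof (rule \<kappa>(2)[OF _ _ _ _ Ws WF])
        show "m \<ge> 1" "0 < s 1" "s m < s (Suc m)" using False nonneg(2)[of 1] s(2) by auto
        show "mono_on {1..m} s" by (intro mono_onI time_chain_mono[OF chain]) auto
      qed
      also have "\<dots> = expectation (\<lambda>\<omega>. (increment_sum (Suc m) y s \<omega>)\<^sup>2)"
      proof (rule integral_cong_AE)
        show "AE \<omega> in M. (y (Suc m) * Y (s (Suc m)) \<omega> + W \<omega>)\<^sup>2 = (increment_sum (Suc m) y s \<omega>)\<^sup>2"
          using start
        proof eventually_elim
          case (elim \<omega>)
          have "Y0 j \<omega> = Y (s j) \<omega>" for j using elim s by (simp add: Y0_def)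
          then show ?case by (simp add: W_def increment_sum_def algebra_simps)
        qed
      qed (use sqI Ws sm in \<open>auto simp: sq_integrable_def\<close>)
      finally show ?thesis .
    qed
  qed
qed

text \<open>Let \<open>Z\<^sub>m\<close> be the sum of the first \<open>m\<close> terms and \<open>p\<close> the new contribution
  \<open>y\<^sub>m\<^sub>+\<^sub>1\<^sup>2 (s\<^sub>m\<^sub>+\<^sub>1 - s\<^sub>m) powr (2 * H)\<close>. Then \<open>E Z\<^sub>m\<^sub>+\<^sub>1\<^sup>2\<close> dominates both a multiple of \<open>p\<close>
  and \<open>E Z\<^sub>m\<^sup>2 / 2 - |C| p\<close>. A suitable multiple of the first bound makes up for the loss in the
  second, which closes the induction without determinants.\<close>

lemma increment_sum_lower_bound:
  "\<exists>\<kappa>>0. \<forall>y s. time_chain m s \<longrightarrow>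
     \<kappa> * (\<Sum>i=1..m. (y i)\<^sup>2 * (s i - s (i - 1)) powr (2 * H)) \<le> expectation (\<lambda>\<omega>. (increment_sum m y s \<omega>)\<^sup>2)"
proof (induction m)
  case 0
  show ?case by (intro exI[of _ 1]) (simp add: increment_sum_def)
next
  case (Suc m)
  from Suc.IH obtain c where c0: "c > 0 \<and> (\<forall>y s. time_chain m s \<longrightarrow>
     c * (\<Sum>i=1..m. (y i)\<^sup>2 * (s i - s (i - 1)) powr (2 * H)) \<le> expectation (\<lambda>\<omega>. (increment_sum m y s \<omega>)\<^sup>2))"
    by (rule exE)
  note c = conjunct1[OF c0] conjunct2[OF c0, rule_format]
  obtain \<kappa> where \<kappa>: "\<kappa> > 0"
    "\<And>m y s. time_chain (Suc m) s \<Longrightarrow>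
      \<kappa> * ((y (Suc m))\<^sup>2 * (s (Suc m) - s m) powr (2 * H)) \<le> expectation (\<lambda>\<omega>. (increment_sum (Suc m) y s \<omega>)\<^sup>2)"
    using last_increment_lower_bound by blast
  define A where "A = (\<bar>C\<bar> + 1) / \<kappa>"
  have A: "A > 0" "A * \<kappa> = \<bar>C\<bar> + 1" using \<kappa>(1) by (auto simp: A_def add_nonneg_pos)
  (* (1 + A) copies of the second moment pay for half of the old one and for the new term *)
  define \<kappa>' where "\<kappa>' = min (c / 2) 1 / (1 + A)"
  have \<kappa>': "\<kappa>' > 0" using A c by (simp add: \<kappa>'_def)
  show ?case
  proof (intro exI[of _ \<kappa>'] conjI allI impI \<kappa>')
    fix y s :: "nat \<Rightarrow> real"
    assume chain: "time_chain (Suc m) s"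
    then have s: "s m < s (Suc m)" "time_chain m s"
      by (auto simp: time_chain_def dest: bspec[of _ _ "Suc m"])
    note nonneg = time_chain_positive[OF chain]
    let ?E = "expectation (\<lambda>\<omega>. (increment_sum (Suc m) y s \<omega>)\<^sup>2)"
    let ?G = "expectation (\<lambda>\<omega>. (increment_sum m y s \<omega>)\<^sup>2)"
    let ?S = "\<Sum>i=1..m. (y i)\<^sup>2 * (s i - s (i - 1)) powr (2 * H)"
    let ?p = "(y (Suc m))\<^sup>2 * (s (Suc m) - s m) powr (2 * H)"
    have S: "0 \<le> ?S" by (intro sum_nonneg) auto
    have p: "0 \<le> ?p" by auto
    have sqs: "sq_integrable M (increment_sum (Suc m) y s)" "sq_integrable M (increment_sum m y s)"
      using nonneg by (auto intro!: sq_integrable_increment_sum)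
    define L where "L \<omega> = y (Suc m) * (Y (s (Suc m)) \<omega> - Y (s m) \<omega>)" for \<omega>
    have sL: "sq_integrable M L" unfolding L_def[abs_def]
      using nonneg by (intro sq_integrable_cmult sq_integrable_diff sq) auto
    have "?G \<le> expectation (\<lambda>\<omega>. 2 * (increment_sum (Suc m) y s \<omega>)\<^sup>2 + 2 * (L \<omega>)\<^sup>2)"
    proof (rule integral_mono)
      fix \<omega>
      have "increment_sum (Suc m) y s \<omega> = increment_sum m y s \<omega> + L \<omega>"
        by (simp add: increment_sum_def L_def)
      moreover have "a\<^sup>2 \<le> 2 * (a + b)\<^sup>2 + 2 * b\<^sup>2" for a b :: real
        using zero_le_power2[of "a + 2 * b"] by (simp add: power2_eq_square algebra_simps)
      ultimately show "(increment_sum m y s \<omega>)\<^sup>2 \<le> 2 * (increment_sum (Suc m) y s \<omega>)\<^sup>2 + 2 * (L \<omega>)\<^sup>2"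
        by simp
    qed (use sqs sL in \<open>auto simp: sq_integrable_def\<close>)
    also have "\<dots> = 2 * ?E + 2 * expectation (\<lambda>\<omega>. (L \<omega>)\<^sup>2)"
      using sqs sL by (simp add: sq_integrable_def)
    also have "expectation (\<lambda>\<omega>. (L \<omega>)\<^sup>2) = (y (Suc m))\<^sup>2 * expectation (\<lambda>\<omega>. (Y (s (Suc m)) \<omega> - Y (s m) \<omega>)\<^sup>2)"
      by (simp add: L_def power_mult_distrib)
    also have "\<dots> \<le> (y (Suc m))\<^sup>2 * (C * (s (Suc m) - s m) powr (2 * H))"
      using nonneg(1)[of m] s(1) by (intro mult_left_mono increment) auto
    also have "\<dots> \<le> \<bar>C\<bar> * ?p"
      using mult_right_mono[OF abs_ge_self[of C] p] by (simp add: mult_ac)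
    finally have 1: "?G \<le> 2 * ?E + 2 * (\<bar>C\<bar> * ?p)" by simp
    have 2: "\<kappa> * ?p \<le> ?E" by (rule \<kappa>(2)[OF chain])
    have 3: "c * ?S \<le> ?G" by (rule c(2)[OF s(2)])
    have "A * (\<kappa> * ?p) \<le> A * ?E" using 2 A by (intro mult_left_mono) auto
    then have "(\<bar>C\<bar> + 1) * ?p \<le> A * ?E" using A(2) by (simp add: mult.assoc[symmetric])
    then have 4: "c / 2 * ?S + ?p \<le> (1 + A) * ?E"
      using 1 3 by (simp add: distrib_right)
    have "min (c / 2) 1 * (?S + ?p) \<le> c / 2 * ?S + 1 * ?p"
      unfolding distrib_left using S p by (intro add_mono mult_right_mono) auto
    also have "\<dots> \<le> (1 + A) * ?E" unfolding mult_1_left by (rule 4)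
    finally have "min (c / 2) 1 * (?S + ?p) / (1 + A) \<le> ?E"
      using A(1) by (subst pos_divide_le_eq) (auto simp only: mult.commute)
    then have "\<kappa>' * (?S + ?p) \<le> ?E" by (simp only: \<kappa>'_def times_divide_eq_left)
    then show "\<kappa>' * (\<Sum>i=1..Suc m. (y i)\<^sup>2 * (s i - s (i - 1)) powr (2 * H)) \<le> ?E"
      by simp
  qed
qed

end

section \<open>The Gaussian process\<close>

lemma G_L_component_moments:
  fixes X :: "real \<Rightarrow> 'w \<Rightarrow> real^'d::finite"
  assumes G: "G_L M H X" and "0 \<le> t"
  shows "sq_integrable M (\<lambda>\<omega>. X t \<omega> $ j)" and "integral\<^sup>L M (\<lambda>\<omega>. X t \<omega> $ j) = 0"
proof -
  have *: "\<forall>T c. finite T \<longrightarrow> T \<subseteq> {0..} \<longrightarrow> centered_gaussian_rv M (\<lambda>\<omega>. \<Sum>t\<in>T. c t \<bullet> X t \<omega>)"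
    using G by (simp add: G_L_def centered_gaussian_process_def)
  have "centered_gaussian_rv M (\<lambda>\<omega>. X t \<omega> $ j)"
    using *[rule_format, of "{t}" "\<lambda>_. axis j 1"] \<open>0 \<le> t\<close> by (simp add: inner_axis')
  then show "sq_integrable M (\<lambda>\<omega>. X t \<omega> $ j)" and "integral\<^sup>L M (\<lambda>\<omega>. X t \<omega> $ j) = 0"
    using centered_gaussian_rv_moments G by (auto simp: G_L_def)
qed

lemma G_L_self_similar_moment:
  fixes X :: "real \<Rightarrow> 'w \<Rightarrow> real^'d::finite"
  assumes G: "G_L M H X" and a: "0 < a" and t: "0 \<le> t"
  shows "integral\<^sup>L M (\<lambda>\<omega>. (X (a * t) \<omega> $ j)\<^sup>2) = a powr (2 * H) * integral\<^sup>L M (\<lambda>\<omega>. (X t \<omega> $ j)\<^sup>2)"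
proof -
  have X: "X u \<in> borel_measurable M" if "0 \<le> u" for u
    using G that by (simp add: G_L_def centered_gaussian_process_def)
  let ?N = "Pi\<^sub>M {0..} (\<lambda>_. borel) :: (real \<Rightarrow> real^'d) measure"
  have ev: "(\<lambda>p. (p t $ j)\<^sup>2) \<in> borel_measurable ?N"
  proof -
    have "(\<lambda>p. p t) \<in> borel_measurable ?N" using t by (intro measurable_component_singleton) auto
    then have "(\<lambda>p. p t $ j) \<in> borel_measurable ?N"
      by (rule measurable_compose) (intro borel_measurable_continuous_onI continuous_intros)
    then show ?thesis by measurable
  qed
  have eq: "process_law M (\<lambda>t. X (a * t)) = process_law M (\<lambda>t \<omega>. (a powr H) *\<^sub>R X t \<omega>)"
    using G a by (simp add: G_L_def self_similar_def)
  have "integral\<^sup>L M (\<lambda>\<omega>. (X (a * t) \<omega> $ j)\<^sup>2) = integral\<^sup>L (process_law M (\<lambda>t. X (a * t))) (\<lambda>p. (p t $ j)\<^sup>2)"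
    unfolding process_law_def using t a X
    by (subst integral_distr[OF _ ev]) (auto intro!: measurable_restrict)
  also have "\<dots> = integral\<^sup>L M (\<lambda>\<omega>. (a powr H * (X t \<omega> $ j))\<^sup>2)"
    unfolding eq unfolding process_law_def using t X
    by (subst integral_distr[OF _ ev]) (auto intro!: measurable_restrict borel_measurable_scaleR)
  also have "\<dots> = (a powr H)\<^sup>2 * integral\<^sup>L M (\<lambda>\<omega>. (X t \<omega> $ j)\<^sup>2)"
    by (simp add: power_mult_distrib)
  also have "(a powr H)\<^sup>2 = a powr (2 * H)" by (simp add: power2_eq_square flip: powr_add)
  finally show ?thesis .
qed

lemma G_L_moment_scaling:
  fixes X :: "real \<Rightarrow> 'w \<Rightarrow> real^'d::finite"
  assumes G: "G_L M H X" and H: "0 < H" and t: "0 \<le> t"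
  shows "integral\<^sup>L M (\<lambda>\<omega>. (X t \<omega> $ j)\<^sup>2) = t powr (2 * H) * integral\<^sup>L M (\<lambda>\<omega>. (X 1 \<omega> $ j)\<^sup>2)"
proof (cases "t = 0")
  case False
  then show ?thesis using G_L_self_similar_moment[OF G, of t 1 j] t by simp
next
  case True
  (* scaling by 2 fixes the variance at time 0 but multiplies it by a factor above 1 *)
  have "(2::real) powr (2 * H) > 1" using H by simp
  moreover have "integral\<^sup>L M (\<lambda>\<omega>. (X 0 \<omega> $ j)\<^sup>2) = 2 powr (2 * H) * integral\<^sup>L M (\<lambda>\<omega>. (X 0 \<omega> $ j)\<^sup>2)"
    using G_L_self_similar_moment[OF G, of 2 0 j] by simp
  ultimately have "integral\<^sup>L M (\<lambda>\<omega>. (X 0 \<omega> $ j)\<^sup>2) = 0" by auto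
  then show ?thesis using True by simp
qed

text \<open>For \<open>t - s\<close> small compared with \<open>s\<close> this is the upper half of \<open>assumption_A\<close>. Otherwise \<open>t\<close> is at
  most a multiple of \<open>t - s\<close>, and the variances at the two times, known by scaling, suffice.\<close>

lemma G_L_increment_bound:
  fixes X :: "real \<Rightarrow> 'w \<Rightarrow> real^'d::finite"
  assumes G: "G_L M H X" and H: "0 < H"
  obtains C where "\<And>s t. 0 \<le> s \<Longrightarrow> s \<le> t \<Longrightarrow>
    integral\<^sup>L M (\<lambda>\<omega>. (X t \<omega> $ j - X s \<omega> $ j)\<^sup>2) \<le> C * (t - s) powr (2 * H)"
proof -
  interpret prob_space M using G by (simp add: G_L_def)
  let ?v = "expectation (\<lambda>\<omega>. (X 1 \<omega> $ j)\<^sup>2)"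
  have v: "0 \<le> ?v" by simp
  note mom = G_L_component_moments[OF G, where j=j]
  have sqd: "sq_integrable M (\<lambda>\<omega>. X t \<omega> $ j - X s \<omega> $ j)" if "0 \<le> s" "0 \<le> t" for s t
    using that by (intro sq_integrable_diff mom)
  note scal = G_L_moment_scaling[OF G H, where j=j]
  have "assumption_A M H (\<lambda>t \<omega>. X t \<omega> $ j)" using G by (simp add: G_L_def)
  then obtain \<eta> \<sigma> \<phi> where \<eta>: "\<eta> \<ge> 1" and \<phi>: "mono_on {0..1/\<eta>} \<phi>"
    and up: "\<And>t h. t > 0 \<Longrightarrow> h \<in> {0..t/\<eta>} \<Longrightarrow>
      variance (\<lambda>\<omega>. X (t + h) \<omega> $ j - X t \<omega> $ j) \<le> h powr (2 * H) * (\<sigma> + \<phi> (h / t))"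
    unfolding assumption_A_def by blast
  define C where "C = max (\<sigma> + \<phi> (1 / \<eta>)) (4 * ?v * (\<eta> + 1) powr (2 * H))"
  have "expectation (\<lambda>\<omega>. (X t \<omega> $ j - X s \<omega> $ j)\<^sup>2) \<le> C * (t - s) powr (2 * H)" if st: "0 \<le> s" "s \<le> t" for s t
  proof (cases "0 < s \<and> t - s \<le> s / \<eta>")
    case True
    define h where "h = t - s"
    have h: "h \<in> {0..s/\<eta>}" "t = s + h" using True st by (auto simp: h_def)
    have "expectation (\<lambda>\<omega>. X t \<omega> $ j - X s \<omega> $ j) = 0"
      using mom(2)[of t] mom(2)[of s] sq_integrable_integrable[OF mom(1)] st by simp
    then have "expectation (\<lambda>\<omega>. (X t \<omega> $ j - X s \<omega> $ j)\<^sup>2) = variance (\<lambda>\<omega>. X (s + h) \<omega> $ j - X s \<omega> $ j)"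
      unfolding h(2) by (simp only: diff_zero)
    also have "\<dots> \<le> h powr (2 * H) * (\<sigma> + \<phi> (h / s))"
      using True by (intro up h) auto
    also have "\<dots> \<le> h powr (2 * H) * C"
    proof (intro mult_left_mono)
      have "h / s \<in> {0..1/\<eta>}" using h True \<eta> by (auto simp: field_simps)
      then have "\<phi> (h / s) \<le> \<phi> (1 / \<eta>)" using \<eta> by (intro mono_onD[OF \<phi>]) auto
      then show "\<sigma> + \<phi> (h / s) \<le> C" unfolding C_def by linarith
    qed auto
    finally show ?thesis by (simp add: h_def mult.commute)
  next
    case False
    have t0: "0 \<le> t" using st by simp
    have far: "t \<le> (\<eta> + 1) * (t - s)"
    proof (cases "s = 0")
      case True
      then show ?thesis using t0 \<eta> by (simp add: algebra_simps)
    next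
      case s: False
      then have "s < \<eta> * (t - s)" using False st \<eta> by (auto simp: field_simps)
      then show ?thesis by (simp add: algebra_simps)
    qed
    have i2: "integrable M (\<lambda>\<omega>. (X t \<omega> $ j)\<^sup>2)" "integrable M (\<lambda>\<omega>. (X s \<omega> $ j)\<^sup>2)"
      using mom(1)[of t] mom(1)[of s] st by (auto simp: sq_integrable_def)
    have "expectation (\<lambda>\<omega>. (X t \<omega> $ j - X s \<omega> $ j)\<^sup>2)
        \<le> expectation (\<lambda>\<omega>. 2 * (X t \<omega> $ j)\<^sup>2 + 2 * (X s \<omega> $ j)\<^sup>2)"
    proof (rule integral_mono)
      show "integrable M (\<lambda>\<omega>. (X t \<omega> $ j - X s \<omega> $ j)\<^sup>2)"
        using sqd[of s t] st by (simp add: sq_integrable_def)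
      show "(a - b)\<^sup>2 \<le> 2 * a\<^sup>2 + 2 * b\<^sup>2" for a b :: real
        using zero_le_power2[of "a + b"] by (simp add: power2_eq_square algebra_simps)
    qed (use i2 in auto)
    also have "\<dots> = 2 * expectation (\<lambda>\<omega>. (X t \<omega> $ j)\<^sup>2) + 2 * expectation (\<lambda>\<omega>. (X s \<omega> $ j)\<^sup>2)"
      using i2 by simp
    also have "\<dots> = 2 * (t powr (2 * H) * ?v) + 2 * (s powr (2 * H) * ?v)"
      by (simp only: scal[OF t0] scal[OF st(1)])
    also have "\<dots> \<le> 2 * (t powr (2 * H) * ?v) + 2 * (t powr (2 * H) * ?v)"
      using st H by (intro add_mono mult_left_mono mult_right_mono powr_mono2) auto
    also have "\<dots> = 4 * ?v * t powr (2 * H)" by simp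
    also have "\<dots> \<le> 4 * ?v * ((\<eta> + 1) * (t - s)) powr (2 * H)"
      using far t0 H by (intro mult_left_mono powr_mono2) auto
    also have "\<dots> = 4 * ?v * (\<eta> + 1) powr (2 * H) * (t - s) powr (2 * H)"
      using \<eta> st by (simp add: powr_mult)
    also have "\<dots> \<le> C * (t - s) powr (2 * H)"
      by (intro mult_right_mono) (auto simp: C_def)
    finally show ?thesis .
  qed
  then show thesis by (rule that)
qed

lemma G_L_component_lnd:
  fixes X :: "real \<Rightarrow> 'w \<Rightarrow> real^'d::finite"
  assumes G: "G_L M H X" and H: "0 < H"
  obtains C where "lnd_process M (\<lambda>t \<omega>. X t \<omega> $ j) H C"
proof -
  interpret prob_space M using G by (simp add: G_L_def)
  obtain C where C: "\<And>s t. 0 \<le> s \<Longrightarrow> s \<le> t \<Longrightarrow>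
    expectation (\<lambda>\<omega>. (X t \<omega> $ j - X s \<omega> $ j)\<^sup>2) \<le> C * (t - s) powr (2 * H)"
    using G_L_increment_bound[OF G H] by blast
  have "lnd_process M (\<lambda>t \<omega>. X t \<omega> $ j) H C"
  proof
    show "0 < H" by fact
    show "sq_integrable M (\<lambda>\<omega>. X t \<omega> $ j)" if "0 \<le> t" for t
      using G_L_component_moments[OF G that] by blast
    show "AE \<omega> in M. X 0 \<omega> $ j = 0"
      using integral_nonneg_eq_0_iff_AE[of M "\<lambda>\<omega>. (X 0 \<omega> $ j)\<^sup>2"] G_L_moment_scaling[OF G H, of 0 j] G_L_component_moments(1)[OF G, of 0 j]
      by (auto simp: sq_integrable_def)
    show "expectation (\<lambda>\<omega>. (X t \<omega> $ j)\<^sup>2) = t powr (2 * H) * expectation (\<lambda>\<omega>. (X 1 \<omega> $ j)\<^sup>2)"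
      if "0 \<le> t" for t
      by (rule G_L_moment_scaling[OF G H that])
    show "strong_local_nondeterminism M H (\<lambda>t \<omega>. X t \<omega> $ j)" using G by (simp add: G_L_def)
  qed (rule C)
  then show thesis by (rule that)
qed

lemma (in prob_space) expectation_square_sum_orthogonal:
  fixes A :: "'i \<Rightarrow> 'a \<Rightarrow> real"
  assumes "finite I" and sq: "\<And>i. i \<in> I \<Longrightarrow> sq_integrable M (A i)"
    and orth: "\<And>i j. i \<in> I \<Longrightarrow> j \<in> I \<Longrightarrow> i \<noteq> j \<Longrightarrow> expectation (\<lambda>\<omega>. A i \<omega> * A j \<omega>) = 0"
  shows "expectation (\<lambda>\<omega>. (\<Sum>i\<in>I. A i \<omega>)\<^sup>2) = (\<Sum>i\<in>I. expectation (\<lambda>\<omega>. (A i \<omega>)\<^sup>2))"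
proof -
  have "expectation (\<lambda>\<omega>. (\<Sum>i\<in>I. A i \<omega>)\<^sup>2) = expectation (\<lambda>\<omega>. \<Sum>i\<in>I. \<Sum>j\<in>I. A i \<omega> * A j \<omega>)"
    by (simp add: power2_eq_square sum_product)
  also have "\<dots> = (\<Sum>i\<in>I. \<Sum>j\<in>I. expectation (\<lambda>\<omega>. A i \<omega> * A j \<omega>))"
    using sq by (simp add: sq_integrable_mult)
  also have "\<dots> = (\<Sum>i\<in>I. \<Sum>j\<in>I. if j = i then expectation (\<lambda>\<omega>. (A i \<omega>)\<^sup>2) else 0)"
    using orth by (intro sum.cong) (auto simp: power2_eq_square)
  also have "\<dots> = (\<Sum>i\<in>I. expectation (\<lambda>\<omega>. (A i \<omega>)\<^sup>2))"
    using \<open>finite I\<close> by simp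
  finally show ?thesis .
qed

text \<open>The components are independent and centered, so the variance is the sum over the components of the
  one-dimensional variances.\<close>

lemma G_L_variance_lower_bound:
  fixes X :: "real \<Rightarrow> 'w \<Rightarrow> real^'d::finite"
    and m :: nat
  assumes G: "G_L M H X" and H: "0 < H"
  obtains \<kappa> where "\<kappa> > 0" "\<And>x s. time_chain m s \<Longrightarrow>
    \<kappa> * (\<Sum>i=1..m. (norm (x i))\<^sup>2 * (s i - s (i - 1)) powr (2 * H))
      \<le> prob_space.variance M (\<lambda>\<omega>. \<Sum>i=1..m. x i \<bullet> (X (s i) \<omega> - X (s (i - 1)) \<omega>))"
proof -
  interpret prob_space M using G by (simp add: G_L_def)
  have "\<exists>\<kappa>>0. \<forall>y s. time_chain m s \<longrightarrow>
     \<kappa> * (\<Sum>i=1..m. (y i)\<^sup>2 * (s i - s (i - 1)) powr (2 * H))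
       \<le> expectation (\<lambda>\<omega>. (\<Sum>i=1..m. y i * (X (s i) \<omega> $ j - X (s (i - 1)) \<omega> $ j))\<^sup>2)" for j
  proof -
    obtain C where "lnd_process M (\<lambda>t \<omega>. X t \<omega> $ j) H C" using G_L_component_lnd[OF G H] by blast
    then interpret P: lnd_process M "\<lambda>t \<omega>. X t \<omega> $ j" H C .
    show ?thesis using P.increment_sum_lower_bound[of m] unfolding P.increment_sum_def .
  qed
  then have "\<exists>K. \<forall>j. K j > 0 \<and> (\<forall>y s. time_chain m s \<longrightarrow>
     K j * (\<Sum>i=1..m. (y i)\<^sup>2 * (s i - s (i - 1)) powr (2 * H))
       \<le> expectation (\<lambda>\<omega>. (\<Sum>i=1..m. y i * (X (s i) \<omega> $ j - X (s (i - 1)) \<omega> $ j))\<^sup>2))"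
    by (intro choice allI)
  then obtain K where K: "\<And>j. K j > 0" "\<And>j y s. time_chain m s \<Longrightarrow>
     K j * (\<Sum>i=1..m. (y i)\<^sup>2 * (s i - s (i - 1)) powr (2 * H))
       \<le> expectation (\<lambda>\<omega>. (\<Sum>i=1..m. y i * (X (s i) \<omega> $ j - X (s (i - 1)) \<omega> $ j))\<^sup>2)"
    by blast
  define \<kappa> where "\<kappa> = Min (range K)"
  have \<kappa>: "\<kappa> > 0" "\<And>j. \<kappa> \<le> K j" using K(1) by (auto simp: \<kappa>_def)
  show thesis
  proof (rule that[OF \<kappa>(1)])
    fix x :: "nat \<Rightarrow> real^'d" and s assume chain: "time_chain m s"
    note nonneg = time_chain_positive(1)[OF chain]
    define A where "A j \<omega> = (\<Sum>i=1..m. (x i $ j) * (X (s i) \<omega> $ j - X (s (i - 1)) \<omega> $ j))" for j \<omega>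
    have sqX: "sq_integrable M (\<lambda>\<omega>. X (s i) \<omega> $ j)" if "i \<le> m" for i j
      using G_L_component_moments(1)[OF G nonneg[OF that]] .
    have sqA: "sq_integrable M (A j)" for j
      unfolding A_def[abs_def] by (intro sq_integrable_sum sq_integrable_cmult sq_integrable_diff sqX) auto
    have EA: "expectation (A j) = 0" for j
    proof -
      have "integrable M (\<lambda>\<omega>. X (s i) \<omega> $ j)" "expectation (\<lambda>\<omega>. X (s i) \<omega> $ j) = 0" if "i \<le> m" for i
        using sq_integrable_integrable[OF sqX[OF that]] G_L_component_moments(2)[OF G nonneg[OF that]] by auto
      then show ?thesis unfolding A_def[abs_def]
        by (subst Bochner_Integration.integral_sum) (auto intro!: sum.neutral)
    qed
    have dot: "(\<Sum>i=1..m. x i \<bullet> (X (s i) \<omega> - X (s (i - 1)) \<omega>)) = (\<Sum>j\<in>UNIV. A j \<omega>)" for \<omega>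
      unfolding A_def by (subst sum.swap) (simp add: inner_vec_def)
    have "indep_vars (\<lambda>_. borel) (\<lambda>j \<omega>. A j \<omega>) UNIV"
    proof -
      let ?g = "\<lambda>j p. \<Sum>i=1..m. (x i $ j) * (p (s i) - p (s (i - 1))) :: real"
      have "indep_vars (\<lambda>_. Pi\<^sub>M {0..} (\<lambda>_. borel)) (\<lambda>j \<omega>. \<lambda>t\<in>{0..}. X t \<omega> $ j) UNIV"
        using G by (simp add: G_L_def iid_components_def)
      then have "indep_vars (\<lambda>_. borel) (\<lambda>j \<omega>. ?g j (\<lambda>t\<in>{0..}. X t \<omega> $ j)) UNIV"
      proof (rule indep_vars_compose2)
        have "(\<lambda>p. p (s i)) \<in> borel_measurable (Pi\<^sub>M {0..} (\<lambda>_. borel :: real measure))" if "i \<le> m" for i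
          using nonneg[OF that] by (intro measurable_component_singleton) auto
        then show "?g j \<in> borel_measurable (Pi\<^sub>M {0..} (\<lambda>_. borel))" for j
          by (intro borel_measurable_sum borel_measurable_times borel_measurable_diff) auto
      qed
      also have "(\<lambda>j \<omega>. ?g j (\<lambda>t\<in>{0..}. X t \<omega> $ j)) = (\<lambda>j \<omega>. A j \<omega>)"
        unfolding A_def by (intro ext sum.cong) (auto simp: nonneg)
      finally show ?thesis .
    qed
    then have orth: "expectation (\<lambda>\<omega>. A j \<omega> * A k \<omega>) = 0" if "j \<noteq> k" for j k
    proof -
      have "indep_vars (\<lambda>_. borel) A {j, k}"
        using \<open>indep_vars (\<lambda>_. borel) (\<lambda>j \<omega>. A j \<omega>) UNIV\<close> by (rule indep_vars_subset) auto
      then have "expectation (\<lambda>\<omega>. \<Prod>i\<in>{j,k}. A i \<omega>) = (\<Prod>i\<in>{j,k}. expectation (A i))"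
        by (intro indep_vars_lebesgue_integral) (auto intro: sq_integrable_integrable sqA)
      then show ?thesis using that EA by simp
    qed
    have "expectation (\<lambda>\<omega>. \<Sum>j\<in>UNIV. A j \<omega>) = 0"
      using EA sq_integrable_integrable[OF sqA] by (subst Bochner_Integration.integral_sum) auto
    then have var: "variance (\<lambda>\<omega>. \<Sum>i=1..m. x i \<bullet> (X (s i) \<omega> - X (s (i - 1)) \<omega>)) = (\<Sum>j\<in>UNIV. expectation (\<lambda>\<omega>. (A j \<omega>)\<^sup>2))"
      unfolding dot using expectation_square_sum_orthogonal[of UNIV A] sqA orth by simp
    have "\<kappa> * (\<Sum>i=1..m. (norm (x i))\<^sup>2 * (s i - s (i - 1)) powr (2 * H))
        = (\<Sum>j\<in>UNIV. \<kappa> * (\<Sum>i=1..m. (x i $ j)\<^sup>2 * (s i - s (i - 1)) powr (2 * H)))"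
    proof -
      have "(norm v)\<^sup>2 = (\<Sum>j\<in>UNIV. (v $ j)\<^sup>2)" for v :: "real^'d"
        unfolding power2_norm_eq_inner inner_vec_def by (simp add: power2_eq_square)
      then show ?thesis
        by (simp add: sum_distrib_right sum_distrib_left) (rule sum.swap)
    qed
    also have "\<dots> \<le> (\<Sum>j\<in>UNIV. expectation (\<lambda>\<omega>. (A j \<omega>)\<^sup>2))"
    proof (rule sum_mono)
      fix j
      have "\<kappa> * (\<Sum>i=1..m. (x i $ j)\<^sup>2 * (s i - s (i - 1)) powr (2 * H))
          \<le> K j * (\<Sum>i=1..m. (x i $ j)\<^sup>2 * (s i - s (i - 1)) powr (2 * H))"
        by (intro mult_right_mono \<kappa> sum_nonneg) auto
      also have "\<dots> \<le> expectation (\<lambda>\<omega>. (A j \<omega>)\<^sup>2)"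
        unfolding A_def by (rule K(2)[OF chain])
      finally show "\<kappa> * (\<Sum>i=1..m. (x i $ j)\<^sup>2 * (s i - s (i - 1)) powr (2 * H)) \<le> expectation (\<lambda>\<omega>. (A j \<omega>)\<^sup>2)" .
    qed
    finally show "\<kappa> * (\<Sum>i=1..m. (norm (x i))\<^sup>2 * (s i - s (i - 1)) powr (2 * H))
      \<le> variance (\<lambda>\<omega>. \<Sum>i=1..m. x i \<bullet> (X (s i) \<omega> - X (s (i - 1)) \<omega>))"
      unfolding var .
  qed
qed

text \<open>A process with continuous paths is the pointwise limit of its discretisations in time. Times are cut
  off at 0 because nothing is known about the process at negative times.\<close>

lemma continuous_paths_jointly_measurable:
  fixes X :: "real \<Rightarrow> 'w \<Rightarrow> 'v::{second_countable_topology, metric_space}"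
  assumes X: "\<And>t. 0 \<le> t \<Longrightarrow> X t \<in> borel_measurable M"
    and cont: "\<And>\<omega>. \<omega> \<in> space M \<Longrightarrow> continuous_on {0..} (\<lambda>t. X t \<omega>)"
  shows "(\<lambda>(t, \<omega>). X (max 0 t) \<omega>) \<in> borel_measurable (borel \<Otimes>\<^sub>M M)"
proof (rule borel_measurable_LIMSEQ_metric)
  define r where "r n t = of_int \<lfloor>t * real (Suc n)\<rfloor> / real (Suc n)" for n and t :: real
  have r: "(\<lambda>n. r n t) \<longlonglongrightarrow> t" for t
  proof (rule tendsto_sandwich)
    show "\<forall>\<^sub>F n in sequentially. t - 1 / real (Suc n) \<le> r n t"
    proof (intro always_eventually allI)
      fix n
      have "t * real (Suc n) - 1 \<le> of_int \<lfloor>t * real (Suc n)\<rfloor>" by linarith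
      then have "(t * real (Suc n) - 1) / real (Suc n) \<le> r n t"
        unfolding r_def by (intro divide_right_mono) auto
      then show "t - 1 / real (Suc n) \<le> r n t" by (simp add: diff_divide_distrib)
    qed
    show "\<forall>\<^sub>F n in sequentially. r n t \<le> t"
    proof (intro always_eventually allI)
      fix n
      have "of_int \<lfloor>t * real (Suc n)\<rfloor> \<le> t * real (Suc n)" by linarith
      then have "r n t \<le> (t * real (Suc n)) / real (Suc n)"
        unfolding r_def by (intro divide_right_mono) auto
      then show "r n t \<le> t" by simp
    qed
    show "(\<lambda>n. t - 1 / real (Suc n)) \<longlonglongrightarrow> t"
      using tendsto_diff[OF tendsto_const LIMSEQ_inverse_real_of_nat, of t] by (simp add: inverse_eq_divide)
  qed auto
  show "(\<lambda>(t, \<omega>). X (max 0 (r n t)) \<omega>) \<in> borel_measurable (borel \<Otimes>\<^sub>M M)" for n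
  proof -
    let ?f = "\<lambda>(k::int) (p::real \<times> 'w). X (max 0 (of_int k / real (Suc n))) (snd p)"
    have "(\<lambda>p. ?f \<lfloor>fst p * real (Suc n)\<rfloor> p) \<in> borel_measurable (borel \<Otimes>\<^sub>M M)"
    proof (rule measurable_compose_countable[where f = ?f and g = "\<lambda>p. \<lfloor>fst p * real (Suc n)\<rfloor>"])
      show "?f k \<in> borel_measurable (borel \<Otimes>\<^sub>M M)" for k
        by (rule measurable_compose[OF measurable_snd X]) auto
      show "(\<lambda>p. \<lfloor>fst p * real (Suc n)\<rfloor>) \<in> (borel :: real measure) \<Otimes>\<^sub>M M \<rightarrow>\<^sub>M count_space UNIV"
        by measurable
    qed
    then show ?thesis by (simp add: r_def case_prod_unfold)
  qed
  show "(\<lambda>n. (case p of (t, \<omega>) \<Rightarrow> X (max 0 (r n t)) \<omega>)) \<longlonglongrightarrow> (case p of (t, \<omega>) \<Rightarrow> X (max 0 t) \<omega>)"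
    if "p \<in> space (borel \<Otimes>\<^sub>M M)" for p
  proof -
    obtain t \<omega> where p: "p = (t, \<omega>)" "\<omega> \<in> space M"
      using \<open>p \<in> space (borel \<Otimes>\<^sub>M M)\<close> by (auto simp: space_pair_measure)
    have "(\<lambda>n. max 0 (r n t)) \<longlonglongrightarrow> max 0 t" by (intro tendsto_max tendsto_const r)
    then have "(\<lambda>n. X (max 0 (r n t)) \<omega>) \<longlonglongrightarrow> X (max 0 t) \<omega>"
      by (intro continuous_on_tendsto_compose[OF cont[OF p(2)]]) auto
    then show ?thesis by (simp add: p)
  qed
qed

section \<open>Monomial expansion of the difference\<close>

text \<open>The bound, up to a constant, for the first \<open>k\<close> factors of \<open>I\<^sub>k\<^sub>-\<^sub>1 - I\<^sub>k\<close> in terms of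
  \<open>t\<^sub>i = trunc (x\<^sub>i)\<close>: the squared factors at even indices below \<open>k\<close> and the increment of the Fourier
  transform in which \<open>I\<^sub>k\<^sub>-\<^sub>1\<close> and \<open>I\<^sub>k\<close> differ, for even \<open>k\<close> together with the factor at \<open>- x\<^sub>k\<close>.\<close>

definition leading :: "nat \<Rightarrow> nat \<Rightarrow> (nat \<Rightarrow> real) \<Rightarrow> real" where
  "leading \<beta> k t = (\<Prod>j=1..(k - 1) div 2. t (2 * j) ^ (2 * \<beta>)) *
     (if odd k then t k ^ \<beta> + t k * t (k + 1) ^ (\<beta> - 1)
      else t k ^ \<beta> * (t (k + 1) ^ \<beta> + t (k + 1) * t k ^ (\<beta> - 1)))"

text \<open>The exponents that occur when the first \<open>r\<close> factors have been expanded. The next factor can raise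
  the exponent at \<open>r + 1\<close> by \<open>\<beta>\<close>, so that exponent may be at most \<open>\<beta>\<close> until then.\<close>

definition admissible :: "nat \<Rightarrow> nat \<Rightarrow> nat \<Rightarrow> (nat \<Rightarrow> nat) \<Rightarrow> bool" where
  "admissible \<beta> k r q \<longleftrightarrow> (\<forall>i. q i \<le> 2 * \<beta>) \<and> q (Suc r) \<le> \<beta> \<and> (\<forall>i>Suc r. q i = 0) \<and>
     0 < q k \<and> q k < 2 * \<beta> \<and> (\<Sum>i=1..Suc r. q i) = \<beta> * r"

lemma prod_even_indices:
  fixes g :: "nat \<Rightarrow> 'a::comm_monoid_mult"
  shows "(\<Prod>j=1..l div 2. g (2 * j)) = (\<Prod>i=1..l. if even i then g i else 1)"
proof (induction l)
  case (Suc l)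
  show ?case
  proof (cases "even (Suc l)")
    case True
    then have "Suc l div 2 = Suc (l div 2)" "2 * Suc (l div 2) = Suc l" by presburger+
    with Suc show ?thesis using True by (simp del: mult_Suc_right)
  next
    case False
    then have "Suc l div 2 = l div 2" by presburger
    with Suc show ?thesis using False by simp
  qed
qed simp

lemma sum_even_indices: "(\<Sum>i=1..l. if even i then c else 0) = c * (l div 2)" for c :: nat
proof (induction l)
  case (Suc l)
  then show ?case by (auto elim!: oddE evenE)
qed simp

lemma leading_expansion:
  fixes \<beta> k :: nat
  assumes "\<beta> \<ge> 1" "k \<ge> 1"
  shows "\<exists>qs. (\<forall>q\<in>set qs. admissible \<beta> k k q) \<and>
    (\<forall>t. leading \<beta> k t = (\<Sum>q\<leftarrow>qs. \<Prod>i=1..Suc k. t i ^ q i))"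
proof -
  (* the exponents of a monomial with a at k and b at k + 1; index 0 is never used *)
  define E where "E a b i = (if i = 0 then 0 else if i < k then (if even i then 2 * \<beta> else 0)
     else if i = k then a else if i = Suc k then b else 0)" for a b i :: nat
  obtain l where l: "k = Suc l" using assms(2) by (cases k) auto
  have mono: "(\<Prod>i=1..Suc k. t i ^ E a b i) = (\<Prod>j=1..(k - 1) div 2. t (2 * j) ^ (2 * \<beta>)) * t k ^ a * t (Suc k) ^ b"
    for a b and t :: "nat \<Rightarrow> real"
  proof -
    have "(\<Prod>i=1..l. t i ^ E a b i) = (\<Prod>i=1..l. if even i then t i ^ (2 * \<beta>) else 1)"
      by (intro prod.cong) (auto simp: E_def l)
    then show ?thesis using prod_even_indices[of "\<lambda>i. t i ^ (2 * \<beta>)" l]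
      by (simp add: l) (simp add: E_def l)
  qed
  have adm: "admissible \<beta> k k (E a b)"
    if "a + b = (if odd k then \<beta> else 2 * \<beta>)" "0 < a" "a < 2 * \<beta>" "b \<le> \<beta>" for a b
  proof -
    have "(\<Sum>i=1..l. E a b i) = (\<Sum>i=1..l. if even i then 2 * \<beta> else 0)"
      by (intro sum.cong) (auto simp: E_def l)
    also have "\<dots> = 2 * \<beta> * (l div 2)" by (rule sum_even_indices)
    finally have "(\<Sum>i=1..Suc k. E a b i) = 2 * \<beta> * (l div 2) + (a + b)"
      by (simp add: l) (simp add: E_def l)
    also have "\<dots> = \<beta> * k"
    proof (cases "odd k")
      case True
      then have "l = 2 * (l div 2)" by (simp add: l)
      then have "\<beta> * k = \<beta> * (2 * (l div 2) + 1)" by (simp add: l)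
      then show ?thesis using that(1) True by simp
    next
      case False
      then have "Suc l = 2 * (l div 2) + 2" using l by presburger
      then have "\<beta> * k = \<beta> * (2 * (l div 2) + 2)" by (simp add: l)
      then show ?thesis using that(1) False by simp
    qed
    finally show ?thesis using that assms by (auto simp: admissible_def E_def)
  qed
  show ?thesis
  proof (cases "odd k")
    case True
    have "leading \<beta> k t = (\<Sum>q\<leftarrow>[E \<beta> 0, E 1 (\<beta> - 1)]. \<Prod>i=1..Suc k. t i ^ q i)" for t
      unfolding list.map sum_list.Cons sum_list.Nil mono using True by (simp add: leading_def algebra_simps)
    moreover have "\<forall>q\<in>set [E \<beta> 0, E 1 (\<beta> - 1)]. admissible \<beta> k k q"
      using True assms by (auto intro!: adm)
    ultimately show ?thesis by blast
  next
    case False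
    have p: "t k ^ \<beta> * t k ^ (\<beta> - 1) = t k ^ (2 * \<beta> - 1)" for t :: "nat \<Rightarrow> real"
      using assms by (simp add: power_add[symmetric] mult_2)
    have "leading \<beta> k t = (\<Sum>q\<leftarrow>[E \<beta> \<beta>, E (2 * \<beta> - 1) 1]. \<Prod>i=1..Suc k. t i ^ q i)" for t
      unfolding list.map sum_list.Cons sum_list.Nil mono p[symmetric]
      using False by (simp add: leading_def algebra_simps)
    moreover have "\<forall>q\<in>set [E \<beta> \<beta>, E (2 * \<beta> - 1) 1]. admissible \<beta> k k q"
      using False assms by (auto intro!: adm)
    ultimately show ?thesis by blast
  qed
qed

text \<open>Each further factor \<open>t\<^sub>i ^ \<beta> + t\<^sub>i\<^sub>+\<^sub>1 ^ \<beta>\<close> touches only indices beyond \<open>k\<close>, so the exponent at \<open>k\<close> stays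
  strictly between 0 and \<open>2 * \<beta>\<close>.\<close>

lemma chain_expansion:
  fixes \<beta> k r :: nat
  assumes "\<beta> \<ge> 1" "k \<ge> 1" "k \<le> r"
  shows "\<exists>qs. (\<forall>q\<in>set qs. admissible \<beta> k r q) \<and>
    (\<forall>t. leading \<beta> k t * (\<Prod>i=k+1..r. t i ^ \<beta> + t (i + 1) ^ \<beta>) = (\<Sum>q\<leftarrow>qs. \<Prod>i=1..Suc r. t i ^ q i))"
  using assms(3)
proof (induction r rule: dec_induct)
  case base
  show ?case using leading_expansion[OF assms(1,2)] by simp
next
  case (step r)
  then obtain qs where qs: "\<And>q. q \<in> set qs \<Longrightarrow> admissible \<beta> k r q"
    "\<And>t. leading \<beta> k t * (\<Prod>i=k+1..r. t i ^ \<beta> + t (i + 1) ^ \<beta>) = (\<Sum>q\<leftarrow>qs. \<Prod>i=1..Suc r. t i ^ q i)"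
    by blast
  define L where "L q = q(Suc r := q (Suc r) + \<beta>)" for q :: "nat \<Rightarrow> nat"
  define R where "R q = q(Suc (Suc r) := \<beta>)" for q :: "nat \<Rightarrow> nat"
  have L: "admissible \<beta> k (Suc r) (L q)" if "q \<in> set qs" for q
  proof -
    have a: "admissible \<beta> k r q" by (rule qs(1)[OF that])
    have "(\<Sum>i=1..r. L q i) = (\<Sum>i=1..r. q i)" by (intro sum.cong) (auto simp: L_def)
    then show ?thesis using a step(1) by (auto simp: admissible_def L_def)
  qed
  have R: "admissible \<beta> k (Suc r) (R q)" if "q \<in> set qs" for q
  proof -
    have a: "admissible \<beta> k r q" by (rule qs(1)[OF that])
    have "(\<Sum>i=1..Suc r. R q i) = (\<Sum>i=1..Suc r. q i)" by (intro sum.cong) (auto simp: R_def)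
    then show ?thesis using a step(1) by (auto simp: admissible_def R_def)
  qed
  have mL: "(\<Prod>i=1..Suc (Suc r). t i ^ L q i) = (\<Prod>i=1..Suc r. t i ^ q i) * t (Suc r) ^ \<beta>"
    if "q \<in> set qs" for q and t :: "nat \<Rightarrow> real"
  proof -
    have "(\<Prod>i=1..r. t i ^ L q i) = (\<Prod>i=1..r. t i ^ q i)" by (intro prod.cong) (auto simp: L_def)
    then show ?thesis using qs(1)[OF that] by (simp add: L_def admissible_def power_add mult_ac)
  qed
  have mR: "(\<Prod>i=1..Suc (Suc r). t i ^ R q i) = (\<Prod>i=1..Suc r. t i ^ q i) * t (Suc (Suc r)) ^ \<beta>"
    if "q \<in> set qs" for q and t :: "nat \<Rightarrow> real"
  proof -
    have "(\<Prod>i=1..Suc r. t i ^ R q i) = (\<Prod>i=1..Suc r. t i ^ q i)" by (intro prod.cong) (auto simp: R_def)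
    then show ?thesis by (simp add: R_def)
  qed
  show ?case
  proof (intro exI[of _ "map L qs @ map R qs"] conjI allI ballI)
    show "admissible \<beta> k (Suc r) q" if "q \<in> set (map L qs @ map R qs)" for q
      using that L R by auto
    fix t :: "nat \<Rightarrow> real"
    have "(\<Sum>q\<leftarrow>map L qs @ map R qs. \<Prod>i=1..Suc (Suc r). t i ^ q i)
        = (\<Sum>q\<leftarrow>qs. \<Prod>i=1..Suc (Suc r). t i ^ L q i) + (\<Sum>q\<leftarrow>qs. \<Prod>i=1..Suc (Suc r). t i ^ R q i)"
      by (simp add: comp_def)
    also have "\<dots> = (\<Sum>q\<leftarrow>qs. (\<Prod>i=1..Suc r. t i ^ q i) * t (Suc r) ^ \<beta>)
        + (\<Sum>q\<leftarrow>qs. (\<Prod>i=1..Suc r. t i ^ q i) * t (Suc (Suc r)) ^ \<beta>)"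
      using mL mR by (intro arg_cong2[where f = "(+)"] arg_cong[where f = sum_list] map_cong refl) auto
    also have "\<dots> = (\<Sum>q\<leftarrow>qs. \<Prod>i=1..Suc r. t i ^ q i) * (t (Suc r) ^ \<beta> + t (Suc (Suc r)) ^ \<beta>)"
      by (simp only: sum_list_mult_const distrib_left)
    also have "\<dots> = leading \<beta> k t * (\<Prod>i=k+1..Suc r. t i ^ \<beta> + t (i + 1) ^ \<beta>)"
      using step(1) unfolding qs(2)[symmetric] by (simp add: prod.nat_ivl_Suc' mult_ac)
    finally show "leading \<beta> k t * (\<Prod>i=k+1..Suc r. t i ^ \<beta> + t (i + 1) ^ \<beta>)
        = (\<Sum>q\<leftarrow>map L qs @ map R qs. \<Prod>i=1..Suc (Suc r). t i ^ q i)" by simp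
  qed
qed

text \<open>By the convention \<open>x\<^sub>m\<^sub>+\<^sub>1 = 0\<close> the monomials in which \<open>t\<^sub>m\<^sub>+\<^sub>1\<close> occurs drop out, and the whole
  degree \<open>\<beta> * m\<close> is carried by the \<open>m\<close> integration variables.\<close>

lemma chain_expansion_vanishing_end:
  fixes \<beta> k m :: nat
  assumes "\<beta> \<ge> 1" "k \<in> {1..m}"
  obtains N :: nat and q :: "nat \<Rightarrow> nat \<Rightarrow> nat" where
    "\<And>l i. l < N \<Longrightarrow> q l i \<le> 2 * \<beta>" "\<And>l. l < N \<Longrightarrow> 0 < q l k \<and> q l k < 2 * \<beta>"
    "\<And>l. l < N \<Longrightarrow> (\<Sum>i=1..m. q l i) = \<beta> * m"
    "\<And>t. t (Suc m) = 0 \<Longrightarrow> leading \<beta> k t * (\<Prod>i=k+1..m. t i ^ \<beta> + t (i + 1) ^ \<beta>)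
      = (\<Sum>l<N. \<Prod>i=1..m. t i ^ q l i)"
proof -
  obtain qs where qs: "\<And>q. q \<in> set qs \<Longrightarrow> admissible \<beta> k m q"
    "\<And>t. leading \<beta> k t * (\<Prod>i=k+1..m. t i ^ \<beta> + t (i + 1) ^ \<beta>) = (\<Sum>q\<leftarrow>qs. \<Prod>i=1..Suc m. t i ^ q i)"
    using chain_expansion[of \<beta> k m] assms by auto
  define ps where "ps = filter (\<lambda>q. q (Suc m) = 0) qs"
  have ps: "admissible \<beta> k m (ps ! l)" "(ps ! l) (Suc m) = 0" if "l < length ps" for l
    using nth_mem[OF that] qs(1) by (auto simp: ps_def)
  show thesis
  proof (rule that[of "length ps" "\<lambda>l. ps ! l"])
    show "(ps ! l) i \<le> 2 * \<beta>" if "l < length ps" for l i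
      using ps(1)[OF that] by (simp add: admissible_def)
    show "0 < (ps ! l) k \<and> (ps ! l) k < 2 * \<beta>" if "l < length ps" for l
      using ps(1)[OF that] by (simp add: admissible_def)
    show "(\<Sum>i=1..m. (ps ! l) i) = \<beta> * m" if "l < length ps" for l
      using ps[OF that] by (simp add: admissible_def)
    fix t :: "nat \<Rightarrow> real" assume t: "t (Suc m) = 0"
    have "(\<Sum>q\<leftarrow>qs. \<Prod>i=1..Suc m. t i ^ q i) = (\<Sum>q\<leftarrow>ps. \<Prod>i=1..m. t i ^ q i)"
      unfolding ps_def using t by (induction qs) auto
    also have "\<dots> = (\<Sum>l<length ps. \<Prod>i=1..m. t i ^ (ps ! l) i)"
      by (simp add: sum_list_sum_nth atLeast0LessThan)
    finally show "leading \<beta> k t * (\<Prod>i=k+1..m. t i ^ \<beta> + t (i + 1) ^ \<beta>)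
        = (\<Sum>l<length ps. \<Prod>i=1..m. t i ^ (ps ! l) i)" by (simp only: qs(2))
  qed
qed

text \<open>Only the exponents equal to \<open>2 * \<beta>\<close> produce a logarithm. The one at \<open>k\<close> is positive and different
  from \<open>2 * \<beta>\<close>, so by the total degree fewer than half of the exponents do. Replacing the number of
  logarithms by \<open>(m - 1) / 2\<close> is possible because \<open>ln n \<ge> ln 2\<close>.\<close>

lemma weight_product_bound:
  fixes \<kappa> H B :: real and \<beta> m k :: nat and q :: "nat \<Rightarrow> nat"
  assumes \<beta>: "\<beta> \<in> {1, 2}" and H: "H = 1 / (2 * real \<beta> + real DIM('a::euclidean_space))"
    and \<kappa>: "\<kappa> > 0" and B: "B \<ge> 1"
    and k: "k \<in> {1..m}" "0 < q k" "q k < 2 * \<beta>"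
    and q: "\<And>i. q i \<le> 2 * \<beta>" "(\<Sum>i=1..m. q i) = \<beta> * m"
  shows "\<exists>C>0. \<forall>n\<ge>2. (\<Prod>i=1..m. weight \<kappa> H (real n * B) (q i) TYPE('a))
      \<le> ennreal (C * real n powr (H * real \<beta> * real m) * ln (real n) powr (real (m - 1) / 2))"
proof -
  let ?d = "real DIM('a)"
  have den: "2 * real \<beta> + ?d > 0" using \<beta> by auto
  have Hpos: "H > 0" and Hd: "H * ?d < 1" and one: "H * (2 * real \<beta> + ?d) = 1"
    using \<beta> den by (auto simp: H field_simps)
  define \<delta> where "\<delta> i = H * (2 * real \<beta> - real (q i))" for i
  have \<delta>: "\<delta> i \<ge> 0" "H * (?d + real (q i)) = 1 - \<delta> i" "\<delta> i = 0 \<longleftrightarrow> q i = 2 * \<beta>" for i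
  proof -
    have "real (q i) \<le> real (2 * \<beta>)" using q(1)[of i] by (simp only: of_nat_le_iff)
    then show "\<delta> i \<ge> 0" using Hpos by (simp add: \<delta>_def)
    show "H * (?d + real (q i)) = 1 - \<delta> i" using one by (simp add: \<delta>_def algebra_simps)
    have "\<delta> i = 0 \<longleftrightarrow> real (q i) = real (2 * \<beta>)" using Hpos by (auto simp: \<delta>_def)
    then show "\<delta> i = 0 \<longleftrightarrow> q i = 2 * \<beta>" by (simp only: of_nat_eq_iff)
  qed
  have "\<exists>C>0. \<forall>n\<ge>2. weight \<kappa> H (real n * B) (q i) TYPE('a)
      \<le> ennreal (C * real n powr \<delta> i * (if \<delta> i = 0 then ln (real n) else 1))" for i
    using weight_bound[OF \<kappa> Hpos Hd B \<delta>(1) \<delta>(2)[of i]] by metis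
  then have "\<exists>C. \<forall>i. C i > 0 \<and> (\<forall>n\<ge>2. weight \<kappa> H (real n * B) (q i) TYPE('a)
      \<le> ennreal (C i * real n powr \<delta> i * (if \<delta> i = 0 then ln (real n) else 1)))"
    by (intro choice allI)
  then obtain C where C: "\<And>i. C i > 0" "\<And>i n. n \<ge> 2 \<Longrightarrow> weight \<kappa> H (real n * B) (q i) TYPE('a)
      \<le> ennreal (C i * real n powr \<delta> i * (if \<delta> i = 0 then ln (real n) else 1))"
    by blast
  define S where "S = {i\<in>{1..m}. q i = 2 * \<beta>}"
  have fS: "finite S" "S \<subseteq> {1..m}" by (auto simp: S_def)
  have cardS: "2 * card S \<le> m - 1"
  proof -
    have "2 * \<beta> * card S + q k = (\<Sum>i\<in>S. q i) + q k" by (simp add: S_def)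
    also have "\<dots> = (\<Sum>i\<in>insert k S. q i)" using fS k by (subst sum.insert) (auto simp: S_def)
    also have "\<dots> \<le> (\<Sum>i=1..m. q i)" using fS k by (intro sum_mono2) auto
    finally have "2 * \<beta> * card S + q k \<le> \<beta> * m" by (simp only: q(2))
    moreover have "\<beta> * (2 * card S) = 2 * \<beta> * card S" by simp
    ultimately have "\<beta> * (2 * card S) < \<beta> * m" using k(2) by linarith
    then have "2 * card S < m" by simp
    then show ?thesis by linarith
  qed
  define \<gamma> where "\<gamma> = real (card S) - real (m - 1) / 2"
  have \<gamma>: "\<gamma> \<le> 0" using cardS by (simp add: \<gamma>_def)
  define C' where "C' = (\<Prod>i=1..m. C i) * ln 2 powr \<gamma>"
  have "C' > 0" using C(1) by (auto simp: C'_def intro!: mult_pos_pos prod_pos)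
  show ?thesis
  proof (intro exI[of _ C'] conjI allI impI \<open>C' > 0\<close>)
    fix n :: nat assume n: "n \<ge> 2"
    have ln2: "ln 2 \<le> ln (real n)" "0 < ln (real n)" using n by auto
    have nz: "0 \<le> C i * real n powr \<delta> i * (if \<delta> i = 0 then ln (real n) else 1)" for i
      using C(1)[of i] ln2 by auto
    have "(\<Prod>i=1..m. weight \<kappa> H (real n * B) (q i) TYPE('a))
        \<le> (\<Prod>i=1..m. ennreal (C i * real n powr \<delta> i * (if \<delta> i = 0 then ln (real n) else 1)))"
      using C(2)[OF n] by (intro prod_mono_ennreal)
    also have "\<dots> = ennreal (\<Prod>i=1..m. C i * real n powr \<delta> i * (if \<delta> i = 0 then ln (real n) else 1))"
      using nz by (intro prod_ennreal)
    also have "(\<Prod>i=1..m. C i * real n powr \<delta> i * (if \<delta> i = 0 then ln (real n) else 1))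
        = (\<Prod>i=1..m. C i) * (\<Prod>i=1..m. real n powr \<delta> i) * (\<Prod>i=1..m. if \<delta> i = 0 then ln (real n) else 1)"
      by (simp add: prod.distrib)
    also have "(\<Prod>i=1..m. real n powr \<delta> i) = real n powr (H * real \<beta> * real m)"
    proof -
      have "(\<Sum>i=1..m. \<delta> i) = H * (2 * real \<beta> * real m - real (\<Sum>i=1..m. q i))"
        by (simp add: \<delta>_def sum_distrib_left[symmetric] sum_subtractf)
      also have "\<dots> = H * real \<beta> * real m" unfolding q(2) by (simp add: algebra_simps)
      finally show ?thesis using n by (simp add: powr_sum[symmetric])
    qed
    also have "(\<Prod>i=1..m. if \<delta> i = 0 then ln (real n) else 1) = ln (real n) ^ card S"
    proof -
      have "{1..m} \<inter> {i. q i = 2 * \<beta>} = S" by (auto simp: S_def)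
      then show ?thesis by (simp add: \<delta>(3) prod.If_cases)
    qed
    also have "ln (real n) ^ card S = ln (real n) powr \<gamma> * ln (real n) powr (real (m - 1) / 2)"
      using ln2 by (simp add: \<gamma>_def powr_add[symmetric] powr_realpow)
    also have "(\<Prod>i=1..m. C i) * real n powr (H * real \<beta> * real m) *
          (ln (real n) powr \<gamma> * ln (real n) powr (real (m - 1) / 2))
        \<le> (\<Prod>i=1..m. C i) * real n powr (H * real \<beta> * real m) *
          (ln 2 powr \<gamma> * ln (real n) powr (real (m - 1) / 2))"
    proof (intro mult_left_mono mult_right_mono)
      show "ln (real n) powr \<gamma> \<le> ln 2 powr \<gamma>"
        using ln2 \<gamma> by (intro powr_mono2') auto
    qed (auto intro!: mult_nonneg_nonneg prod_nonneg less_imp_le[OF C(1)])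
    finally show "(\<Prod>i=1..m. weight \<kappa> H (real n * B) (q i) TYPE('a))
      \<le> ennreal (C' * real n powr (H * real \<beta> * real m) * ln (real n) powr (real (m - 1) / 2))"
      by (simp add: C'_def mult_ac ennreal_leI order_trans)
  qed
qed

section \<open>Pointwise bounds for the Fourier factors\<close>

definition fourier_factor :: "(real^'d::finite \<Rightarrow> real) \<Rightarrow> nat \<Rightarrow> nat \<Rightarrow> (nat \<Rightarrow> real^'d) \<Rightarrow> complex" where
  "fourier_factor f m k x = I_factor f k x * (\<Prod>i=k+1..m. fourier f (x i - x (i + 1)) - fourier f 0)"

lemma fourier_gap_bounds:
  fixes f :: "real^'d::finite \<Rightarrow> real"
  assumes \<beta>: "\<beta> \<in> {1, 2}" and f: "f \<in> Theta \<beta>"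
  obtains K where "K > 0"
    "\<And>y u. cmod (fourier f (y + u) - fourier f y) \<le> K * (trunc u ^ \<beta> + trunc u * trunc y ^ (\<beta> - 1))"
    "\<And>u. cmod (fourier f u - fourier f 0) \<le> K * trunc u ^ \<beta>"
    "\<And>u v. cmod (fourier f (u - v) - fourier f 0) \<le> K * (trunc u ^ \<beta> + trunc v ^ \<beta>)"
proof -
  obtain C where C: "C > 0"
    "\<And>y u. cmod (fourier f (y + u) - fourier f y) \<le> C * (trunc u ^ \<beta> + trunc u * trunc y ^ (\<beta> - 1))"
    using fourier_increment_bound[OF \<beta> f] by blast
  have inc: "cmod (fourier f u - fourier f 0) \<le> 2 * C * trunc u ^ \<beta>" for u
  proof -
    have "C * trunc u ^ 2 \<le> 2 * C * trunc u ^ 2" using C(1) by (intro mult_right_mono) auto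
    then show ?thesis using C(2)[of 0 u] \<beta> by (auto simp: power2_eq_square)
  qed
  have conv: "(a + b) ^ \<beta> \<le> 2 * (a ^ \<beta> + b ^ \<beta>)" if "0 \<le> a" "0 \<le> b" for a b :: real
    using \<beta> that sum_squares_bound[of a b] by (auto simp: power2_sum)
  show thesis
  proof (rule that[of "4 * C"])
    show "4 * C > 0" using C by simp
    show "cmod (fourier f (y + u) - fourier f y) \<le> 4 * C * (trunc u ^ \<beta> + trunc u * trunc y ^ (\<beta> - 1))" for y u
      using C(1) by (intro order_trans[OF C(2)] mult_right_mono) auto
    show "cmod (fourier f u - fourier f 0) \<le> 4 * C * trunc u ^ \<beta>" for u
    proof -
      have "2 * C * trunc u ^ \<beta> \<le> 4 * C * trunc u ^ \<beta>" using C(1) by (intro mult_right_mono) auto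
      then show ?thesis using inc[of u] by linarith
    qed
    fix u v
    have "cmod (fourier f (u - v) - fourier f 0) \<le> 2 * C * trunc (u - v) ^ \<beta>" by (rule inc)
    also have "\<dots> \<le> 2 * C * (trunc u + trunc v) ^ \<beta>"
      using C(1) trunc_diff_le[of u v] by (intro mult_left_mono power_mono) auto
    also have "\<dots> \<le> 2 * C * (2 * (trunc u ^ \<beta> + trunc v ^ \<beta>))"
      using C(1) conv[of "trunc u" "trunc v"] by (intro mult_left_mono) auto
    finally show "cmod (fourier f (u - v) - fourier f 0) \<le> 4 * C * (trunc u ^ \<beta> + trunc v ^ \<beta>)"
      by (simp add: algebra_simps)
  qed
qed

lemma fourier_factor_bounded:
  fixes f :: "real^'d::finite \<Rightarrow> real"
  assumes "\<beta> \<in> {1, 2}" and "f \<in> Theta \<beta>"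
  obtains K where "K > 0" "\<And>x. cmod (fourier_factor f m k x) \<le> K"
proof -
  obtain K where K: "K > 0" "\<And>u. cmod (fourier f u - fourier f 0) \<le> K * trunc u ^ \<beta>"
    using fourier_gap_bounds[OF assms] by metis
  have b: "cmod (fourier f u - fourier f 0) \<le> K" for u
  proof -
    have "K * trunc u ^ \<beta> \<le> K * 1" using K(1) by (intro mult_left_mono power_le_one) auto
    then show ?thesis using K(2)[of u] by simp
  qed
  have sq: "(\<Prod>j=1..l. (cmod (fourier f (x (2 * j)) - fourier f 0))\<^sup>2) \<le> (K\<^sup>2) ^ l" for l and x :: "nat \<Rightarrow> real^'d"
  proof -
    have "(\<Prod>j=1..l. (cmod (fourier f (x (2 * j)) - fourier f 0))\<^sup>2) \<le> (\<Prod>j=1..l. K\<^sup>2)"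
      by (intro prod_mono) (auto intro: power_mono b)
    then show ?thesis by simp
  qed
  define L where "L = 1 + (K\<^sup>2) ^ ((k - 1) div 2) * K + (K\<^sup>2) ^ (k div 2)"
  have L: "L > 0" using K(1) by (simp add: L_def add_pos_nonneg)
  have I: "cmod (I_factor f k x) \<le> L" for x
  proof -
    consider "k = 0" | "odd k" | "k \<noteq> 0" "even k" by blast
    then show ?thesis
    proof cases
      case 2
      have "cmod (I_factor f k x) = (\<Prod>j=1..(k-1) div 2. (cmod (fourier f (x (2 * j)) - fourier f 0))\<^sup>2)
          * cmod (fourier f (- x (k + 1)) - fourier f 0)"
        using 2 by (auto simp: I_factor_def norm_mult prod_norm[symmetric] norm_power simp flip: of_real_power)
      also have "\<dots> \<le> (K\<^sup>2) ^ ((k - 1) div 2) * K"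
        using K(1) by (intro mult_mono sq b) auto
      also have "\<dots> \<le> L" using K(1) by (simp add: L_def)
      finally show ?thesis .
    next
      case 3
      have "cmod (I_factor f k x) = (\<Prod>j=1..k div 2. (cmod (fourier f (x (2 * j)) - fourier f 0))\<^sup>2)"
        using 3 by (auto simp: I_factor_def prod_norm[symmetric] norm_power)
      also have "\<dots> \<le> (K\<^sup>2) ^ (k div 2)" by (rule sq)
      also have "\<dots> \<le> L" using K(1) by (simp add: L_def)
      finally show ?thesis .
    qed (use K(1) in \<open>simp add: I_factor_def L_def\<close>)
  qed
  show thesis
  proof (rule that[of "L * K ^ (m - k)"])
    show "L * K ^ (m - k) > 0" using L K by simp
    fix x
    have "(\<Prod>i=k+1..m. cmod (fourier f (x i - x (i + 1)) - fourier f 0)) \<le> (\<Prod>i=k+1..m. K)"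
      by (intro prod_mono) (auto intro: b)
    then show "cmod (fourier_factor f m k x) \<le> L * K ^ (m - k)"
      unfolding fourier_factor_def norm_mult prod_norm[symmetric]
      using I[of x] L by (intro mult_mono) (auto intro: prod_nonneg)
  qed
qed

text \<open>For odd \<open>k\<close> the new factor replaces \<open>x\<^sub>k - x\<^sub>k\<^sub>+\<^sub>1\<close> by \<open>- x\<^sub>k\<^sub>+\<^sub>1\<close>. For even \<open>k\<close> it replaces it by \<open>x\<^sub>k\<close>,
  since the squared modulus in \<open>I\<^sub>k\<close> is the factor at \<open>- x\<^sub>k\<close> times its conjugate; here the
  Fourier transform of a real function is conjugate symmetric.\<close>

lemma fourier_factor_difference:
  fixes f :: "real^'d::finite \<Rightarrow> real"
  assumes k: "k \<in> {1..m}"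
  shows "fourier_factor f m (k - 1) x - fourier_factor f m k x =
    (\<Prod>j=1..(k - 1) div 2. of_real ((cmod (fourier f (x (2 * j)) - fourier f 0))\<^sup>2)) *
    (if odd k then fourier f (x k - x (k + 1)) - fourier f (- x (k + 1))
     else (fourier f (- x k) - fourier f 0) * (fourier f (x k - x (k + 1)) - fourier f (x k))) *
    (\<Prod>i=k+1..m. fourier f (x i - x (i + 1)) - fourier f 0)"
proof -
  obtain l where l: "k = Suc l" using k by (cases k) auto
  let ?P = "\<Prod>j=1..(k - 1) div 2. complex_of_real ((cmod (fourier f (x (2 * j)) - fourier f 0))\<^sup>2)"
  let ?T = "\<Prod>i=k+1..m. fourier f (x i - x (i + 1)) - fourier f 0"
  have split: "(\<Prod>i=k..m. fourier f (x i - x (i + 1)) - fourier f 0)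
      = (fourier f (x k - x (k + 1)) - fourier f 0) * ?T"
    using k by (simp add: prod.atLeast_Suc_atMost)
  have F1: "fourier_factor f m (k - 1) x = I_factor f (k - 1) x * ((fourier f (x k - x (k + 1)) - fourier f 0) * ?T)"
    unfolding fourier_factor_def split[symmetric] using k by simp
  show ?thesis
  proof (cases "odd k")
    case True
    have I1: "I_factor f (k - 1) x = ?P" using True by (auto simp: I_factor_def l)
    have I2: "I_factor f k x = ?P * (fourier f (- x (k + 1)) - fourier f 0)"
      using True k by (simp add: I_factor_def)
    have cancel: "P * ((A - z) * T) - P * (B - z) * T = P * (A - B) * T" for P A B T z :: complex
      by (simp add: algebra_simps)
    show ?thesis unfolding F1 fourier_factor_def[of f m k] I1 I2 if_P[OF True] by (rule cancel)
  next
    case False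
    then have h: "k div 2 = Suc ((k - 1) div 2)" "2 * Suc ((k - 1) div 2) = k" "(k - 1 - 1) div 2 = (k - 1) div 2"
      by (simp add: l; presburger)+
    have I1: "I_factor f (k - 1) x = ?P * (fourier f (- x k) - fourier f 0)"
      using False h(3) by (auto simp: I_factor_def l)
    have "I_factor f k x = ?P * of_real ((cmod (fourier f (x k) - fourier f 0))\<^sup>2)"
      using False k h(2) unfolding I_factor_def h(1) by (simp del: mult_Suc_right)
    moreover have "of_real ((cmod (fourier f (x k) - fourier f 0))\<^sup>2)
        = (fourier f (x k) - fourier f 0) * (fourier f (- x k) - fourier f 0)"
      using complex_norm_square[of "fourier f (x k) - fourier f 0"] by (simp add: fourier_uminus fourier_0_real)
    ultimately have I2: "I_factor f k x = ?P * ((fourier f (x k) - fourier f 0) * (fourier f (- x k) - fourier f 0))"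
      by (simp only:)
    have cancel: "P * g * ((A - z) * T) - P * ((B - z) * g) * T = P * (g * (A - B)) * T" for P A B T g z :: complex
      by (simp add: algebra_simps)
    show ?thesis unfolding F1 fourier_factor_def[of f m k] I1 I2 if_not_P[OF False] by (rule cancel)
  qed
qed

lemma fourier_factor_difference_bound:
  fixes f :: "real^'d::finite \<Rightarrow> real"
  assumes \<beta>: "\<beta> \<in> {1, 2}" and f: "f \<in> Theta \<beta>" and k: "k \<in> {1..m}"
  obtains K where "K > 0" "\<And>x. cmod (fourier_factor f m (k - 1) x - fourier_factor f m k x)
    \<le> K * (leading \<beta> k (\<lambda>i. trunc (x i)) * (\<Prod>i=k+1..m. trunc (x i) ^ \<beta> + trunc (x (i + 1)) ^ \<beta>))"
proof -
  obtain K where K: "K > 0"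
    "\<And>y u. cmod (fourier f (y + u) - fourier f y) \<le> K * (trunc u ^ \<beta> + trunc u * trunc y ^ (\<beta> - 1))"
    "\<And>u. cmod (fourier f u - fourier f 0) \<le> K * trunc u ^ \<beta>"
    "\<And>u v. cmod (fourier f (u - v) - fourier f 0) \<le> K * (trunc u ^ \<beta> + trunc v ^ \<beta>)"
    using fourier_gap_bounds[OF \<beta> f] by blast
  define K' where "K' = (K\<^sup>2) ^ ((k - 1) div 2) * (if odd k then K else K * K) * K ^ (m - k)"
  show thesis
  proof (rule that[of K'])
    show "K' > 0" using K(1) by (simp add: K'_def)
    fix x :: "nat \<Rightarrow> real^'d"
    define t where "t i = trunc (x i)" for i
    have t0: "0 \<le> t i" for i by (simp add: t_def)
    let ?P1 = "\<Prod>j=1..(k - 1) div 2. (cmod (fourier f (x (2 * j)) - fourier f 0))\<^sup>2"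
    let ?P2 = "if odd k then fourier f (x k - x (k + 1)) - fourier f (- x (k + 1))
     else (fourier f (- x k) - fourier f 0) * (fourier f (x k - x (k + 1)) - fourier f (x k))"
    let ?P3 = "\<Prod>i=k+1..m. cmod (fourier f (x i - x (i + 1)) - fourier f 0)"
    let ?Q1 = "\<Prod>j=1..(k - 1) div 2. t (2 * j) ^ (2 * \<beta>)"
    let ?Q2 = "if odd k then t k ^ \<beta> + t k * t (k + 1) ^ (\<beta> - 1)
      else t k ^ \<beta> * (t (k + 1) ^ \<beta> + t (k + 1) * t k ^ (\<beta> - 1))"
    let ?Q3 = "\<Prod>i=k+1..m. t i ^ \<beta> + t (i + 1) ^ \<beta>"
    have 1: "?P1 \<le> (K\<^sup>2) ^ ((k - 1) div 2) * ?Q1"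
    proof -
      have "?P1 \<le> (\<Prod>j=1..(k - 1) div 2. K\<^sup>2 * t (2 * j) ^ (2 * \<beta>))"
      proof (intro prod_mono conjI)
        fix j
        have "(cmod (fourier f (x (2 * j)) - fourier f 0))\<^sup>2 \<le> (K * t (2 * j) ^ \<beta>)\<^sup>2"
          unfolding t_def by (intro power_mono K(3)) auto
        then show "(cmod (fourier f (x (2 * j)) - fourier f 0))\<^sup>2 \<le> K\<^sup>2 * t (2 * j) ^ (2 * \<beta>)"
          by (simp add: power_mult_distrib power_mult[symmetric] mult.commute)
      qed auto
      then show ?thesis by (simp add: prod.distrib)
    qed
    have 2: "cmod ?P2 \<le> (if odd k then K else K * K) * ?Q2"
    proof (cases "odd k")
      case True
      have "cmod (fourier f (- x (k + 1) + x k) - fourier f (- x (k + 1)))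
          \<le> K * (t k ^ \<beta> + t k * t (k + 1) ^ (\<beta> - 1))"
        using K(2)[of "- x (k + 1)" "x k"] by (simp add: t_def)
      then show ?thesis using True by simp
    next
      case False
      have "cmod (fourier f (x k + - x (k + 1)) - fourier f (x k))
          \<le> K * (t (k + 1) ^ \<beta> + t (k + 1) * t k ^ (\<beta> - 1))"
        using K(2)[of "x k" "- x (k + 1)"] by (simp add: t_def)
      moreover have "cmod (fourier f (- x k) - fourier f 0) \<le> K * t k ^ \<beta>"
        using K(3)[of "- x k"] by (simp add: t_def)
      ultimately have "cmod (fourier f (- x k) - fourier f 0) * cmod (fourier f (x k - x (k + 1)) - fourier f (x k))
          \<le> (K * t k ^ \<beta>) * (K * (t (k + 1) ^ \<beta> + t (k + 1) * t k ^ (\<beta> - 1)))"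
        using K(1) t0 by (intro mult_mono) auto
      then show ?thesis using False by (simp add: norm_mult mult_ac)
    qed
    have 3: "?P3 \<le> K ^ (m - k) * ?Q3"
    proof -
      have "?P3 \<le> (\<Prod>i=k+1..m. K * (t i ^ \<beta> + t (i + 1) ^ \<beta>))"
        unfolding t_def by (intro prod_mono) (auto intro: K(4))
      also have "\<dots> = K ^ (m - k) * ?Q3" by (simp add: prod.distrib)
      finally show ?thesis .
    qed
    have "cmod (fourier_factor f m (k - 1) x - fourier_factor f m k x) = ?P1 * cmod ?P2 * ?P3"
      unfolding fourier_factor_difference[OF k] norm_mult by (simp add: prod_norm[symmetric] norm_power)
    also have "\<dots> \<le> ((K\<^sup>2) ^ ((k - 1) div 2) * ?Q1) * ((if odd k then K else K * K) * ?Q2) * (K ^ (m - k) * ?Q3)"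
      using K(1) t0 by (intro mult_mono 1 2 3 mult_nonneg_nonneg prod_nonneg) auto
    also have "\<dots> = K' * (leading \<beta> k t * ?Q3)"
      by (simp add: K'_def leading_def mult_ac)
    finally show "cmod (fourier_factor f m (k - 1) x - fourier_factor f m k x)
      \<le> K' * (leading \<beta> k (\<lambda>i. trunc (x i)) * (\<Prod>i=k+1..m. trunc (x i) ^ \<beta> + trunc (x (i + 1)) ^ \<beta>))"
      unfolding t_def .
  qed
qed

section \<open>Absolute convergence and size of the frequency integrals\<close>

lemma nn_integral_frequency_chain:
  fixes F :: "nat \<Rightarrow> 'a::euclidean_space \<Rightarrow> real \<Rightarrow> ennreal"
  assumes F [measurable]: "\<And>i. (\<lambda>(x, u). F i x u) \<in> borel_measurable (borel \<Otimes>\<^sub>M borel)"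
  shows "(\<lambda>x. \<integral>\<^sup>+s. (\<Prod>i=1..m. F i (x i) ((s(0 := 0)) i - (s(0 := 0)) (i - 1))) \<partial>Pi\<^sub>M {1..m} (\<lambda>_. lborel))
      \<in> borel_measurable (Pi\<^sub>M {1..m} (\<lambda>_. lborel))"
    and "(\<integral>\<^sup>+x. \<integral>\<^sup>+s. (\<Prod>i=1..m. F i (x i) ((s(0 := 0)) i - (s(0 := 0)) (i - 1)))
        \<partial>Pi\<^sub>M {1..m} (\<lambda>_. lborel) \<partial>Pi\<^sub>M {1..m} (\<lambda>_. lborel))
      = (\<Prod>i=1..m. \<integral>\<^sup>+x. \<integral>\<^sup>+u. F i x u \<partial>lborel \<partial>lborel)"
proof -
  interpret product_sigma_finite "\<lambda>_::nat. lborel :: 'a measure" by standard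
  have inner: "(\<integral>\<^sup>+s. (\<Prod>i=1..m. F i (x i) ((s(0 := 0)) i - (s(0 := 0)) (i - 1))) \<partial>Pi\<^sub>M {1..m} (\<lambda>_. lborel))
      = (\<Prod>i=1..m. \<integral>\<^sup>+u. F i (x i) u \<partial>lborel)" for x
    by (rule nn_integral_increments) measurable
  have Fm [measurable]: "(\<lambda>x. \<integral>\<^sup>+u. F i x u \<partial>lborel) \<in> borel_measurable lborel" for i
    by measurable
  show "(\<lambda>x. \<integral>\<^sup>+s. (\<Prod>i=1..m. F i (x i) ((s(0 := 0)) i - (s(0 := 0)) (i - 1))) \<partial>Pi\<^sub>M {1..m} (\<lambda>_. lborel))
      \<in> borel_measurable (Pi\<^sub>M {1..m} (\<lambda>_. lborel))"
    unfolding inner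
  proof (rule borel_measurable_prod_ennreal)
    fix i assume "i \<in> {1..m}"
    then have "(\<lambda>x. x i) \<in> Pi\<^sub>M {1..m} (\<lambda>_. lborel) \<rightarrow>\<^sub>M (lborel :: 'a measure)"
      by (rule measurable_component_singleton)
    then show "(\<lambda>x. \<integral>\<^sup>+u. F i (x i) u \<partial>lborel) \<in> borel_measurable (Pi\<^sub>M {1..m} (\<lambda>_. lborel))"
      by (rule measurable_compose[OF _ Fm])
  qed
  show "(\<integral>\<^sup>+x. \<integral>\<^sup>+s. (\<Prod>i=1..m. F i (x i) ((s(0 := 0)) i - (s(0 := 0)) (i - 1)))
        \<partial>Pi\<^sub>M {1..m} (\<lambda>_. lborel) \<partial>Pi\<^sub>M {1..m} (\<lambda>_. lborel))
      = (\<Prod>i=1..m. \<integral>\<^sup>+x. \<integral>\<^sup>+u. F i x u \<partial>lborel \<partial>lborel)"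
    unfolding inner by (rule product_nn_integral_prod) auto
qed

abbreviation freq_space :: "nat \<Rightarrow> (nat \<Rightarrow> real^'d::finite) measure" where
  "freq_space m \<equiv> Pi\<^sub>M {1..m} (\<lambda>_. lborel)"

abbreviation time_space :: "nat \<Rightarrow> (nat \<Rightarrow> real) measure" where
  "time_space m \<equiv> Pi\<^sub>M {1..m} (\<lambda>_. lborel)"

lemma pair_sigma_finite_freq_time:
  "pair_sigma_finite (freq_space m :: (nat \<Rightarrow> real^'d::finite) measure) (time_space m)"
proof -
  interpret A: product_sigma_finite "\<lambda>_::nat. lborel :: (real^'d) measure" by standard
  interpret B: product_sigma_finite "\<lambda>_::nat. lborel :: real measure" by standard
  show ?thesis by (intro pair_sigma_finite.intro A.sigma_finite B.sigma_finite) auto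
qed

definition kernel ::
  "'w measure \<Rightarrow> (real \<Rightarrow> 'w \<Rightarrow> real^'d::finite) \<Rightarrow> real \<Rightarrow> real^'d \<Rightarrow> nat \<Rightarrow> nat \<Rightarrow>
   (nat \<Rightarrow> real^'d) \<Rightarrow> (nat \<Rightarrow> real) \<Rightarrow> complex" where
  "kernel M X H lam m n x s = exp (- \<i> * of_real (real n powr H * (lam \<bullet> x 1))
     - of_real (1/2 * prob_space.variance M (\<lambda>\<omega>. \<Sum>i=1..m. x i \<bullet> (X (s i) \<omega> - X (s (i-1)) \<omega>))))"

text \<open>The integrand of \<open>I\<^sup>n\<^sub>m\<^sub>,\<^sub>k\<close> on the product of the frequency and time spaces, with the Fourier factors
  replaced by an arbitrary \<open>\<Psi>\<close>; the difference of two consecutive quantities is again of this form.\<close>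

definition frequency_integrand ::
  "'w measure \<Rightarrow> (real \<Rightarrow> 'w \<Rightarrow> real^'d::finite) \<Rightarrow> real \<Rightarrow> real^'d \<Rightarrow> real \<Rightarrow> real \<Rightarrow> nat \<Rightarrow> nat \<Rightarrow>
   ((nat \<Rightarrow> real^'d) \<Rightarrow> complex) \<Rightarrow> (nat \<Rightarrow> real^'d) \<times> (nat \<Rightarrow> real) \<Rightarrow> complex" where
  "frequency_integrand M X H lam a b m n \<Psi> = (\<lambda>(x, s). indicator (D_set n a b m) s *\<^sub>R
     (\<Psi> (x(m + 1 := 0)) * kernel M X H lam m n (x(m + 1 := 0)) (s(0 := 0))))"

lemma D_set_time_chain:
  assumes "s \<in> D_set n a b m" "0 \<le> a"
  shows "time_chain m (s(0 := 0))"
  unfolding time_chain_def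
proof (intro conjI ballI)
  have s: "\<And>i. i \<in> {1..m} \<Longrightarrow> real n * a < s i" "strict_mono_on {1..m} s"
    using assms(1) by (auto simp: D_set_def PiE_iff)
  fix i assume i: "i \<in> {1..m}"
  show "(s(0 := 0)) (i - 1) < (s(0 := 0)) i"
  proof (cases "i = 1")
    case True
    have "0 \<le> real n * a" using assms(2) by simp
    then show ?thesis using s(1)[OF i] True by simp
  next
    case False
    then have "i - 1 \<in> {1..m}" "i - 1 < i" using i by auto
    then show ?thesis using strict_mono_onD[OF s(2) _ i, of "i - 1"] i by auto
  qed
qed simp

text \<open>The order of the times is relaxed to separate bounds on the increments, which makes the domain of
  integration a product.\<close>

lemma D_set_increment:
  assumes s: "s \<in> D_set n a b m" "0 \<le> a" and i: "i \<in> {1..m}"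
  shows "0 < (s(0 := 0)) i - (s(0 := 0)) (i - 1)" "(s(0 := 0)) i - (s(0 := 0)) (i - 1) < real n * b"
proof -
  note chain = D_set_time_chain[OF s]
  show "0 < (s(0 := 0)) i - (s(0 := 0)) (i - 1)"
    using chain i by (auto simp: time_chain_def simp del: fun_upd_apply)
  have "(s(0 := 0)) i < real n * b" using s(1) i by (auto simp: D_set_def PiE_iff)
  moreover have "0 \<le> (s(0 := 0)) (i - 1)" using time_chain_positive(1)[OF chain, of "i - 1"] i by auto
  ultimately show "(s(0 := 0)) i - (s(0 := 0)) (i - 1) < real n * b" by linarith
qed

lemma D_set_measurable: "D_set n a b m \<in> sets (time_space m)"
proof -
  have D: "D_set n a b m = {s \<in> space (time_space m). (\<forall>i\<in>{1..m}. real n * a < s i \<and> s i < real n * b) \<and>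
      (\<forall>i\<in>{1..m}. \<forall>j\<in>{1..m}. i < j \<longrightarrow> s i < s j)}"
    by (auto simp: D_set_def space_PiM PiE_iff strict_mono_on_def)
  have coord: "(\<lambda>s. s i) \<in> borel_measurable (time_space m)" if "i \<in> {1..m}" for i
    using measurable_component_singleton[OF that, of "\<lambda>_. lborel"] by simp
  have "{s \<in> space (time_space m). real n * a < s i} \<in> sets (time_space m)"
    "{s \<in> space (time_space m). s i < real n * b} \<in> sets (time_space m)" if "i \<in> {1..m}" for i
    using coord[OF that] by (auto intro: borel_measurable_less)
  moreover have "{s \<in> space (time_space m). s i < s j} \<in> sets (time_space m)" if "i \<in> {1..m}" "j \<in> {1..m}" for i j
    using coord[OF that(1)] coord[OF that(2)] by (rule borel_measurable_less)
  ultimately have "{s \<in> space (time_space m). (\<forall>i\<in>{1..m}. real n * a < s i \<and> s i < real n * b) \<and>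
      (\<forall>i\<in>{1..m}. \<forall>j\<in>{1..m}. i < j \<longrightarrow> s i < s j)} \<in> sets (time_space m)"
    by (intro sets.sets_Collect_conj sets.sets_Collect_finite_All sets.sets_Collect_imp
        sets.sets_Collect_const finite_atLeastAtMost)
  with D show ?thesis by (simp only:)
qed

text \<open>The cutoff at 0 makes the variance measurable for arbitrary real times.\<close>

lemma variance_measurable:
  fixes X :: "real \<Rightarrow> 'w \<Rightarrow> real^'d::finite"
  assumes G: "G_L M H X"
  shows "(\<lambda>p. prob_space.variance M (\<lambda>\<omega>. \<Sum>i=1..m. ((fst p)(m + 1 := 0)) i \<bullet>
      (X (max 0 (((snd p)(0 := 0)) i)) \<omega> - X (max 0 (((snd p)(0 := 0)) (i - 1))) \<omega>)))
    \<in> borel_measurable (freq_space m \<Otimes>\<^sub>M time_space m)"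
proof -
  interpret prob_space M using G by (simp add: G_L_def)
  let ?N = "(freq_space m :: (nat \<Rightarrow> real^'d) measure) \<Otimes>\<^sub>M time_space m"
  have J: "(\<lambda>(t, \<omega>). X (max 0 t) \<omega>) \<in> borel_measurable (borel \<Otimes>\<^sub>M M)"
    using G by (intro continuous_paths_jointly_measurable) (auto simp: G_L_def centered_gaussian_process_def)
  have x: "(\<lambda>r. ((fst (fst r))(m + 1 := 0)) i) \<in> borel_measurable (?N \<Otimes>\<^sub>M M)" if "i \<in> {1..m}" for i
  proof -
    have "(\<lambda>x. x i) \<in> freq_space m \<rightarrow>\<^sub>M (lborel :: (real^'d) measure)"
      using that by (rule measurable_component_singleton)
    then have "(\<lambda>r. fst (fst r) i) \<in> ?N \<Otimes>\<^sub>M M \<rightarrow>\<^sub>M (lborel :: (real^'d) measure)"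
      by (intro measurable_compose[OF _ \<open>(\<lambda>x. x i) \<in> _\<close>] measurable_compose[OF measurable_fst measurable_fst])
    then show ?thesis using that by simp
  qed
  have s: "(\<lambda>r. ((snd (fst r))(0 := 0)) i) \<in> borel_measurable (?N \<Otimes>\<^sub>M M)" if "i \<le> m" for i
  proof (cases "i = 0")
    case False
    then have "i \<in> {1..m}" using that by auto
    then have "(\<lambda>x. x i) \<in> time_space m \<rightarrow>\<^sub>M lborel"
      by (rule measurable_component_singleton)
    then have "(\<lambda>r. snd (fst r) i) \<in> ?N \<Otimes>\<^sub>M M \<rightarrow>\<^sub>M lborel"
      by (intro measurable_compose[OF _ \<open>(\<lambda>x. x i) \<in> _\<close>] measurable_compose[OF measurable_fst measurable_snd])
    then show ?thesis using False by simp
  qed simp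
  have Xs: "(\<lambda>r. X (max 0 (((snd (fst r))(0 := 0)) i)) (snd r)) \<in> borel_measurable (?N \<Otimes>\<^sub>M M)" if "i \<le> m" for i
    using measurable_compose[OF measurable_Pair[OF s[OF that] measurable_snd] J] by simp
  define S where "S r = (\<Sum>i=1..m. ((fst (fst r))(m + 1 := 0)) i \<bullet>
      (X (max 0 (((snd (fst r))(0 := 0)) i)) (snd r) - X (max 0 (((snd (fst r))(0 := 0)) (i - 1))) (snd r)))"
    for r :: "((nat \<Rightarrow> real^'d) \<times> (nat \<Rightarrow> real)) \<times> 'w"
  have S: "S \<in> borel_measurable (?N \<Otimes>\<^sub>M M)"
    unfolding S_def[abs_def]
    by (intro borel_measurable_sum borel_measurable_inner borel_measurable_diff x Xs) auto
  have E1: "(\<lambda>p. expectation (\<lambda>\<omega>. S (p, \<omega>))) \<in> borel_measurable ?N"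
    using S by (intro borel_measurable_lebesgue_integral) (simp add: case_prod_unfold)
  have "(\<lambda>p. expectation (\<lambda>\<omega>. (S (p, \<omega>) - expectation (\<lambda>\<omega>. S (p, \<omega>)))\<^sup>2)) \<in> borel_measurable ?N"
  proof (rule borel_measurable_lebesgue_integral)
    show "(\<lambda>(p, \<omega>). (S (p, \<omega>) - expectation (\<lambda>\<omega>. S (p, \<omega>)))\<^sup>2) \<in> borel_measurable (?N \<Otimes>\<^sub>M M)"
      using S measurable_compose[OF measurable_fst E1]
      by (simp add: case_prod_unfold)
  qed
  then show ?thesis by (simp add: S_def)
qed

lemma frequency_integrand_measurable:
  fixes X :: "real \<Rightarrow> 'w \<Rightarrow> real^'d::finite"
  assumes G: "G_L M H X" and a: "0 \<le> a" and m: "m \<ge> 1"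
    and \<Psi>: "(\<lambda>x. \<Psi> (x(m + 1 := 0))) \<in> borel_measurable (freq_space m)"
  shows "frequency_integrand M X H lam a b m n \<Psi> \<in> borel_measurable (freq_space m \<Otimes>\<^sub>M time_space m)"
proof -
  let ?N = "(freq_space m :: (nat \<Rightarrow> real^'d) measure) \<Otimes>\<^sub>M time_space m"
  define V where "V p = prob_space.variance M (\<lambda>\<omega>. \<Sum>i=1..m. ((fst p)(m + 1 := 0)) i \<bullet>
      (X (max 0 (((snd p)(0 := 0)) i)) \<omega> - X (max 0 (((snd p)(0 := 0)) (i - 1))) \<omega>))"
    for p :: "(nat \<Rightarrow> real^'d) \<times> (nat \<Rightarrow> real)"
  have V [measurable]: "V \<in> borel_measurable ?N"
    unfolding V_def[abs_def] by (rule variance_measurable[OF G])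
  have x1: "(\<lambda>p. lam \<bullet> fst p 1) \<in> borel_measurable ?N"
  proof -
    have "(\<lambda>x. x 1) \<in> freq_space m \<rightarrow>\<^sub>M (lborel :: (real^'d) measure)"
      using m by (intro measurable_component_singleton) auto
    then have "(\<lambda>p. fst p 1) \<in> borel_measurable ?N"
      using measurable_compose[OF measurable_fst] by fastforce
    then show ?thesis by measurable
  qed
  note [measurable] = x1 measurable_compose[OF measurable_fst \<Psi>] D_set_measurable
  have "frequency_integrand M X H lam a b m n \<Psi> =
    (\<lambda>p. indicator (D_set n a b m) (snd p) *\<^sub>R (\<Psi> ((fst p)(m + 1 := 0)) *
       exp (- \<i> * of_real (real n powr H * (lam \<bullet> fst p 1)) - of_real (1/2 * V p))))" (is "_ = ?R")
  proof
    fix p :: "(nat \<Rightarrow> real^'d) \<times> (nat \<Rightarrow> real)"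
    obtain x s where p: "p = (x, s)" by force
    show "frequency_integrand M X H lam a b m n \<Psi> p = ?R p"
    proof (cases "s \<in> D_set n a b m")
      case True
      have nn: "0 \<le> (s(0 := 0)) i" if "i \<le> m" for i
        using time_chain_positive(1)[OF D_set_time_chain[OF True a] that] .
      have "prob_space.variance M (\<lambda>\<omega>. \<Sum>i=1..m. (x(m + 1 := 0)) i \<bullet> (X ((s(0 := 0)) i) \<omega> - X ((s(0 := 0)) (i - 1)) \<omega>)) = V p"
      proof -
        have "(\<Sum>i=1..m. (x(m + 1 := 0)) i \<bullet> (X ((s(0 := 0)) i) \<omega> - X ((s(0 := 0)) (i - 1)) \<omega>))
            = (\<Sum>i=1..m. (x(m + 1 := 0)) i \<bullet> (X (max 0 ((s(0 := 0)) i)) \<omega> - X (max 0 ((s(0 := 0)) (i - 1))) \<omega>))" for \<omega>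
          using nn by (intro sum.cong) (auto simp: max_absorb2 simp del: fun_upd_apply)
        then show ?thesis unfolding V_def p fst_conv snd_conv by simp
      qed
      then show ?thesis using m by (simp add: frequency_integrand_def kernel_def p)
    qed (simp add: frequency_integrand_def p)
  qed
  also have "?R \<in> borel_measurable ?N" by measurable
  finally show ?thesis .
qed

text \<open>On the domain of integration the lower bound for the variance splits the exponential into one factor
  for each increment, so each monomial integrates to a product of weights.\<close>

lemma frequency_integral_bound:
  fixes X :: "real \<Rightarrow> 'w \<Rightarrow> real^'d::finite" and q :: "nat \<Rightarrow> nat \<Rightarrow> nat"
  assumes G: "G_L M H X" and a: "0 \<le> a" and m: "m \<ge> 1"
    and \<kappa>: "\<And>x s. time_chain m s \<Longrightarrow>
      \<kappa> * (\<Sum>i=1..m. (norm (x i))\<^sup>2 * (s i - s (i - 1)) powr (2 * H))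
        \<le> prob_space.variance M (\<lambda>\<omega>. \<Sum>i=1..m. x i \<bullet> (X (s i) \<omega> - X (s (i - 1)) \<omega>))"
    and T: "real n * b \<le> T"
    and \<Psi>: "(\<lambda>x. \<Psi> (x(m + 1 := 0))) \<in> borel_measurable (freq_space m)"
    and K: "0 \<le> K" "\<And>x. x (m + 1) = 0 \<Longrightarrow> cmod (\<Psi> x) \<le> K * (\<Sum>l<N. \<Prod>i=1..m. trunc (x i) ^ q l i)"
    and W: "\<And>l. l < N \<Longrightarrow> 0 \<le> W l"
      "\<And>l. l < N \<Longrightarrow> (\<Prod>i=1..m. weight (\<kappa> / 2) H T (q l i) TYPE(real^'d)) \<le> ennreal (W l)"
  shows "integrable (freq_space m \<Otimes>\<^sub>M time_space m) (frequency_integrand M X H lam a b m n \<Psi>)"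
    and "cmod (integral\<^sup>L (freq_space m \<Otimes>\<^sub>M time_space m) (frequency_integrand M X H lam a b m n \<Psi>))
      \<le> K * (\<Sum>l<N. W l)"
proof -
  let ?\<Phi> = "frequency_integrand M X H lam a b m n \<Psi>"
  let ?N = "(freq_space m :: (nat \<Rightarrow> real^'d) measure) \<Otimes>\<^sub>M time_space m"
  interpret pair_sigma_finite "freq_space m :: (nat \<Rightarrow> real^'d) measure" "time_space m"
    by (rule pair_sigma_finite_freq_time)
  define F where "F l i x u = ennreal (trunc x ^ q l i) * (indicator {0<..<T} u *
     ennreal (exp (- (\<kappa> / 2) * (norm x)\<^sup>2 * u powr (2 * H))))" for l i :: nat and x :: "real^'d" and u
  have Fm [measurable]: "(\<lambda>(x, u). F l i x u) \<in> borel_measurable (borel \<Otimes>\<^sub>M borel)" for l i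
    unfolding F_def[abs_def] by measurable
  let ?\<Delta> = "\<lambda>s i. (s(0 := 0)) i - (s(0 := 0)) (i - 1) :: real"
  have pt: "ennreal (cmod (?\<Phi> (x, s))) \<le> ennreal K * (\<Sum>l<N. \<Prod>i=1..m. F l i (x i) (?\<Delta> s i))" for x s
  proof (cases "s \<in> D_set n a b m")
    case True
    define x' where "x' = x(m + 1 := 0)"
    have x': "x' (m + 1) = 0" "\<And>i. i \<in> {1..m} \<Longrightarrow> x' i = x i" by (auto simp: x'_def)
    note chain = D_set_time_chain[OF True a]
    let ?V = "prob_space.variance M (\<lambda>\<omega>. \<Sum>i=1..m. x' i \<bullet> (X ((s(0 := 0)) i) \<omega> - X ((s(0 := 0)) (i - 1)) \<omega>))"
    have F: "F l i (x i) (?\<Delta> s i) = ennreal (trunc (x i) ^ q l i * exp (- (\<kappa> / 2) * (norm (x i))\<^sup>2 * ?\<Delta> s i powr (2 * H)))"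
      if "i \<in> {1..m}" for l i
      using D_set_increment[OF True a that] T by (simp add: F_def ennreal_mult' del: fun_upd_apply)
    have "cmod (?\<Phi> (x, s)) = cmod (\<Psi> x') * exp (- (1/2) * ?V)"
      using True by (simp add: frequency_integrand_def kernel_def norm_mult x'_def)
    also have "\<dots> \<le> (K * (\<Sum>l<N. \<Prod>i=1..m. trunc (x i) ^ q l i)) *
        exp (- (1/2) * (\<kappa> * (\<Sum>i=1..m. (norm (x i))\<^sup>2 * ?\<Delta> s i powr (2 * H))))"
    proof (intro mult_mono)
      show "cmod (\<Psi> x') \<le> K * (\<Sum>l<N. \<Prod>i=1..m. trunc (x i) ^ q l i)"
        using K(2)[of x'] x' by simp
      have "\<kappa> * (\<Sum>i=1..m. (norm (x i))\<^sup>2 * ?\<Delta> s i powr (2 * H))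
          = \<kappa> * (\<Sum>i=1..m. (norm (x' i))\<^sup>2 * ?\<Delta> s i powr (2 * H))"
        using x'(2) by (intro arg_cong[where f = "\<lambda>z. \<kappa> * z"] sum.cong) auto
      also have "\<dots> \<le> ?V" by (rule \<kappa>[OF chain])
      finally show "exp (- (1/2) * ?V) \<le> exp (- (1/2) * (\<kappa> * (\<Sum>i=1..m. (norm (x i))\<^sup>2 * ?\<Delta> s i powr (2 * H))))"
        by simp
    qed (use K(1) in \<open>auto intro!: mult_nonneg_nonneg sum_nonneg prod_nonneg\<close>)
    also have "exp (- (1/2) * (\<kappa> * (\<Sum>i=1..m. (norm (x i))\<^sup>2 * ?\<Delta> s i powr (2 * H))))
        = (\<Prod>i=1..m. exp (- (\<kappa> / 2) * (norm (x i))\<^sup>2 * ?\<Delta> s i powr (2 * H)))"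
      by (simp add: exp_sum[symmetric] sum_distrib_left mult.assoc sum_negf del: fun_upd_apply)
    also have "(K * (\<Sum>l<N. \<Prod>i=1..m. trunc (x i) ^ q l i)) * \<dots>
        = K * (\<Sum>l<N. \<Prod>i=1..m. trunc (x i) ^ q l i * exp (- (\<kappa> / 2) * (norm (x i))\<^sup>2 * ?\<Delta> s i powr (2 * H)))"
      by (simp add: sum_distrib_right prod.distrib mult.assoc del: fun_upd_apply)
    finally have "ennreal (cmod (?\<Phi> (x, s))) \<le> ennreal (K * (\<Sum>l<N. \<Prod>i=1..m. trunc (x i) ^ q l i *
        exp (- (\<kappa> / 2) * (norm (x i))\<^sup>2 * ?\<Delta> s i powr (2 * H))))"
      by (rule ennreal_leI)
    also have "\<dots> = ennreal K * (\<Sum>l<N. \<Prod>i=1..m. ennreal (trunc (x i) ^ q l i *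
        exp (- (\<kappa> / 2) * (norm (x i))\<^sup>2 * ?\<Delta> s i powr (2 * H))))"
      by (subst ennreal_mult'[OF K(1)], subst sum_ennreal[symmetric], rule prod_nonneg, simp,
          subst prod_ennreal[symmetric], simp_all del: fun_upd_apply)
    also have "\<dots> = ennreal K * (\<Sum>l<N. \<Prod>i=1..m. F l i (x i) (?\<Delta> s i))"
      using F by simp
    finally show ?thesis .
  qed (simp add: frequency_integrand_def)
  have \<Phi>m: "?\<Phi> \<in> borel_measurable ?N" by (rule frequency_integrand_measurable[OF G a m \<Psi>])
  have \<Delta>m: "(\<lambda>s. \<Prod>i=1..m. F l i (x i) (?\<Delta> s i)) \<in> borel_measurable (time_space m)" for l x
  proof (rule borel_measurable_prod_ennreal)
    fix i assume i: "i \<in> {1..m}"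
    have c: "(\<lambda>s. (s(0 := 0)) j) \<in> borel_measurable (time_space m)" if "j \<le> m" for j
      using that by (cases "j = 0") (auto intro: measurable_component_singleton)
    have "(\<lambda>s. ?\<Delta> s i) \<in> borel_measurable (time_space m)"
      using i by (intro borel_measurable_diff c) auto
    moreover have "(\<lambda>u. F l i (x i) u) \<in> borel_measurable borel" by measurable
    ultimately show "(\<lambda>s. F l i (x i) (?\<Delta> s i)) \<in> borel_measurable (time_space m)"
      by (rule measurable_compose)
  qed
  have "(\<integral>\<^sup>+p. ennreal (cmod (?\<Phi> p)) \<partial>?N) = (\<integral>\<^sup>+x. \<integral>\<^sup>+s. ennreal (cmod (?\<Phi> (x, s))) \<partial>time_space m \<partial>freq_space m)"
    by (rule M2.nn_integral_fst[symmetric]) (rule measurable_compose[OF \<Phi>m], measurable)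
  also have "\<dots> \<le> (\<integral>\<^sup>+x. \<integral>\<^sup>+s. ennreal K * (\<Sum>l<N. \<Prod>i=1..m. F l i (x i) (?\<Delta> s i)) \<partial>time_space m \<partial>freq_space m)"
    by (intro nn_integral_mono pt)
  also have "\<dots> = (\<integral>\<^sup>+x. ennreal K * (\<Sum>l<N. \<integral>\<^sup>+s. (\<Prod>i=1..m. F l i (x i) (?\<Delta> s i)) \<partial>time_space m) \<partial>freq_space m)"
    using \<Delta>m by (simp add: nn_integral_cmult nn_integral_sum del: fun_upd_apply)
  also have "\<dots> = ennreal K * (\<Sum>l<N. \<integral>\<^sup>+x. \<integral>\<^sup>+s. (\<Prod>i=1..m. F l i (x i) (?\<Delta> s i)) \<partial>time_space m \<partial>freq_space m)"
    using nn_integral_frequency_chain(1)[of "F _", OF Fm]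
    by (subst nn_integral_cmult, intro borel_measurable_sum, assumption, subst nn_integral_sum)
      (auto simp del: fun_upd_apply)
  also have "\<dots> = ennreal K * (\<Sum>l<N. \<Prod>i=1..m. weight (\<kappa> / 2) H T (q l i) TYPE(real^'d))"
    unfolding nn_integral_frequency_chain(2)[of "F _", OF Fm] by (simp only: weight_def F_def[abs_def])
  also have "\<dots> \<le> ennreal K * (\<Sum>l<N. ennreal (W l))"
    using W(2) by (intro mult_left_mono sum_mono) auto
  also have "\<dots> = ennreal (K * (\<Sum>l<N. W l))"
    using W(1) by (subst ennreal_mult'[OF K(1)], subst sum_ennreal) auto
  finally have bound: "(\<integral>\<^sup>+p. ennreal (cmod (?\<Phi> p)) \<partial>?N) \<le> ennreal (K * (\<Sum>l<N. W l))" .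
  show int: "integrable ?N ?\<Phi>"
    using \<Phi>m bound by (intro integrableI_bounded) (auto intro: le_less_trans)
  have "ennreal (cmod (integral\<^sup>L ?N ?\<Phi>)) \<le> ennreal (K * (\<Sum>l<N. W l))"
    using integral_norm_bound_ennreal[OF int] bound by (rule order_trans)
  moreover have "0 \<le> K * (\<Sum>l<N. W l)"
    using W(1) K(1) by (intro mult_nonneg_nonneg sum_nonneg) auto
  ultimately show "cmod (integral\<^sup>L ?N ?\<Phi>) \<le> K * (\<Sum>l<N. W l)"
    by (simp add: ennreal_le_iff)
qed

lemma fourier_factor_measurable:
  fixes f :: "real^'d::finite \<Rightarrow> real"
  assumes "\<beta> \<in> {1, 2}" and "f \<in> Theta \<beta>" and k: "k \<le> m"
  shows "(\<lambda>x. fourier_factor f m k (x(m + 1 := 0))) \<in> borel_measurable (freq_space m)"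
proof -
  note bf = borel_measurable_fourier[OF assms(1,2)]
  have c: "(\<lambda>x. (x(m + 1 := 0)) i) \<in> borel_measurable (freq_space m :: (nat \<Rightarrow> real^'d) measure)"
    if "1 \<le> i" "i \<le> m + 1" for i
    using that by (cases "i = m + 1") (auto intro: measurable_component_singleton)
  have d: "(\<lambda>x. fourier f ((x(m + 1 := 0)) i) - fourier f 0) \<in> borel_measurable (freq_space m)"
    if "1 \<le> i" "i \<le> m + 1" for i
    using that by (intro borel_measurable_diff borel_measurable_const measurable_compose[OF c bf])
  have I: "(\<lambda>x. I_factor f k (x(m + 1 := 0))) \<in> borel_measurable (freq_space m)"
  proof -
    have sq: "(\<lambda>x. \<Prod>j=1..l. complex_of_real ((cmod (fourier f ((x(m + 1 := 0)) (2 * j)) - fourier f 0))\<^sup>2))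
        \<in> borel_measurable (freq_space m)" if "2 * l \<le> m" for l
    proof (rule borel_measurable_prod)
      fix j assume "j \<in> {1..l}"
      then have "1 \<le> 2 * j" "2 * j \<le> m + 1" using that by auto
      from d[OF this] show "(\<lambda>x. complex_of_real ((cmod (fourier f ((x(m + 1 := 0)) (2 * j)) - fourier f 0))\<^sup>2))
          \<in> borel_measurable (freq_space m)"
        by (rule measurable_compose[where g = "\<lambda>z. complex_of_real ((cmod z)\<^sup>2)"]) measurable
    qed
    have last: "(\<lambda>x. fourier f (- (x(m + 1 := 0)) (k + 1)) - fourier f 0) \<in> borel_measurable (freq_space m)"
      using k by (intro borel_measurable_diff borel_measurable_const
          measurable_compose[OF borel_measurable_uminus[OF c] bf]) auto
    consider "k = 0" | "odd k" | "k \<noteq> 0" "even k" by blast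
    then show ?thesis
    proof cases
      case 2
      have "2 * ((k - 1) div 2) \<le> m" using k by linarith
      moreover have "k \<noteq> 0" using 2 by (cases k) auto
      ultimately show ?thesis
        unfolding I_factor_def if_not_P[OF \<open>k \<noteq> 0\<close>] if_P[OF 2]
        by (intro borel_measurable_times sq last)
    next
      case 3
      have "2 * (k div 2) \<le> m" using k by linarith
      from sq[OF this] show ?thesis using 3 by (simp add: I_factor_def del: fun_upd_apply)
    qed (simp add: I_factor_def)
  qed
  have "(\<lambda>x. fourier f ((x(m + 1 := 0)) i - (x(m + 1 := 0)) (i + 1)) - fourier f 0) \<in> borel_measurable (freq_space m)"
    if "i \<in> {k+1..m}" for i
    using that by (intro borel_measurable_diff borel_measurable_const
        measurable_compose[OF borel_measurable_diff[OF c c] bf]) auto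
  then show ?thesis
    unfolding fourier_factor_def by (intro borel_measurable_times I borel_measurable_prod) auto
qed

lemma I_quantity_eq_frequency_integral:
  fixes X :: "real \<Rightarrow> 'w \<Rightarrow> real^'d::finite"
  assumes "integrable (freq_space m \<Otimes>\<^sub>M time_space m) (frequency_integrand M X H lam a b m n (fourier_factor f m k))"
  shows "I_quantity M X H f lam a b m k n =
     of_real (c_const m CARD('d) * ell n H CARD('d) ^ m / real n ^ m) *
     integral\<^sup>L (freq_space m \<Otimes>\<^sub>M time_space m) (frequency_integrand M X H lam a b m n (fourier_factor f m k))"
proof -
  interpret pair_sigma_finite "freq_space m :: (nat \<Rightarrow> real^'d) measure" "time_space m"
    by (rule pair_sigma_finite_freq_time)
  show ?thesis
    unfolding I_quantity_def set_lebesgue_integral_def integral_fst'[OF assms, symmetric]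
    by (simp add: frequency_integrand_def I_integrand_def fourier_factor_def kernel_def)
qed

section \<open>Bookkeeping of the powers of n and of the logarithms\<close>

text \<open>The normalisation contributes \<open>n powr (- m * (1 - H * d) / 2)\<close>, and \<open>1 - H * d = 2 * \<beta> * H\<close>.\<close>

lemma normalisation_identity:
  fixes H :: real
  assumes H: "H * (2 * real \<beta> + real d) = 1" and n: "n \<ge> 2" and m: "m \<ge> 1"
  shows "ell n H d ^ m / real n ^ m * (real n powr (H * real \<beta> * real m) * ln (real n) powr (real (m - 1) / 2))
    = ln (real n) powr (- 1/2)"
proof -
  have n0: "real n > 0" "ln (real n) > 0" using n by auto
  have e1: "(ln (real n) powr (- 1/2)) ^ m = ln (real n) powr (- 1/2 * real m)"
    using n0 by (simp add: powr_powr flip: powr_realpow)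
  have e2: "(real n powr ((H * real d + 1) / 2)) ^ m = real n powr ((H * real d + 1) / 2 * real m)"
    using n0 by (simp add: powr_powr flip: powr_realpow)
  have e3: "1 / real n ^ m = real n powr (- real m)"
    using n0 by (simp add: powr_minus powr_realpow inverse_eq_divide)
  have "ell n H d ^ m / real n ^ m * (real n powr (H * real \<beta> * real m) * ln (real n) powr (real (m - 1) / 2))
    = (ln (real n) powr (- 1/2)) ^ m * ln (real n) powr (real (m - 1) / 2)
      * ((real n powr ((H * real d + 1) / 2)) ^ m * (1 / real n ^ m) * real n powr (H * real \<beta> * real m))"
    by (simp add: ell_def power_mult_distrib)
  also have "\<dots> = ln (real n) powr (- 1/2 * real m + real (m - 1) / 2)
      * real n powr ((H * real d + 1) / 2 * real m + - real m + H * real \<beta> * real m)"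
    unfolding e1 e2 e3 by (simp only: powr_add)
  also have "- 1/2 * real m + real (m - 1) / 2 = - 1/2" using m by (simp add: of_nat_diff field_simps)
  also have "(H * real d + 1) / 2 * real m + - real m + H * real \<beta> * real m = 0"
  proof -
    have "(H * real d + 1) / 2 * real m + - real m + H * real \<beta> * real m
        = (H * (2 * real \<beta> + real d) - 1) / 2 * real m" by (simp add: field_simps)
    then show ?thesis using H by simp
  qed
  finally show ?thesis using n0 by simp
qed

section \<open>The bound for consecutive quantities\<close>

theorem proposition3p2:
  fixes M :: "'w measure"
    and X :: "real \<Rightarrow> 'w \<Rightarrow> real^'d::finite"
    and f :: "real^'d \<Rightarrow> real"
    and lam :: "real^'d"
    and H a b :: real
    and \<beta> m :: nat
  assumes "\<beta> \<in> {1, 2}"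
    and "H = 1 / (2 * real \<beta> + real CARD('d))"
    and "G_L M H X"
    and "f \<in> Theta \<beta>"
    and "0 \<le> a" and "a < b"
  shows "\<forall>k\<in>{1..m}. \<exists>c>0. \<forall>n\<ge>2.
           cmod (I_quantity M X H f lam a b m (k - 1) n - I_quantity M X H f lam a b m k n)
             \<le> c * (b - a) powr (real m * (1 - H * real CARD('d)) / 2)
                 * ln (real n) powr (- 1/2)"
proof
  fix k assume k: "k \<in> {1..m}"
  note \<beta> = assms(1) and G = assms(3) and f = assms(4) and a = assms(5)
  have m: "m \<ge> 1" using k by simp
  have \<beta>1: "\<beta> \<ge> 1" using \<beta> by auto
  have den: "2 * real \<beta> + real CARD('d) > 0" using \<beta> by auto
  have H: "H > 0" "H * real CARD('d) < 1" "H * (2 * real \<beta> + real CARD('d)) = 1"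
    using \<beta> den by (auto simp: assms(2) field_simps)
  have Hdim: "H = 1 / (2 * real \<beta> + real DIM(real^'d))" using assms(2) by simp
  (* increments are below n * b; enlarging b to B \<ge> 1 makes n * B at least 1, where the bound of a weight applies *)
  define B where "B = b + 1"
  have B: "B \<ge> 1" "\<And>n. real n * b \<le> real n * B" using assms(5,6) by (auto simp: B_def mult_left_mono)
  obtain \<kappa> where \<kappa>: "\<kappa> > 0" "\<And>x s. time_chain m s \<Longrightarrow>
      \<kappa> * (\<Sum>i=1..m. (norm (x i))\<^sup>2 * (s i - s (i - 1)) powr (2 * H))
        \<le> prob_space.variance M (\<lambda>\<omega>. \<Sum>i=1..m. x i \<bullet> (X (s i) \<omega> - X (s (i - 1)) \<omega>))"
    using G_L_variance_lower_bound[OF G H(1), of m] by blast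
  have \<kappa>2: "\<kappa> / 2 > 0" using \<kappa>(1) by simp
  let ?\<Phi> = "\<lambda>n \<Psi>. frequency_integrand M X H lam a b m n \<Psi>"
  let ?N = "(freq_space m :: (nat \<Rightarrow> real^'d) measure) \<Otimes>\<^sub>M time_space m"
  (* absolute convergence of each quantity: bounded Fourier factors, all exponents 0 *)
  have int: "integrable ?N (?\<Phi> n (fourier_factor f m j))" if n: "n \<ge> 2" and j: "j \<le> m" for n j
  proof -
    obtain K where K: "K > 0" "\<And>x. cmod (fourier_factor f m j x) \<le> K"
      using fourier_factor_bounded[OF \<beta> f] by blast
    define \<delta> where "\<delta> = 2 * real \<beta> * H"
    have \<delta>: "\<delta> \<ge> 0" "H * (real DIM(real^'d) + real 0) = 1 - \<delta>" "H * real DIM(real^'d) < 1"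
      using H by (auto simp: \<delta>_def algebra_simps)
    obtain C where C: "C > 0" "\<And>n::nat. n \<ge> 2 \<Longrightarrow> weight (\<kappa> / 2) H (real n * B) 0 TYPE(real^'d)
        \<le> ennreal (C * real n powr \<delta> * (if \<delta> = 0 then ln (real n) else 1))"
      using weight_bound[OF \<kappa>2 H(1) \<delta>(3) B(1) \<delta>(1,2)] by blast
    define w where "w = C * real n powr \<delta> * (if \<delta> = 0 then ln (real n) else 1)"
    have w: "0 \<le> w" using C n by (simp add: w_def)
    show ?thesis
    proof (rule frequency_integral_bound(1)[OF G a m \<kappa>(2) B(2) fourier_factor_measurable[OF \<beta> f j],
          where K = K and N = 1 and q = "\<lambda>_ _. 0" and W = "\<lambda>_. w ^ m"])
      show "(\<Prod>i=1..m. weight (\<kappa> / 2) H (real n * B) 0 TYPE(real^'d)) \<le> ennreal (w ^ m)"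
        using C(2)[OF n] w unfolding w_def[symmetric] by (simp add: ennreal_power[symmetric] power_mono)
    qed (use K w in auto)
  qed
  obtain K where K: "K > 0" "\<And>x. cmod (fourier_factor f m (k - 1) x - fourier_factor f m k x)
    \<le> K * (leading \<beta> k (\<lambda>i. trunc (x i)) * (\<Prod>i=k+1..m. trunc (x i) ^ \<beta> + trunc (x (i + 1)) ^ \<beta>))"
    using fourier_factor_difference_bound[OF \<beta> f k] by blast
  obtain N and q :: "nat \<Rightarrow> nat \<Rightarrow> nat" where q:
    "\<And>l i. l < N \<Longrightarrow> q l i \<le> 2 * \<beta>" "\<And>l. l < N \<Longrightarrow> 0 < q l k \<and> q l k < 2 * \<beta>"
    "\<And>l. l < N \<Longrightarrow> (\<Sum>i=1..m. q l i) = \<beta> * m"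
    "\<And>t. t (Suc m) = 0 \<Longrightarrow> leading \<beta> k t * (\<Prod>i=k+1..m. t i ^ \<beta> + t (i + 1) ^ \<beta>)
      = (\<Sum>l<N. \<Prod>i=1..m. t i ^ q l i)"
    using chain_expansion_vanishing_end[OF \<beta>1 k] by blast
  have "\<exists>C. \<forall>l\<in>{..<N}. C l > 0 \<and> (\<forall>n\<ge>2. (\<Prod>i=1..m. weight (\<kappa> / 2) H (real n * B) (q l i) TYPE(real^'d))
      \<le> ennreal (C l * real n powr (H * real \<beta> * real m) * ln (real n) powr (real (m - 1) / 2)))"
    using q k by (intro bchoice ballI weight_product_bound[OF \<beta> Hdim \<kappa>2 B(1), of k]) auto
  then obtain C where C: "\<And>l. l < N \<Longrightarrow> C l > 0"
    "\<And>l n. l < N \<Longrightarrow> n \<ge> 2 \<Longrightarrow> (\<Prod>i=1..m. weight (\<kappa> / 2) H (real n * B) (q l i) TYPE(real^'d))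
      \<le> ennreal (C l * real n powr (H * real \<beta> * real m) * ln (real n) powr (real (m - 1) / 2))"
    by blast
  define c0 where "c0 = c_const m CARD('d) * K * (\<Sum>l<N. C l)"
  have c0: "0 \<le> c0"
    using K(1) C(1) unfolding c0_def c_const_def by (intro mult_nonneg_nonneg sum_nonneg) (auto intro: less_imp_le)
  (* c may depend on a and b, so the power of b - a is divided out at the end *)
  define h where "h = (b - a) powr (real m * (1 - H * real CARD('d)) / 2)"
  have h: "h > 0" using assms(6) by (simp add: h_def)
  show "\<exists>c>0. \<forall>n\<ge>2. cmod (I_quantity M X H f lam a b m (k - 1) n - I_quantity M X H f lam a b m k n)
             \<le> c * (b - a) powr (real m * (1 - H * real CARD('d)) / 2) * ln (real n) powr (- 1/2)"
  proof (intro exI[of _ "(c0 + 1) / h"] conjI allI impI)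
    show "(c0 + 1) / h > 0" using c0 h by simp
    fix n :: nat assume n: "n \<ge> 2"
    let ?F = "\<lambda>x. fourier_factor f m (k - 1) x - fourier_factor f m k x"
    define g where "g = real n powr (H * real \<beta> * real m) * ln (real n) powr (real (m - 1) / 2)"
    have g: "0 \<le> g" by (simp add: g_def)
    define A where "A = ell n H CARD('d) ^ m / real n ^ m"
    have A: "0 \<le> A" by (simp add: A_def ell_def)
    have cc: "0 \<le> c_const m CARD('d)" by (simp add: c_const_def)
    have i1: "integrable ?N (?\<Phi> n (fourier_factor f m (k - 1)))" and i2: "integrable ?N (?\<Phi> n (fourier_factor f m k))"
      using int[OF n] k by auto
    have "?\<Phi> n ?F = (\<lambda>p. ?\<Phi> n (fourier_factor f m (k - 1)) p - ?\<Phi> n (fourier_factor f m k) p)"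
      by (rule ext) (simp add: frequency_integrand_def left_diff_distrib scaleR_diff_right case_prod_unfold)
    then have dif: "integral\<^sup>L ?N (?\<Phi> n (fourier_factor f m (k - 1))) - integral\<^sup>L ?N (?\<Phi> n (fourier_factor f m k))
        = integral\<^sup>L ?N (?\<Phi> n ?F)"
      by (simp only: Bochner_Integration.integral_diff[OF i1 i2])
    have bnd: "cmod (integral\<^sup>L ?N (?\<Phi> n ?F)) \<le> K * (\<Sum>l<N. C l * g)"
    proof (rule frequency_integral_bound(2)[OF G a m \<kappa>(2) B(2), where q = q])
      show "(\<lambda>x. ?F (x(m + 1 := 0))) \<in> borel_measurable (freq_space m)"
        using k by (intro borel_measurable_diff fourier_factor_measurable[OF \<beta> f]) auto
      show "0 \<le> K" using K(1) by simp
      show "cmod (?F x) \<le> K * (\<Sum>l<N. \<Prod>i=1..m. trunc (x i) ^ q l i)" if "x (m + 1) = 0" for x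
        using K(2)[of x] q(4)[of "\<lambda>i. trunc (x i)"] that by simp
      show "0 \<le> C l * g" if "l < N" for l using C(1)[OF that] g by simp
      show "(\<Prod>i=1..m. weight (\<kappa> / 2) H (real n * B) (q l i) TYPE(real^'d)) \<le> ennreal (C l * g)" if "l < N" for l
        using C(2)[OF that n] by (simp add: g_def mult.assoc)
    qed
    have cA: "c_const m CARD('d) * ell n H CARD('d) ^ m / real n ^ m = c_const m CARD('d) * A"
      by (simp add: A_def)
    have "cmod (I_quantity M X H f lam a b m (k - 1) n - I_quantity M X H f lam a b m k n)
        = c_const m CARD('d) * A * cmod (integral\<^sup>L ?N (?\<Phi> n ?F))"
      unfolding I_quantity_eq_frequency_integral[OF i1] I_quantity_eq_frequency_integral[OF i2]
        right_diff_distrib[symmetric] dif norm_mult cA norm_of_real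
      using A cc by (simp add: abs_mult)
    also have "\<dots> \<le> c_const m CARD('d) * A * (K * (\<Sum>l<N. C l * g))"
      using A cc bnd by (intro mult_left_mono) auto
    also have "\<dots> = c0 * (A * g)"
    proof -
      have "(\<Sum>l<N. C l * g) = (\<Sum>l<N. C l) * g" by (rule sum_distrib_right[symmetric])
      then show ?thesis by (simp add: c0_def mult_ac)
    qed
    also have "A * g = ln (real n) powr (- 1/2)"
      unfolding A_def g_def by (rule normalisation_identity[OF H(3) n m])
    also have "c0 * ln (real n) powr (- 1/2) \<le> (c0 + 1) * ln (real n) powr (- 1/2)"
      by (intro mult_right_mono) auto
    also have "\<dots> = (c0 + 1) / h * h * ln (real n) powr (- 1/2)" using h by simp
    finally show "cmod (I_quantity M X H f lam a b m (k - 1) n - I_quantity M X H f lam a b m k n)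
        \<le> (c0 + 1) / h * (b - a) powr (real m * (1 - H * real CARD('d)) / 2) * ln (real n) powr (- 1/2)"
      by (simp only: h_def)
  qed
qed

end
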